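(* Let $T$ be an operator defined on an appropriate class of functions on $\mathbb{R}^n$ (e.g. $C_c^\infty$ or $\bigcup_p L^p(w^p)$); $T$ is not required to be linear. Suppose that $p_0$ and $q_0$ are exponents with $1\le p_0\le q_0<\infty$, and that there are constants $\gamma>0$ and $c>0$ such that $$\|w\,Tf\|_{L^{q_0}(\mathbb{R}^n)}\le c\,[w]_{A_{p_0,q_0}}^{\gamma}\,\|wf\|_{L^{p_0}(\mathbb{R}^n)}$$ holds for all $w\in A_{p_0,q_0}$ and all $f$ in the class. Then, for all $p,q$ satisfying $1<p\le q<\infty$ and $$\frac1p-\frac1q=\frac1{p_0}-\frac1{q_0},$$ there is a constant $C$, independent of $w$ and $f$, such that $$\|w\,Tf\|_{L^{q}(\mathbb{R}^n)}\le C\,[w]_{A_{p,q}}^{\gamma\max\left\{1,\frac{q_0}{p_0'}\frac{p'}{q}\right\}}\,\|wf\|_{L^{p}(\mathbb{R}^n)}$$ holds for all weights $w\in A_{p,q}$ and all $f$ in the class.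
   Context: A weight is a non-negative locally integrable function on $\mathbb{R}^n$. For an exponent $p$, $p'$ is defined by $1/p+1/p'=1$ (for $p_0=1$, $p_0'=\infty$ and $q_0/p_0'=0$). Cubes have sides parallel to the axes. For $1<p\le q<\infty$, a weight $w$ belongs to $A_{p,q}$ if $$[w]_{A_{p,q}}=\sup_Q\left(\frac1{|Q|}\int_Q w^q\,dx\right)\left(\frac1{|Q|}\int_Q w^{-p'}\,dx\right)^{q/p'}<\infty,$$ the supremum being over all cubes $Q$. For $1\le q<\infty$, $w\in A_{1,q}$ if there is a constant $c$ with $\frac1{|Q|}\int_Q w^q\,dx\le c\,\inf_Q w^q$ (essential infimum) for all cubes $Q$, and $[w]_{A_{1,q}}$ is the smallest such $c$. *)

theory Defs
  imports "HOL-Analysis.Analysis"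
begin

(* Real powers on [0,\<infinity>].  Negative powers of 0 are \<infinity>, so that w^(-p') is
   infinite where the weight w vanishes. *)
definition epowr :: "ennreal \<Rightarrow> real \<Rightarrow> ennreal" where
  "epowr x a =
     (if a = 0 then 1
      else if x = 0 then (if a > 0 then 0 else \<infinity>)
      else if x = \<infinity> then (if a > 0 then \<infinity> else 0)
      else ennreal (enn2real x powr a))"

(* Defined by 1/p + 1/p' = 1.  For p = 1, where p' = \<infinity>, division by zero gives
   conj_exp 1 = 0 and hence q / conj_exp 1 = 0, which is the convention q/p' = 0. *)
definition conj_exp :: "real \<Rightarrow> real" where
  "conj_exp p = 1 / (1 - 1 / p)"

definition cubes :: "(real ^ 'n) set set" where
  "cubes = {cbox a (a + vec l) | a l. 0 < l}"

definition avg :: "(real ^ 'n) set \<Rightarrow> (real ^ 'n \<Rightarrow> ennreal) \<Rightarrow> ennreal" where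
  "avg Q g = (\<integral>\<^sup>+x\<in>Q. g x \<partial>lebesgue) / emeasure lebesgue Q"

definition ess_inf :: "(real ^ 'n) set \<Rightarrow> (real ^ 'n \<Rightarrow> ennreal) \<Rightarrow> ennreal" where
  "ess_inf Q g = Sup {m. AE x in lebesgue. x \<in> Q \<longrightarrow> m \<le> g x}"

definition weight :: "(real ^ 'n \<Rightarrow> real) \<Rightarrow> bool" where
  "weight w \<longleftrightarrow> (\<forall>x. 0 \<le> w x) \<and> (\<forall>K. compact K \<longrightarrow> set_integrable lebesgue K w)"

(* In the case p = 1 the infimum ranges over [0,\<infinity>]; it is finite iff some finite
   constant is admissible, and it is then the smallest admissible one.
   Products use 0 * \<infinity> = 0, so w = 0 a.e. is allowed and has constant 0. *)
definition Apq_const :: "real \<Rightarrow> real \<Rightarrow> (real ^ 'n \<Rightarrow> real) \<Rightarrow> ennreal" where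
  "Apq_const p q w =
     (if p = 1 then
        Inf {c. \<forall>Q\<in>cubes. avg Q (\<lambda>x. epowr (ennreal (w x)) q)
                             \<le> c * ess_inf Q (\<lambda>x. epowr (ennreal (w x)) q)}
      else
        (SUP Q\<in>cubes. avg Q (\<lambda>x. epowr (ennreal (w x)) q)
           * epowr (avg Q (\<lambda>x. epowr (ennreal (w x)) (- conj_exp p))) (q / conj_exp p)))"

definition Apq :: "real \<Rightarrow> real \<Rightarrow> (real ^ 'n \<Rightarrow> real) set" where
  "Apq p q = {w. weight w \<and> Apq_const p q w < \<infinity>}"

definition Lp_norm :: "real \<Rightarrow> (real ^ 'n \<Rightarrow> complex) \<Rightarrow> ennreal" where
  "Lp_norm p f = epowr (\<integral>\<^sup>+x. epowr (ennreal (norm (f x))) p \<partial>lebesgue) (1 / p)"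

end

theory Submission
  imports Defs
begin

text \<open>
  Pass from \<open>w\<close> to \<open>W = w\<^sup>q\<close> and put \<open>r = 1 + q/p'\<close>.  Then \<open>[w]\<close> in \<open>A(p,q)\<close> is the
  Muckenhoupt constant \<open>[W]\<close> in \<open>A(r)\<close>, and since \<open>1/p - 1/q\<close> is the same for both pairs of
  exponents, so is \<open>r/q\<close>.  The assertion becomes an extrapolation from \<open>A(r0)\<close> to \<open>A(r)\<close> whose
  exponent is \<open>\<gamma>\<close> times the larger of \<open>1\<close> and \<open>(r0 - 1)/(r - 1)\<close>.  For \<open>q = q0\<close> there is nothing
  to prove, since then \<open>p = p0\<close>.

  The weight to which the hypothesis is applied comes from the Rubio de Francia algorithm: iterating
  a maximal operator on a function \<open>h\<close> of \<open>L\<^sup>r(W)\<close> and summing a geometric series gives a majorant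
  \<open>u\<close> of \<open>h\<close> of comparable norm, which is an \<open>A(1)\<close> weight whose constant is bounded by a multiple
  of the norm of the maximal operator on \<open>L\<^sup>r(W)\<close> (\<open>rubio_de_francia\<close>).  If \<open>r < r0\<close>, then
  \<open>V = W u\<^bsup>r-r0\<^esup>\<close> is in \<open>A(r0)\<close>; with \<open>h\<close> a suitable product of powers of \<open>|f|\<close> and \<open>W\<close>, the bound
  \<open>u \<ge> h\<close> and Hoelder's inequality turn the hypothesis for \<open>V\<close> into the conclusion for \<open>W\<close>
  (\<open>extrapolation_down\<close>).  If \<open>r > r0\<close>, the algorithm runs in the dual space, on a function built
  from \<open>|Tf|\<close>, and \<open>V = W\<^sup>t u\<^bsup>1-t\<^esup>\<close> with \<open>t = (r0 - 1)/(r - 1)\<close> (\<open>extrapolation_up_aux\<close>).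

  The power of \<open>[W]\<close> is right because the maximal operator has norm at most a constant times
  \<open>[W]\<^bsup>1/(r-1)\<^esup>\<close> on \<open>L\<^sup>r(W)\<close>, which is Buckley's theorem (\<open>dmax_bound\<close>).  For \<open>r < r0\<close> this gives
  \<open>[V]\<close> at most a constant times \<open>[W] [W]\<^bsup>(r0-r)/(r-1)\<^esup> = [W]\<^bsup>(r0-1)/(r-1)\<^esup>\<close>.  For \<open>r > r0\<close> the dual
  weight has its constant equal to \<open>[W]\<^bsup>1/(r-1)\<^esup>\<close> in \<open>A(r')\<close>, hence the norm there is at most a
  constant times \<open>[W]\<close>, and \<open>[V]\<close> at most a constant times \<open>[W]\<^sup>t [W]\<^bsup>1-t\<^esup> = [W]\<close>.

  Buckley's theorem is obtained by Lerner's argument.  With \<open>\<sigma> = W\<^bsup>-1/(r-1)\<^esup>\<close>, the maximal function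
  over a dyadic grid satisfies, pointwise, the bound
  \<open>(M f)\<^bsup>r-1\<^esup> \<le> [W] M\<^sub>W(M\<^sub>\<sigma>(f/\<sigma>)\<^bsup>r-1\<^esup>/W)\<close>, where \<open>M\<^sub>W\<close> and \<open>M\<^sub>\<sigma>\<close> average with respect to
  \<open>W dx\<close> and \<open>\<sigma> dx\<close>; and maximal operators over nested families are bounded on every \<open>L\<^sup>t(\<mu>)\<close>,
  \<open>t > 1\<close>, with a constant that depends on \<open>t\<close> alone (Doob's inequality, \<open>doob_maxop\<close>).  Finitely
  many dyadic grids suffice to see all cubes (\<open>cube_subset_grid\<close>).
\<close>

section \<open>Powers of extended non-negative numbers\<close>

text \<open>For non-negative exponents all the usual laws of powers hold on \<open>[0,\<infinity>]\<close> without exception, since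
  \<open>0 * \<infinity> = 0\<close>.  Negative exponents are applied to positive real bases, except where it is
  shown that a weight cannot vanish on a part of the space only.\<close>

lemma ennreal_zero_top_pos:
  obtains "x = 0" | "x = \<infinity>" | r where "0 < r" "x = ennreal r"
  by (cases x) (metis ennreal_0 infinity_ennreal_def order_le_less)+

lemma epowr_simps [simp]:
  "epowr x 0 = 1" "0 < a \<Longrightarrow> epowr 0 a = 0" "0 < a \<Longrightarrow> epowr \<infinity> a = \<infinity>"
  "0 < a \<Longrightarrow> epowr top a = top" "epowr 1 a = 1"
  by (auto simp: epowr_def)

lemma epowr_one [simp]: "epowr x 1 = x"
  by (cases x rule: ennreal_zero_top_pos) (auto simp: epowr_def)

lemma epowr_ennreal_pos: "0 < r \<Longrightarrow> epowr (ennreal r) a = ennreal (r powr a)"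
  by (auto simp: epowr_def)

lemma epowr_ennreal: "0 \<le> r \<Longrightarrow> 0 < a \<Longrightarrow> epowr (ennreal r) a = ennreal (r powr a)"
  by (cases "r = 0") (auto simp: epowr_ennreal_pos)

lemma epowr_eq_0_iff: "0 < a \<Longrightarrow> epowr x a = 0 \<longleftrightarrow> x = 0"
  by (cases x rule: ennreal_zero_top_pos) (auto simp: epowr_ennreal_pos)

lemma epowr_eq_top_iff: "0 < a \<Longrightarrow> epowr x a = top \<longleftrightarrow> x = top"
  by (cases x rule: ennreal_zero_top_pos) (auto simp: epowr_ennreal_pos)

lemma epowr_less_top_iff [simp]: "0 < a \<Longrightarrow> epowr x a < top \<longleftrightarrow> x < top"
  using epowr_eq_top_iff[of a x] by (metis top.not_eq_extremum)

lemma epowr_mult: "0 \<le> a \<Longrightarrow> epowr (x * y) a = epowr x a * epowr y a"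
proof (cases "a = 0")
  case False
  assume "0 \<le> a"
  with False have "0 < a" by simp
  then show ?thesis
    by (cases x rule: ennreal_zero_top_pos; cases y rule: ennreal_zero_top_pos)
      (auto simp: epowr_ennreal_pos ennreal_mult_top ennreal_top_mult powr_mult
        simp flip: ennreal_mult)
qed simp

lemma epowr_add: "0 \<le> a \<Longrightarrow> 0 \<le> b \<Longrightarrow> epowr x (a + b) = epowr x a * epowr x b"
proof (cases "a = 0 \<or> b = 0")
  case False
  assume "0 \<le> a" "0 \<le> b"
  with False have "0 < a" "0 < b" by auto
  then show ?thesis
    by (cases x rule: ennreal_zero_top_pos)
      (auto simp: epowr_ennreal_pos powr_add ennreal_mult ennreal_mult_top ennreal_top_mult)
qed auto

lemma epowr_epowr: "0 \<le> a \<Longrightarrow> 0 \<le> b \<Longrightarrow> epowr (epowr x a) b = epowr x (a * b)"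
proof (cases "a = 0 \<or> b = 0")
  case False
  assume "0 \<le> a" "0 \<le> b"
  with False have "0 < a" "0 < b" by auto
  then show ?thesis
    by (cases x rule: ennreal_zero_top_pos) (auto simp: epowr_ennreal_pos powr_powr)
qed auto

lemma epowr_mono: "0 \<le> a \<Longrightarrow> x \<le> y \<Longrightarrow> epowr x a \<le> epowr y a"
proof (cases "a = 0")
  case False
  assume "0 \<le> a" "x \<le> y"
  with False have "0 < a" by simp
  with \<open>x \<le> y\<close> show ?thesis
    by (cases x rule: ennreal_zero_top_pos; cases y rule: ennreal_zero_top_pos)
      (auto simp: epowr_ennreal_pos top_unique intro!: powr_mono2)
qed simp

text \<open>A positive power is an order isomorphism of \<open>[0,\<infinity>]\<close>, with the inverse power as inverse.\<close>

lemma epowr_SUP: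
  assumes "0 < a"
  shows "epowr (SUP i\<in>I. g i) a = (SUP i\<in>I. epowr (g i) a)"
proof (rule antisym)
  have "g i \<le> epowr (SUP i\<in>I. epowr (g i) a) (1/a)" if "i \<in> I" for i
  proof -
    have "epowr (g i) a \<le> (SUP i\<in>I. epowr (g i) a)" using that by (rule SUP_upper)
    from epowr_mono[OF _ this, of "1/a"] show ?thesis using assms by (simp add: epowr_epowr)
  qed
  then have "(SUP i\<in>I. g i) \<le> epowr (SUP i\<in>I. epowr (g i) a) (1/a)" by (rule SUP_least)
  from epowr_mono[OF _ this, of a]
  show "epowr (SUP i\<in>I. g i) a \<le> (SUP i\<in>I. epowr (g i) a)"
    using assms by (simp add: epowr_epowr)
  show "(SUP i\<in>I. epowr (g i) a) \<le> epowr (SUP i\<in>I. g i) a"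
    using assms by (intro SUP_least epowr_mono SUP_upper) auto
qed

lemma measurable_epowr [measurable]:
  "f \<in> borel_measurable M \<Longrightarrow> (\<lambda>x. epowr (f x) a) \<in> borel_measurable M"
proof -
  assume [measurable]: "f \<in> borel_measurable M"
  have "(\<lambda>y. epowr y a) \<in> borel_measurable borel"
    unfolding epowr_def
    by (intro measurable_If borel_measurable_const pred_sets1)
      (simp_all add: measurable_compose[OF borel_measurable_enn2real])
  then show "(\<lambda>x. epowr (f x) a) \<in> borel_measurable M"
    by (rule measurable_compose[rotated]) fact
qed

section \<open>Hoelder's inequality\<close>

lemma ennreal_Youngs_inequality:
  assumes "0 < t" "t < 1"
  shows "epowr x t * epowr y (1 - t) \<le> ennreal t * x + ennreal (1 - t) * y"
proof (cases x rule: ennreal_zero_top_pos)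
  case 1 then show ?thesis using assms by simp
next
  case 2 then show ?thesis using assms by (simp add: ennreal_mult_top)
next
  case x: (3 r)
  show ?thesis
  proof (cases y rule: ennreal_zero_top_pos)
    case (3 s)
    have "r powr t * s powr (1 - t) \<le> t * r + (1 - t) * s"
      using assms x 3 by (intro Youngs_inequality_0) auto
    then show ?thesis using x 3 assms
      by (simp add: epowr_ennreal_pos flip: ennreal_mult ennreal_plus)
  qed (use assms x in \<open>auto simp: ennreal_mult_top\<close>)
qed

text \<open>The interpolation form of Hoelder's inequality.  If one of the integrals on the right is zero, then
  so is the left side; the right side is zero as well, even if the other integral is infinite.\<close>

lemma nn_integral_Hoelder:
  assumes t: "0 < t" "t < 1"
    and [measurable]: "F \<in> borel_measurable M" "G \<in> borel_measurable M"
  shows "(\<integral>\<^sup>+x. epowr (F x) t * epowr (G x) (1 - t) \<partial>M)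
      \<le> epowr (\<integral>\<^sup>+x. F x \<partial>M) t * epowr (\<integral>\<^sup>+x. G x \<partial>M) (1 - t)"
proof -
  consider "(\<integral>\<^sup>+x. F x \<partial>M) = 0 \<or> (\<integral>\<^sup>+x. G x \<partial>M) = 0"
    | "(\<integral>\<^sup>+x. F x \<partial>M) \<noteq> 0" "(\<integral>\<^sup>+x. G x \<partial>M) \<noteq> 0"
      "(\<integral>\<^sup>+x. F x \<partial>M) = \<infinity> \<or> (\<integral>\<^sup>+x. G x \<partial>M) = \<infinity>"
    | a b where "0 < a" "0 < b" "(\<integral>\<^sup>+x. F x \<partial>M) = ennreal a" "(\<integral>\<^sup>+x. G x \<partial>M) = ennreal b"
    by (cases "\<integral>\<^sup>+x. F x \<partial>M" rule: ennreal_zero_top_pos;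
        cases "\<integral>\<^sup>+x. G x \<partial>M" rule: ennreal_zero_top_pos) auto
  then show ?thesis
  proof cases
    case 1
    then have "AE x in M. F x = 0 \<or> G x = 0"
      by (auto simp: nn_integral_0_iff_AE)
    then have "AE x in M. epowr (F x) t * epowr (G x) (1 - t) = 0"
      by eventually_elim (use t in auto)
    then have "(\<integral>\<^sup>+x. epowr (F x) t * epowr (G x) (1 - t) \<partial>M) = 0"
      by (subst nn_integral_0_iff_AE) auto
    then show ?thesis by simp
  next
    case 2
    then show ?thesis using t
      by (auto simp: ennreal_mult_top ennreal_top_mult epowr_eq_0_iff)
  next
    case (3 a b)
    let ?k = "ennreal (a powr t * b powr (1 - t))"
    have pw: "epowr (F x) t * epowr (G x) (1 - t)
        \<le> ?k * (ennreal (t / a) * F x + ennreal ((1 - t) / b) * G x)" for x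
    proof -
      have F: "F x = ennreal a * (ennreal (1 / a) * F x)" and G: "G x = ennreal b * (ennreal (1 / b) * G x)"
        using 3 by (auto simp flip: mult.assoc ennreal_mult)
      have "epowr (F x) t * epowr (G x) (1 - t)
          = ?k * (epowr (ennreal (1 / a) * F x) t * epowr (ennreal (1 / b) * G x) (1 - t))"
        by (subst F, subst G, subst (1 2) epowr_mult)
          (use t 3 in \<open>auto simp: epowr_ennreal_pos ennreal_mult ac_simps\<close>)
      also have "\<dots> \<le> ?k * (ennreal t * (ennreal (1 / a) * F x) + ennreal (1 - t) * (ennreal (1 / b) * G x))"
        by (intro mult_left_mono ennreal_Youngs_inequality t) auto
      also have "\<dots> = ?k * (ennreal (t / a) * F x + ennreal ((1 - t) / b) * G x)"
        using t 3 by (simp flip: mult.assoc ennreal_mult)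
      finally show ?thesis .
    qed
    have "(\<integral>\<^sup>+x. epowr (F x) t * epowr (G x) (1 - t) \<partial>M)
        \<le> (\<integral>\<^sup>+x. ?k * (ennreal (t / a) * F x + ennreal ((1 - t) / b) * G x) \<partial>M)"
      by (intro nn_integral_mono pw)
    also have "\<dots> = ?k * (ennreal (t / a) * ennreal a + ennreal ((1 - t) / b) * ennreal b)"
      by (simp add: nn_integral_cmult nn_integral_add 3)
    also have "\<dots> = ?k"
      using t 3 by (simp flip: ennreal_mult ennreal_plus)
    also have "\<dots> = epowr (\<integral>\<^sup>+x. F x \<partial>M) t * epowr (\<integral>\<^sup>+x. G x \<partial>M) (1 - t)"
      using 3 by (simp add: epowr_ennreal_pos ennreal_mult)
    finally show ?thesis .
  qed
qed

section \<open>Maximal functions over nested families\<close>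

text \<open>The maximal function over the members of \<open>F\<close> that contain the point.  It is written with
  indicators so that measurability and suprema over subfamilies are immediate.\<close>

definition maxop :: "'a measure \<Rightarrow> 'a set set \<Rightarrow> ('a \<Rightarrow> ennreal) \<Rightarrow> 'a \<Rightarrow> ennreal" where
  "maxop M F f x = (SUP Q\<in>F. (\<integral>\<^sup>+y\<in>Q. f y \<partial>M) / emeasure M Q * indicator Q x)"

definition laminar :: "'a set set \<Rightarrow> bool" where
  "laminar F \<longleftrightarrow> (\<forall>P\<in>F. \<forall>Q\<in>F. P \<inter> Q = {} \<or> P \<subseteq> Q \<or> Q \<subseteq> P)"

definition averaging :: "'a measure \<Rightarrow> 'a set set \<Rightarrow> bool" where
  "averaging M F \<longleftrightarrow> (\<forall>Q\<in>F. Q \<in> sets M \<and> 0 < emeasure M Q \<and> emeasure M Q < \<infinity>)"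

lemma laminar_subset: "laminar F \<Longrightarrow> G \<subseteq> F \<Longrightarrow> laminar G"
  unfolding laminar_def by blast

lemma averaging_subset: "averaging M F \<Longrightarrow> G \<subseteq> F \<Longrightarrow> averaging M G"
  unfolding averaging_def by blast

lemma measurable_maxop [measurable (raw)]:
  assumes "countable F" "averaging M F"
  shows "maxop M F f \<in> borel_measurable M"
  unfolding maxop_def[abs_def] using assms
  by (intro borel_measurable_SUP borel_measurable_times_ennreal) (auto simp: averaging_def)

lemma avg_le_maxop:
  "Q \<in> F \<Longrightarrow> x \<in> Q \<Longrightarrow> (\<integral>\<^sup>+y\<in>Q. f y \<partial>M) / emeasure M Q \<le> maxop M F f x"
  unfolding maxop_def by (rule SUP_upper2[of Q]) auto

lemma maxop_finite:
  assumes "finite F" "averaging M F" "\<And>Q. Q \<in> F \<Longrightarrow> (\<integral>\<^sup>+y\<in>Q. f y \<partial>M) < \<infinity>"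
  shows "maxop M F f x < \<infinity>"
  using assms
proof (induction F)
  case empty then show ?case by (simp add: maxop_def bot_ennreal)
next
  case (insert Q F)
  have "maxop M (insert Q F) f x
      = max ((\<integral>\<^sup>+y\<in>Q. f y \<partial>M) / emeasure M Q * indicator Q x) (maxop M F f x)"
    by (simp add: maxop_def sup_max)
  moreover have "(\<integral>\<^sup>+y\<in>Q. f y \<partial>M) / emeasure M Q * indicator Q x < \<infinity>"
    using insert.prems
    by (auto simp: averaging_def ennreal_mult_less_top ennreal_divide_eq_top_iff
        less_top[symmetric] split: split_indicator)
  moreover have "maxop M F f x < \<infinity>"
    using insert averaging_subset[of M "insert Q F" F] by auto
  ultimately show ?case by simp
qed

text \<open>The inequality between averages that makes the induction below work is Young's inequality
  for \<open>a m\<^bsup>t-1\<^esup>\<close>.\<close>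

lemma doob_step_real:
  fixes a m t :: real
  assumes "1 < t" "0 \<le> m" "0 \<le> a"
  shows "a powr t + t / (t - 1) * (a * m powr (t - 1)) \<le> m powr t + t / (t - 1) * a powr t"
proof -
  have "a * m powr (t - 1) \<le> a powr t / t + (m powr (t - 1)) powr (t / (t - 1)) / (t / (t - 1))"
    using assms by (intro Youngs_inequality) (auto simp: field_simps)
  also have "(m powr (t - 1)) powr (t / (t - 1)) = m powr t"
    using assms by (simp add: powr_powr)
  finally have "t / (t - 1) * (a * m powr (t - 1)) \<le> t / (t - 1) * (a powr t / t + m powr t / (t / (t - 1)))"
    using assms by (intro mult_left_mono) auto
  also have "\<dots> = m powr t + (t / (t - 1) - 1) * a powr t"
    using assms by (simp add: field_simps)
  finally show ?thesis by (simp add: algebra_simps)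
qed

lemma doob_step:
  fixes a m :: ennreal
  assumes "1 < t" "m < \<infinity>" "a < \<infinity>"
  shows "epowr a t + ennreal (t / (t - 1)) * (a * epowr m (t - 1))
     \<le> epowr m t + ennreal (t / (t - 1)) * epowr a t"
proof -
  obtain a' m' where *: "a = ennreal a'" "m = ennreal m'" "0 \<le> a'" "0 \<le> m'"
    using assms by (cases a; cases m) auto
  then show ?thesis
    using doob_step_real[of t m' a'] assms
    by (simp add: epowr_ennreal flip: ennreal_mult ennreal_plus)
qed

lemma nn_integral_split_set:
  assumes "Q \<in> sets M" "g \<in> borel_measurable M" "\<And>x. x \<in> Q \<Longrightarrow> g x = h x * c"
    and "h \<in> borel_measurable M"
  shows "(\<integral>\<^sup>+x. g x \<partial>M) = (\<integral>\<^sup>+x\<in>-Q. g x \<partial>M) + c * (\<integral>\<^sup>+x\<in>Q. h x \<partial>M)"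
proof -
  have Qc [measurable]: "Q \<in> sets M" by fact
  note [measurable] = assms(2,4)
  have "(\<integral>\<^sup>+x. g x \<partial>M) = (\<integral>\<^sup>+x. g x * indicator (-Q) x + c * (h x * indicator Q x) \<partial>M)"
    by (intro nn_integral_cong) (auto split: split_indicator simp: assms(3) ac_simps)
  also have "\<dots> = (\<integral>\<^sup>+x. g x * indicator (-Q) x \<partial>M) + (\<integral>\<^sup>+x. c * (h x * indicator Q x) \<partial>M)"
  proof (rule nn_integral_add)
    have "(\<lambda>x. g x * indicator (space M - Q) x) \<in> borel_measurable M" by measurable
    also have "?this \<longleftrightarrow> (\<lambda>x. g x * indicator (- Q) x) \<in> borel_measurable M"
      by (intro measurable_cong) (auto split: split_indicator)
    finally show "(\<lambda>x. g x * indicator (- Q) x) \<in> borel_measurable M" .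
  qed auto
  also have "(\<integral>\<^sup>+x. c * (h x * indicator Q x) \<partial>M) = c * (\<integral>\<^sup>+x\<in>Q. h x \<partial>M)"
    by (rule nn_integral_cmult) auto
  finally show ?thesis .
qed

text \<open>Doob's inequality for a finite family, before absorption.  A minimal member \<open>Q\<close> can be added to
  the rest of the family by changing the maximal function on \<open>Q\<close> only, where it was a constant \<open>m\<close>
  and becomes \<open>max m a\<close>, with \<open>a\<close> the average of \<open>f\<close> over \<open>Q\<close>.  If \<open>a > m\<close>, the two sides change by
  the terms that \<open>doob_step\<close> compares, so the inequality survives.\<close>

lemma doob_maxop_aux:
  assumes "finite F" "laminar F" "averaging M F" "1 < t"
    and [measurable]: "f \<in> borel_measurable M"
    and fin: "\<And>Q. Q \<in> F \<Longrightarrow> (\<integral>\<^sup>+y\<in>Q. f y \<partial>M) < \<infinity>"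
  shows "(\<integral>\<^sup>+x. epowr (maxop M F f x) t \<partial>M) < \<infinity> \<and>
    (\<integral>\<^sup>+x. epowr (maxop M F f x) t \<partial>M)
      \<le> ennreal (t / (t - 1)) * (\<integral>\<^sup>+x. f x * epowr (maxop M F f x) (t - 1) \<partial>M)"
  using assms(1-3) fin
proof (induction "card F" arbitrary: F)
  case 0
  then have "F = {}" by simp
  then show ?case using \<open>1 < t\<close> by (simp add: maxop_def bot_ennreal)
next
  case (Suc n)
  then have "F \<noteq> {}" by auto
  from finite_has_minimal[OF \<open>finite F\<close> this] obtain Q
    where Q: "Q \<in> F" "\<And>P. P \<in> F \<Longrightarrow> P \<subseteq> Q \<Longrightarrow> P = Q" by metis
  define G where "G = F - {Q}"
  have G: "finite G" "laminar G" "averaging M G" "n = card G"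
    using Suc Q(1) laminar_subset[of F G] averaging_subset[of M F G] by (auto simp: G_def)
  note IH = Suc(1)[OF G(4) G(1-3)]
  have finG: "(\<integral>\<^sup>+y\<in>P. f y \<partial>M) < \<infinity>" if "P \<in> G" for P using Suc(6)[of P] that by (auto simp: G_def)
  have Qm [measurable]: "Q \<in> sets M" and Qpos: "emeasure M Q \<noteq> 0" and Qfin: "emeasure M Q < \<infinity>"
    using Suc(5) Q(1) by (auto simp: averaging_def)
  let ?N = "maxop M G f" and ?X = "maxop M F f"
  have [measurable]: "?N \<in> borel_measurable M" "?X \<in> borel_measurable M"
    using Suc(3,5) G by (auto intro!: measurable_maxop countable_finite)
  define a where "a = (\<integral>\<^sup>+y\<in>Q. f y \<partial>M) / emeasure M Q"
  have a: "a < \<infinity>" "(\<integral>\<^sup>+y\<in>Q. f y \<partial>M) = a * emeasure M Q"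
    using Suc(6)[OF Q(1)] Qpos Qfin
    by (auto simp: a_def ennreal_divide_eq_top_iff less_top[symmetric] ennreal_divide_times)
  have XN: "?X x = max (a * indicator Q x) (?N x)" for x
  proof -
    have "F = insert Q G" using Q(1) by (auto simp: G_def)
    then show ?thesis by (simp add: maxop_def a_def sup_max)
  qed
  obtain x0 where "x0 \<in> Q" using Qpos by fastforce
  define m where "m = ?N x0"
  \<comment> \<open>By minimality every other member of the family contains \<open>Q\<close> or misses it.\<close>
  have Nm: "?N x = m" if "x \<in> Q" for x
  proof -
    have "indicator P x = (indicator P x0 :: ennreal)" if "P \<in> G" for P
    proof -
      have "P \<inter> Q = {} \<or> P \<subseteq> Q \<or> Q \<subseteq> P" "P \<in> F" "P \<noteq> Q"
        using Suc(4) Q(1) that by (auto simp: laminar_def G_def)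
      then have "P \<inter> Q = {} \<or> Q \<subseteq> P" using Q(2) by blast
      then show ?thesis using \<open>x \<in> Q\<close> \<open>x0 \<in> Q\<close> by (auto split: split_indicator)
    qed
    then show ?thesis unfolding m_def maxop_def by (intro SUP_cong) auto
  qed
  have m: "m < \<infinity>" unfolding m_def using G finG by (intro maxop_finite) auto
  show ?case
  proof (cases "a \<le> m")
    case True
    have "?X x = ?N x" for x
      using True Nm[of x] by (auto simp: XN max_def split: split_indicator)
    then show ?thesis using IH finG by simp
  next
    case False
    then have XQ: "?X x = a" if "x \<in> Q" for x
      using that Nm[of x] by (auto simp: XN max_def)
    have XnQ: "?X x = ?N x" if "x \<notin> Q" for x
      using that by (simp add: XN)
    define A where "A = (\<integral>\<^sup>+x\<in>-Q. epowr (?N x) t \<partial>M)"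
    define B where "B = (\<integral>\<^sup>+x\<in>-Q. f x * epowr (?N x) (t - 1) \<partial>M)"
    let ?\<mu> = "emeasure M Q" and ?s = "ennreal (t / (t - 1))"
    have 1: "(\<integral>\<^sup>+x. epowr (?N x) t \<partial>M) = A + epowr m t * ?\<mu>"
      by (subst nn_integral_split_set[OF Qm, where h="\<lambda>_. 1" and c="epowr m t"])
        (simp_all add: Nm A_def)
    have 2: "(\<integral>\<^sup>+x. f x * epowr (?N x) (t - 1) \<partial>M) = B + epowr m (t - 1) * (a * ?\<mu>)"
      by (subst nn_integral_split_set[OF Qm, where h=f and c="epowr m (t - 1)"])
        (simp_all add: Nm B_def a(2))
    have "(\<integral>\<^sup>+x. epowr (?X x) t \<partial>M) = (\<integral>\<^sup>+x\<in>-Q. epowr (?X x) t \<partial>M) + epowr a t * ?\<mu>"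
      by (subst nn_integral_split_set[OF Qm, where h="\<lambda>_. 1" and c="epowr a t"])
        (simp_all add: XQ)
    also have "(\<integral>\<^sup>+x\<in>-Q. epowr (?X x) t \<partial>M) = A"
      unfolding A_def by (intro nn_integral_cong) (auto simp: XnQ split: split_indicator)
    finally have 3: "(\<integral>\<^sup>+x. epowr (?X x) t \<partial>M) = A + epowr a t * ?\<mu>" .
    have "(\<integral>\<^sup>+x. f x * epowr (?X x) (t - 1) \<partial>M)
        = (\<integral>\<^sup>+x\<in>-Q. f x * epowr (?X x) (t - 1) \<partial>M) + epowr a (t - 1) * (a * ?\<mu>)"
      by (subst nn_integral_split_set[OF Qm, where h=f and c="epowr a (t - 1)"])
        (simp_all add: XQ a(2))
    also have "(\<integral>\<^sup>+x\<in>-Q. f x * epowr (?X x) (t - 1) \<partial>M) = B"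
      unfolding B_def by (intro nn_integral_cong) (auto simp: XnQ split: split_indicator)
    also have "epowr a (t - 1) * (a * ?\<mu>) = epowr a t * ?\<mu>"
      using epowr_add[of "t - 1" 1 a] \<open>1 < t\<close> by (simp add: mult.assoc)
    finally have 4: "(\<integral>\<^sup>+x. f x * epowr (?X x) (t - 1) \<partial>M) = B + epowr a t * ?\<mu>" .
    let ?e = "?s * (a * epowr m (t - 1)) * ?\<mu>"
    have fine: "?e < top" "epowr a t < top"
      using a(1) m Qfin \<open>1 < t\<close> by (auto simp: ennreal_mult_less_top less_top epowr_eq_top_iff)
    have Nfin: "A + epowr m t * ?\<mu> < \<infinity>"
      and Nle: "A + epowr m t * ?\<mu> \<le> ?s * (B + epowr m (t - 1) * (a * ?\<mu>))"
      using IH finG unfolding 1 2 by auto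
    have "?e + (A + epowr a t * ?\<mu>) = A + (epowr a t + ?s * (a * epowr m (t - 1))) * ?\<mu>"
      by (simp add: algebra_simps)
    also have "\<dots> \<le> A + (epowr m t + ?s * epowr a t) * ?\<mu>"
      by (intro add_left_mono mult_right_mono doob_step a m \<open>1 < t\<close>) auto
    also have "\<dots> = (A + epowr m t * ?\<mu>) + ?s * epowr a t * ?\<mu>"
      by (simp add: algebra_simps)
    also have "\<dots> \<le> ?s * (B + epowr m (t - 1) * (a * ?\<mu>)) + ?s * epowr a t * ?\<mu>"
      by (intro add_right_mono Nle)
    also have "\<dots> = ?e + ?s * (B + epowr a t * ?\<mu>)"
      by (simp add: algebra_simps)
    finally have "A + epowr a t * ?\<mu> \<le> ?s * (B + epowr a t * ?\<mu>)"
      using fine by (subst (asm) ennreal_add_left_cancel_le) auto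
    then show ?thesis
      unfolding 3 4 using Nfin fine Qfin by (auto simp: ennreal_mult_less_top)
  qed
qed

text \<open>Where \<open>m \<le> 2 s f\<close>, the left side is at most the second term on the right; elsewhere
  \<open>s f \<le> m/2\<close>, and it is at most the first.  Integrated, the first term can be absorbed
  into the left side of Doob's inequality.\<close>

lemma absorb_pointwise:
  assumes "1 < t" "0 \<le> s"
  shows "ennreal s * (f * epowr m (t - 1)) \<le> ennreal (1/2) * epowr m t + epowr (ennreal (2 * s) * f) t"
proof (cases "m \<le> ennreal (2 * s) * f")
  case True
  have "ennreal s * (f * epowr m (t - 1)) \<le> ennreal (2 * s) * (f * epowr (ennreal (2 * s) * f) (t - 1))"
    using True assms by (intro mult_mono epowr_mono ennreal_leI) auto
  also have "\<dots> = epowr (ennreal (2 * s) * f) t"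
    using epowr_add[of 1 "t - 1" "ennreal (2 * s) * f"] assms by (simp add: mult.assoc)
  finally show ?thesis by (simp add: add_increasing)
next
  case False
  have "ennreal s * (f * epowr m (t - 1)) = ennreal (1/2) * ((ennreal (2 * s) * f) * epowr m (t - 1))"
  proof -
    have "ennreal s = ennreal (1/2) * ennreal (2 * s)"
      using assms by (subst ennreal_mult[symmetric]) auto
    then show ?thesis by (simp add: mult.assoc)
  qed
  also have "\<dots> \<le> ennreal (1/2) * (m * epowr m (t - 1))"
    using False by (intro mult_left_mono mult_right_mono) auto
  also have "m * epowr m (t - 1) = epowr m t"
    using epowr_add[of 1 "t - 1" m] assms by simp
  finally show ?thesis by (simp add: add_increasing2)
qed

definition doob_const :: "real \<Rightarrow> real" where
  "doob_const t = 2 * (2 * (t / (t - 1))) powr t"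

lemma doob_const_pos: "1 < t \<Longrightarrow> 0 < doob_const t"
  by (simp add: doob_const_def)

lemma doob_maxop_finite:
  assumes "finite F" "laminar F" "averaging M F" and t: "1 < t"
    and [measurable]: "f \<in> borel_measurable M"
  shows "(\<integral>\<^sup>+x. epowr (maxop M F f x) t \<partial>M) \<le> ennreal (doob_const t) * (\<integral>\<^sup>+x. epowr (f x) t \<partial>M)"
proof (cases "(\<integral>\<^sup>+x. epowr (f x) t \<partial>M) < \<infinity>")
  case False
  then show ?thesis using doob_const_pos[OF t] by (simp add: ennreal_mult_top not_less top_unique)
next
  case True
  have [measurable]: "maxop M F f \<in> borel_measurable M"
    using assms by (auto intro!: measurable_maxop countable_finite)
  have "(\<integral>\<^sup>+y\<in>Q. f y \<partial>M) < \<infinity>" if "Q \<in> F" for Q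
  proof -
    have [measurable]: "Q \<in> sets M" and "emeasure M Q < \<infinity>"
      using that assms by (auto simp: averaging_def)
    have "(\<integral>\<^sup>+y\<in>Q. f y \<partial>M) = (\<integral>\<^sup>+y. epowr (epowr (f y) t) (1 / t) * epowr (indicator Q y) (1 - 1 / t) \<partial>M)"
      using t by (intro nn_integral_cong) (auto simp: epowr_epowr split: split_indicator)
    also have "\<dots> \<le> epowr (\<integral>\<^sup>+x. epowr (f x) t \<partial>M) (1 / t) * epowr (\<integral>\<^sup>+x. indicator Q x \<partial>M) (1 - 1 / t)"
      using t by (intro nn_integral_Hoelder) auto
    also have "\<dots> < \<infinity>"
      using t True \<open>emeasure M Q < \<infinity>\<close> by (auto simp: ennreal_mult_less_top)
    finally show ?thesis .
  qed
  note aux = doob_maxop_aux[OF assms this, simplified]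
  define I where "I = (\<integral>\<^sup>+x. epowr (maxop M F f x) t \<partial>M)"
  let ?s = "t / (t - 1)"
  have "I \<le> (\<integral>\<^sup>+x. ennreal ?s * (f x * epowr (maxop M F f x) (t - 1)) \<partial>M)"
    using aux unfolding I_def by (subst nn_integral_cmult) auto
  also have "\<dots> \<le> (\<integral>\<^sup>+x. ennreal (1/2) * epowr (maxop M F f x) t + ennreal ((2 * ?s) powr t) * epowr (f x) t \<partial>M)"
  proof (rule nn_integral_mono)
    fix x
    have "epowr (ennreal (2 * ?s) * f x) t = ennreal ((2 * ?s) powr t) * epowr (f x) t"
      using t by (simp add: epowr_mult epowr_ennreal)
    then show "ennreal ?s * (f x * epowr (maxop M F f x) (t - 1))
      \<le> ennreal (1/2) * epowr (maxop M F f x) t + ennreal ((2 * ?s) powr t) * epowr (f x) t"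
      using absorb_pointwise[of t ?s "f x" "maxop M F f x"] t by simp
  qed
  also have "\<dots> = ennreal (1/2) * I + ennreal ((2 * ?s) powr t) * (\<integral>\<^sup>+x. epowr (f x) t \<partial>M)"
    unfolding I_def by (simp add: nn_integral_add nn_integral_cmult)
  finally have le: "I \<le> ennreal (1/2) * I + ennreal ((2 * ?s) powr t) * (\<integral>\<^sup>+x. epowr (f x) t \<partial>M)" .
  obtain i where i: "I = ennreal i" "0 \<le> i" using aux by (cases I) (auto simp: I_def)
  obtain j where j: "(\<integral>\<^sup>+x. epowr (f x) t \<partial>M) = ennreal j" "0 \<le> j"
    using True by (cases "\<integral>\<^sup>+x. epowr (f x) t \<partial>M") auto
  have "i \<le> 1/2 * i + (2 * ?s) powr t * j"
  proof -
    have "ennreal (1/2) * I + ennreal ((2 * ?s) powr t) * ennreal j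
        = ennreal (1/2 * i + (2 * ?s) powr t * j)"
      unfolding i using i(2) j(2)
      by (simp only: ennreal_mult ennreal_plus mult_nonneg_nonneg powr_ge_zero divide_nonneg_nonneg zero_le_one zero_le_numeral)
    then have "ennreal i \<le> ennreal (1/2 * i + (2 * ?s) powr t * j)"
      using le unfolding j i(1) by (simp only:)
    then show ?thesis using i j by (subst (asm) ennreal_le_iff) auto
  qed
  then have "i \<le> doob_const t * j" by (simp add: doob_const_def)
  then show ?thesis
    unfolding I_def[symmetric] i j using doob_const_pos[OF t] j by (simp flip: ennreal_mult)
qed

text \<open>The constant does not depend on the measure.  This uniformity is what makes the
  weighted bounds below sharp in the weight.\<close>

lemma doob_maxop:
  assumes "countable F" "laminar F" "averaging M F" and t: "1 < t"
    and [measurable]: "f \<in> borel_measurable M"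
  shows "(\<integral>\<^sup>+x. epowr (maxop M F f x) t \<partial>M) \<le> ennreal (doob_const t) * (\<integral>\<^sup>+x. epowr (f x) t \<partial>M)"
proof (cases "F = {}")
  case True
  then show ?thesis using t by (simp add: maxop_def bot_ennreal)
next
  case False
  then obtain e :: "nat \<Rightarrow> 'a set" where e: "F = range e"
    using assms(1) by (metis uncountable_def)
  let ?E = "\<lambda>n. e ` {..n}"
  have sub: "?E n \<subseteq> F" for n using e by auto
  have "maxop M F f x = (SUP n. maxop M (?E n) f x)" for x
  proof (rule antisym)
    show "maxop M F f x \<le> (SUP n. maxop M (?E n) f x)"
      proof (unfold maxop_def e, rule SUP_least)
      fix Q assume "Q \<in> range e"
      then obtain n where n: "Q = e n" by auto
      show "(\<integral>\<^sup>+y\<in>Q. f y \<partial>M) / emeasure M Q * indicator Q x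
        \<le> (SUP n. SUP Q\<in>?E n. (\<integral>\<^sup>+y\<in>Q. f y \<partial>M) / emeasure M Q * indicator Q x)"
        unfolding n by (rule SUP_upper2[OF UNIV_I[of n]], rule SUP_upper) auto
    qed
    show "(SUP n. maxop M (?E n) f x) \<le> maxop M F f x"
      unfolding maxop_def using sub by (intro SUP_least SUP_upper) auto
  qed
  then have "(\<integral>\<^sup>+x. epowr (maxop M F f x) t \<partial>M) = (\<integral>\<^sup>+x. (SUP n. epowr (maxop M (?E n) f x) t) \<partial>M)"
    using t by (simp add: epowr_SUP)
  also have "\<dots> = (SUP n. \<integral>\<^sup>+x. epowr (maxop M (?E n) f x) t \<partial>M)"
  proof (rule nn_integral_monotone_convergence_SUP)
    show "incseq (\<lambda>n x. epowr (maxop M (?E n) f x) t)"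
      unfolding incseq_def le_fun_def maxop_def using t
      by (intro allI impI epowr_mono SUP_subset_mono) auto
    show "(\<lambda>x. epowr (maxop M (?E n) f x) t) \<in> borel_measurable M" for n
      using averaging_subset[OF assms(3) sub[of n]]
      by (intro measurable_epowr measurable_maxop) auto
  qed
  also have "\<dots> \<le> ennreal (doob_const t) * (\<integral>\<^sup>+x. epowr (f x) t \<partial>M)"
    using laminar_subset[OF assms(2) sub] averaging_subset[OF assms(3) sub]
    by (intro SUP_least doob_maxop_finite t) auto
  finally show ?thesis .
qed

section \<open>Adjacent dyadic grids\<close>

text \<open>The grid \<open>s\<close> has the cells of side \<open>4\<^sup>k\<close>, shifted by a third of the side in the coordinates
  where \<open>s\<close> holds.  The label of a point names its cell.  Powers of \<open>4\<close> rather than \<open>2\<close> keep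
  the shift the same at all scales: nodes of scale \<open>k + 1\<close> are \<open>4\<^bsup>k+1\<^esup> (m + 1/3) = 4\<^sup>k (4 m + 1 + 1/3)\<close>,
  which are nodes of scale \<open>k\<close>.\<close>

definition grid_label :: "('n \<Rightarrow> bool) \<Rightarrow> int \<Rightarrow> real ^ 'n \<Rightarrow> 'n \<Rightarrow> int" where
  "grid_label s k x i = \<lfloor>x $ i / 4 powi k - (if s i then 1/3 else 0)\<rfloor>"

definition dyadic :: "('n \<Rightarrow> bool) \<Rightarrow> int \<Rightarrow> ('n \<Rightarrow> int) \<Rightarrow> (real ^ 'n) set" where
  "dyadic s k m = {x. grid_label s k x = m}"

definition grid :: "('n \<Rightarrow> bool) \<Rightarrow> (real ^ 'n) set set" where
  "grid s = range (\<lambda>(k, m). dyadic s k m)"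

lemma countable_grid: "countable (grid s)"
  unfolding grid_def by (rule countable_image) (simp add: countableI_type)

lemma grid_label_coarser:
  "grid_label s (k + 1) x i = (grid_label s k x i - (if s i then 1 else 0)) div 4"
proof -
  define y where "y = x $ i / 4 powi k"
  have y: "x $ i / 4 powi (k + 1) = y / 4"
    by (simp add: y_def power_int_add)
  show ?thesis
  proof (cases "s i")
    case True
    have "y / 4 - 1 / 3 = (y - 1/3 - 1) / real_of_int 4" by (simp add: field_simps)
    then have "\<lfloor>y / 4 - 1/3\<rfloor> = \<lfloor>y - 1/3 - 1\<rfloor> div 4"
      by (simp only: floor_divide_real_eq_div)
    also have "\<lfloor>y - 1/3 - 1\<rfloor> = \<lfloor>y - 1/3\<rfloor> - 1" by linarith
    finally show ?thesis using True
      unfolding grid_label_def y y_def[symmetric] by simp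
  next
    case False
    have "y / 4 - 0 = y / real_of_int 4" by simp
    then show ?thesis using False
      unfolding grid_label_def y y_def[symmetric] by (simp only: floor_divide_real_eq_div if_False) simp
  qed
qed

lemma grid_label_eq_coarser:
  assumes "grid_label s k x = grid_label s k y" "k \<le> l"
  shows "grid_label s l x = grid_label s l y"
  using assms(2)
proof (induction rule: int_ge_induct)
  case base then show ?case by fact
next
  case (step i)
  then show ?case by (auto simp: grid_label_coarser)
qed

lemma laminar_grid: "laminar (grid s)"
proof -
  have sub: "dyadic s k m \<inter> dyadic s l m' = {} \<or> dyadic s k m \<subseteq> dyadic s l m'" if "k \<le> l" for k l m m'
  proof (cases "dyadic s k m \<inter> dyadic s l m' = {}")
    case False
    then obtain x where x: "grid_label s k x = m" "grid_label s l x = m'" by (auto simp: dyadic_def)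
    have "dyadic s k m \<subseteq> dyadic s l m'"
    proof
      fix y assume "y \<in> dyadic s k m"
      then have "grid_label s k y = grid_label s k x" using x by (simp add: dyadic_def)
      from grid_label_eq_coarser[OF this that] show "y \<in> dyadic s l m'" using x by (simp add: dyadic_def)
    qed
    then show ?thesis ..
  qed simp
  have "P \<inter> Q = {} \<or> P \<subseteq> Q \<or> Q \<subseteq> P" if "P \<in> grid s" "Q \<in> grid s" for P Q
  proof -
    obtain k l m m' where "P = dyadic s k m" "Q = dyadic s l m'"
      using \<open>P \<in> grid s\<close> \<open>Q \<in> grid s\<close> by (auto simp: grid_def)
    then show ?thesis using sub[of k l m m'] sub[of l k m' m] linear[of k l] by blast
  qed
  then show ?thesis by (simp add: laminar_def)
qed

lemma emeasure_cube:
  assumes "0 < l"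
  shows "emeasure lebesgue (cbox a (a + vec l) :: (real ^ 'n) set) = ennreal (l ^ CARD('n))"
proof -
  have "cbox a (a + vec l) \<noteq> {}" using assms by (auto simp: interval_ne_empty_cart)
  then have "measure lebesgue (cbox a (a + vec l)) = l ^ CARD('n)"
    by (simp add: content_cbox_cart)
  then show ?thesis
    by (subst emeasure_eq_measure2) (auto simp: emeasure_lborel_cbox_eq)
qed

text \<open>Dyadic cells are half-open, which makes them nested or disjoint; the weight classes are
  defined with closed cubes.  The difference is a null set.\<close>

lemma dyadic_AE_cube:
  obtains a :: "real ^ 'n" where "dyadic s k m \<in> sets lebesgue"
    "AE x in lebesgue. x \<in> dyadic s k m \<longleftrightarrow> x \<in> cbox a (a + vec (4 powi k))"
proof -
  define a :: "real ^ 'n" where "a = (\<chi> i. 4 powi k * (m i + (if s i then 1/3 else 0)))"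
  let ?C = "cbox a (a + vec (4 powi k))" and ?B = "box a (a + vec (4 powi k))"
  have pos: "(0::real) < 4 powi k" by simp
  have iff: "x \<in> dyadic s k m \<longleftrightarrow> (\<forall>i. a $ i \<le> x $ i \<and> x $ i < a $ i + 4 powi k)" for x
  proof -
    have "(\<lfloor>y / c - e\<rfloor> = n) \<longleftrightarrow> c * (n + e) \<le> y \<and> y < c * (n + e) + c"
      if "0 < c" for y c e :: real and n
      unfolding floor_eq_iff using that by (auto simp: field_simps)
    from this[OF pos] show ?thesis
      unfolding dyadic_def grid_label_def a_def fun_eq_iff mem_Collect_eq by simp
  qed
  have 1: "?B \<subseteq> dyadic s k m" "dyadic s k m \<subseteq> ?C"
    by (auto simp: iff mem_box_cart less_imp_le)
  have neg: "negligible (?C - ?B)" by (rule negligible_frontier_interval)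
  then have "negligible (dyadic s k m - ?B)" by (rule negligible_subset) (use 1 in auto)
  moreover have "dyadic s k m = ?B \<union> (dyadic s k m - ?B)" using 1 by auto
  ultimately have m: "dyadic s k m \<in> sets lebesgue"
    by (metis negligible_imp_sets sets.Un lmeasurable_box fmeasurableD)
  have "AE x in lebesgue. x \<notin> ?C - ?B"
    using neg unfolding negligible_iff_null_sets by (rule AE_not_in)
  then have "AE x in lebesgue. x \<in> dyadic s k m \<longleftrightarrow> x \<in> ?C"
    by eventually_elim (use 1 in auto)
  with m show ?thesis by (rule that)
qed

lemma grid_AE_cube:
  fixes P :: "(real ^ 'n) set"
  assumes "P \<in> grid s"
  obtains Q where "Q \<in> cubes" "P \<in> sets lebesgue" "AE x in lebesgue. x \<in> P \<longleftrightarrow> x \<in> Q"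
proof -
  obtain k m where P: "P = dyadic s k m" using assms by (auto simp: grid_def)
  obtain a where a: "dyadic s k m \<in> sets lebesgue"
    "AE x in lebesgue. x \<in> dyadic s k m \<longleftrightarrow> x \<in> cbox a (a + vec (4 powi k))"
    using dyadic_AE_cube .
  show ?thesis
  proof (rule that)
    show "cbox a (a + vec (4 powi k)) \<in> cubes"
      unfolding cubes_def by (rule CollectI, intro exI conjI, rule refl) simp
  qed (use a P in auto)
qed

text \<open>Two grids of step \<open>4\<^sup>k\<close> on the line that are shifted by a third of the step have no two
  nodes closer than that third.  A shorter interval therefore contains nodes of at most one
  of them, and lies in one cell of the other.\<close>

lemma floor_shift_eq:
  fixes t d y :: real
  assumes "0 \<le> d" "d < 1/3" "t \<le> y" "y \<le> t + d"
  defines "e \<equiv> (if \<lfloor>t\<rfloor> \<noteq> \<lfloor>t + d\<rfloor> then 1/3 else 0)"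
  shows "\<lfloor>y - e\<rfloor> = \<lfloor>t - e\<rfloor>"
proof (cases "\<lfloor>t\<rfloor> = \<lfloor>t + d\<rfloor>")
  case True
  have "\<lfloor>t\<rfloor> \<le> \<lfloor>y\<rfloor>" "\<lfloor>y\<rfloor> \<le> \<lfloor>t + d\<rfloor>" using assms by (auto intro: floor_mono)
  then show ?thesis using True by (simp add: e_def)
next
  case False
  define N where "N = \<lfloor>t + d\<rfloor>"
  have "\<lfloor>t\<rfloor> < N" using False floor_mono[of t "t + d"] assms by (auto simp: N_def)
  then have tN: "t < N" by (simp add: floor_less_iff)
  have Nt: "N \<le> t + d" unfolding N_def by linarith
  have "\<lfloor>t - 1/3\<rfloor> = N - 1" "\<lfloor>y - 1/3\<rfloor> = N - 1"
    using tN Nt assms(1-4) by (auto simp: floor_eq_iff)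
  then show ?thesis using False by (simp add: e_def)
qed

text \<open>Choose the scale with \<open>3 l < 4\<^sup>k \<le> 12 l\<close> and, in each coordinate, the shift for which the side
  of the cube lies in one cell.\<close>

lemma cube_subset_grid:
  fixes Q :: "(real ^ 'n) set"
  assumes "Q \<in> cubes"
  obtains s P where "P \<in> grid s" "Q \<subseteq> P" "emeasure lebesgue P \<le> ennreal (12 ^ CARD('n)) * emeasure lebesgue Q"
proof -
  obtain a :: "real ^ 'n" and l where Q: "Q = cbox a (a + vec l)" and l: "0 < l"
    using assms by (auto simp: cubes_def)
  define k where "k = \<lfloor>log 4 (3 * l)\<rfloor> + 1"
  have "log 4 (3 * l) < k" "k - 1 \<le> log 4 (3 * l)" unfolding k_def by linarith+
  then have "3 * l < 4 powr k" "4 powr (k - 1) \<le> 3 * l"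
    using l by (auto simp: log_less_iff le_log_iff)
  moreover have "4 powr (k - 1) = 4 powr k / 4" by (simp add: powr_diff)
  ultimately have k: "3 * l < 4 powi k" "4 powi k \<le> 12 * l"
    by (auto simp: powr_real_of_int')
  define s where "s = (\<lambda>i. \<lfloor>a $ i / 4 powi k\<rfloor> \<noteq> \<lfloor>a $ i / 4 powi k + l / 4 powi k\<rfloor>)"
  define P where "P = dyadic s k (grid_label s k a)"
  have "Q \<subseteq> P"
  proof
    fix x assume "x \<in> Q"
    then have x: "a $ i \<le> x $ i" "x $ i \<le> a $ i + l" for i by (auto simp: Q mem_box_cart)
    have "grid_label s k x i = grid_label s k a i" for i
      unfolding grid_label_def s_def
    proof (rule floor_shift_eq[of "l / 4 powi k" "a $ i / 4 powi k" "x $ i / 4 powi k"])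
      show "l / 4 powi k < 1 / 3" using k l by (simp add: divide_less_eq)
      show "x $ i / 4 powi k \<le> a $ i / 4 powi k + l / 4 powi k"
        unfolding add_divide_distrib[symmetric] using x[of i] by (intro divide_right_mono) auto
    qed (use x[of i] l in \<open>auto intro: divide_right_mono\<close>)
    then show "x \<in> P" by (auto simp: P_def dyadic_def)
  qed
  moreover have "P \<in> grid s" by (auto simp: P_def grid_def)
  moreover have "emeasure lebesgue P \<le> ennreal (12 ^ CARD('n)) * emeasure lebesgue Q"
  proof -
    obtain b where b: "P \<in> sets lebesgue" "AE x in lebesgue. x \<in> P \<longleftrightarrow> x \<in> cbox b (b + vec (4 powi k))"
      unfolding P_def using dyadic_AE_cube .
    then have "emeasure lebesgue P = emeasure lebesgue (cbox b (b + vec (4 powi k)))"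
      by (intro emeasure_eq_AE) auto
    also have "\<dots> \<le> ennreal ((12 * l) ^ CARD('n))"
      using power_mono[OF k(2), of "CARD('n)"]
      by (subst emeasure_cube) (simp_all add: ennreal_leI)
    also have "\<dots> = ennreal (12 ^ CARD('n)) * emeasure lebesgue Q"
      unfolding Q emeasure_cube[OF l] using l by (simp add: power_mult_distrib flip: ennreal_mult)
    finally show ?thesis .
  qed
  ultimately show ?thesis using that by blast
qed

text \<open>An exhaustion of the space by cubes.\<close>

definition big_cube :: "nat \<Rightarrow> (real ^ 'n) set" where
  "big_cube j = cbox (vec (- (real j + 1))) (vec (- (real j + 1)) + vec (2 * (real j + 1)))"

lemma big_cube: "big_cube j \<in> cubes" "big_cube j \<in> sets lebesgue"
proof -
  show "big_cube j \<in> cubes" unfolding big_cube_def cubes_def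
    by (rule CollectI, rule exI, rule exI, rule conjI, rule refl) simp
  show "big_cube j \<in> sets lebesgue" by (simp add: big_cube_def)
qed

lemma mem_big_cube: "x \<in> big_cube j \<longleftrightarrow> (\<forall>i. \<bar>x $ i\<bar> \<le> real j + 1)"
  by (auto simp: big_cube_def mem_box_cart abs_le_iff algebra_simps minus_le_iff) (smt (verit))+

lemma big_cube_mono: "i \<le> j \<Longrightarrow> big_cube i \<subseteq> big_cube j"
  unfolding subset_iff mem_big_cube by (meson add_right_mono of_nat_mono order_trans)

lemma norm_le_big_cube: "norm x \<le> real j \<Longrightarrow> x \<in> big_cube j"
  unfolding mem_big_cube
proof
  fix i assume "norm x \<le> real j"
  then show "\<bar>x $ i\<bar> \<le> real j + 1" using component_le_norm_cart[of x i] by linarith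
qed

lemma AE_big_cubeI:
  assumes "\<And>j. AE x in lebesgue. x \<in> big_cube j \<longrightarrow> P x"
  shows "AE x in lebesgue. P x"
proof -
  have "AE x in lebesgue. \<forall>j. x \<in> big_cube j \<longrightarrow> P x"
    unfolding AE_all_countable using assms by blast
  then show ?thesis
  proof eventually_elim
    case (elim x)
    obtain j where "norm x \<le> real j" using real_arch_simple by blast
    then show ?case using elim norm_le_big_cube by blast
  qed
qed


section \<open>The sharp weighted bound for the maximal function\<close>

text \<open>Weights are taken positive at every point, not only almost everywhere, so that all their powers
  are real-valued and can be handled by the laws of \<^const>\<open>powr\<close>.\<close>

definition pos_weight :: "(real ^ 'n \<Rightarrow> real) \<Rightarrow> bool" where
  "pos_weight W \<longleftrightarrow> W \<in> borel_measurable lebesgue \<and> (\<forall>x. 0 < W x)"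

definition dual_weight :: "real \<Rightarrow> (real ^ 'n \<Rightarrow> real) \<Rightarrow> real ^ 'n \<Rightarrow> real" where
  "dual_weight r W x = W x powr (- 1 / (r - 1))"

text \<open>The Muckenhoupt constant \<open>[W]\<close> in \<open>A(r)\<close>; here \<open>dual_weight r W\<close> is \<open>W\<^bsup>1-r'\<^esup>\<close>.\<close>

definition Ap_char :: "real \<Rightarrow> (real ^ 'n \<Rightarrow> real) \<Rightarrow> ennreal" where
  "Ap_char r W = (SUP Q\<in>cubes. avg Q (\<lambda>x. ennreal (W x)) * epowr (avg Q (\<lambda>x. ennreal (dual_weight r W x))) (r - 1))"

lemma pos_weightD: "pos_weight W \<Longrightarrow> 0 < W x" "pos_weight W \<Longrightarrow> W \<in> borel_measurable lebesgue"
  by (auto simp: pos_weight_def)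

lemma pos_weight_dual: "pos_weight W \<Longrightarrow> pos_weight (dual_weight r W)"
  unfolding pos_weight_def dual_weight_def[abs_def] by (auto simp: less_le)

lemma cubes_measure:
  assumes "Q \<in> cubes"
  obtains c where "0 < c" "emeasure lebesgue Q = ennreal c" "Q \<in> sets lebesgue"
proof -
  obtain a l where Q: "Q = cbox a (a + vec l)" and "0 < l" using assms by (auto simp: cubes_def)
  then show ?thesis
    using emeasure_cube[OF \<open>0 < l\<close>, of a] by (intro that[of "l ^ CARD('a)"]) auto
qed

lemma grid_as_cube:
  assumes "P \<in> grid s"
  obtains Q where "Q \<in> cubes" "P \<in> sets lebesgue" "emeasure lebesgue P = emeasure lebesgue Q"
    "\<forall>g. (\<integral>\<^sup>+x\<in>P. g x \<partial>lebesgue) = (\<integral>\<^sup>+x\<in>Q. g x \<partial>lebesgue)"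
proof -
  obtain Q where Q: "Q \<in> cubes" "P \<in> sets lebesgue" and ae: "AE x in lebesgue. x \<in> P \<longleftrightarrow> x \<in> Q"
    using grid_AE_cube[OF assms] .
  show ?thesis
  proof (rule that[OF Q])
    show "emeasure lebesgue P = emeasure lebesgue Q"
      using Q ae by (intro emeasure_eq_AE) (auto elim: cubes_measure)
    show "\<forall>g. (\<integral>\<^sup>+x\<in>P. g x \<partial>lebesgue) = (\<integral>\<^sup>+x\<in>Q. g x \<partial>lebesgue)"
      using ae by (intro allI nn_integral_cong_AE) (auto elim!: eventually_mono split: split_indicator)
  qed
qed

lemma pos_weight_integral_pos:
  assumes "pos_weight W" "Q \<in> cubes"
  shows "(\<integral>\<^sup>+x\<in>Q. ennreal (W x) \<partial>lebesgue) \<noteq> 0"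
proof
  assume *: "(\<integral>\<^sup>+x\<in>Q. ennreal (W x) \<partial>lebesgue) = 0"
  obtain c where c: "0 < c" "emeasure lebesgue Q = ennreal c" and [measurable]: "Q \<in> sets lebesgue"
    using cubes_measure[OF assms(2)] .
  have [measurable]: "W \<in> borel_measurable lebesgue" using assms pos_weightD by auto
  have "AE x in lebesgue. ennreal (W x) * indicator Q x = 0"
    using * by (subst (asm) nn_integral_0_iff_AE) auto
  then have "AE x in lebesgue. x \<notin> Q"
    by eventually_elim (use pos_weightD(1)[OF assms(1)] in \<open>auto simp: ennreal_eq_0_iff not_le[symmetric] split: split_indicator_asm\<close>)
  then have "emeasure lebesgue Q = 0"
    by (simp add: AE_iff_measurable[OF \<open>Q \<in> sets lebesgue\<close>])
  then show False using c by simp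
qed

text \<open>Since both averages are positive, finiteness of their product makes each of them finite.\<close>

lemma Ap_char_cube:
  assumes W: "pos_weight W" and r: "1 < r" and K: "Ap_char r W \<le> ennreal K" "0 < K" and Q: "Q \<in> cubes"
  obtains a b c where "0 < a" "0 < b" "0 < c"
    "(\<integral>\<^sup>+x\<in>Q. ennreal (W x) \<partial>lebesgue) = ennreal a"
    "(\<integral>\<^sup>+x\<in>Q. ennreal (dual_weight r W x) \<partial>lebesgue) = ennreal b"
    "emeasure lebesgue Q = ennreal c"
    "a / c * (b / c) powr (r - 1) \<le> K"
proof -
  obtain c where c: "0 < c" "emeasure lebesgue Q = ennreal c" using cubes_measure[OF Q] .
  let ?I = "\<integral>\<^sup>+x\<in>Q. ennreal (W x) \<partial>lebesgue" and ?J = "\<integral>\<^sup>+x\<in>Q. ennreal (dual_weight r W x) \<partial>lebesgue"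
  have ne: "?I \<noteq> 0" "?J \<noteq> 0"
    using pos_weight_integral_pos[OF W Q] pos_weight_integral_pos[OF pos_weight_dual[OF W] Q] by auto
  have "?I / ennreal c * epowr (?J / ennreal c) (r - 1) \<le> Ap_char r W"
    unfolding Ap_char_def avg_def using c by (intro SUP_upper2[OF Q]) auto
  with K have le: "?I / ennreal c * epowr (?J / ennreal c) (r - 1) \<le> ennreal K" by simp
  then have lt: "?I / ennreal c * epowr (?J / ennreal c) (r - 1) < top"
    using le_less_trans ennreal_less_top by blast
  have "?I / ennreal c \<noteq> 0" "epowr (?J / ennreal c) (r - 1) \<noteq> 0"
    using ne r by (auto simp: epowr_eq_0_iff)
  with lt have "?I / ennreal c < top" "epowr (?J / ennreal c) (r - 1) < top"
    by (auto simp: ennreal_mult_less_top)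
  then have "?I / ennreal c \<noteq> top" "?J / ennreal c \<noteq> top"
    using r by auto
  then have fin: "?I < top" "?J < top"
    by (simp_all only: ennreal_divide_eq_top_iff top.not_eq_extremum[symmetric]) auto
  obtain a where a: "?I = ennreal a" "0 < a"
    using fin(1) ne(1) by (cases ?I rule: ennreal_zero_top_pos) auto
  obtain b where b: "?J = ennreal b" "0 < b"
    using fin(2) ne(2) by (cases ?J rule: ennreal_zero_top_pos) auto
  have "ennreal (a / c * (b / c) powr (r - 1)) \<le> ennreal K"
    using le a b c by (simp add: divide_ennreal epowr_ennreal_pos flip: ennreal_mult)
  then have "a / c * (b / c) powr (r - 1) \<le> K" using K by (subst (asm) ennreal_le_iff) auto
  then show ?thesis using a b c that by blast
qed

lemma emeasure_density_pos_weight: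
  assumes "pos_weight W" "P \<in> sets lebesgue"
  shows "emeasure (density lebesgue (\<lambda>x. ennreal (W x))) P = (\<integral>\<^sup>+x\<in>P. ennreal (W x) \<partial>lebesgue)"
  using assms by (intro emeasure_density) (auto simp: pos_weight_def)

lemma averaging_grid:
  assumes W: "pos_weight W" and r: "1 < r" and K: "Ap_char r W \<le> ennreal K" "0 < K"
  shows "averaging lebesgue (grid s)" "averaging (density lebesgue (\<lambda>x. ennreal (W x))) (grid s)"
    "averaging (density lebesgue (\<lambda>x. ennreal (dual_weight r W x))) (grid s)"
  unfolding averaging_def
proof (safe)
  fix P :: "(real ^ 'a) set" assume "P \<in> grid s"
  obtain Q where Q: "Q \<in> cubes" "P \<in> sets lebesgue" "emeasure lebesgue P = emeasure lebesgue Q"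
    "\<forall>g. (\<integral>\<^sup>+x\<in>P. g x \<partial>lebesgue) = (\<integral>\<^sup>+x\<in>Q. g x \<partial>lebesgue)"
    using grid_as_cube[OF \<open>P \<in> grid s\<close>] .
  obtain a b c where abc: "0 < a" "0 < b" "0 < c"
    "(\<integral>\<^sup>+x\<in>Q. ennreal (W x) \<partial>lebesgue) = ennreal a"
    "(\<integral>\<^sup>+x\<in>Q. ennreal (dual_weight r W x) \<partial>lebesgue) = ennreal b"
    "emeasure lebesgue Q = ennreal c" "a / c * (b / c) powr (r - 1) \<le> K"
    using Ap_char_cube[OF assms Q(1)] .
  show "P \<in> sets lebesgue" "P \<in> sets (density lebesgue (\<lambda>x. ennreal (W x)))"
    "P \<in> sets (density lebesgue (\<lambda>x. ennreal (dual_weight r W x)))"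
    using Q by auto
  show "0 < emeasure lebesgue P" "emeasure lebesgue P < \<infinity>"
    "0 < emeasure (density lebesgue (\<lambda>x. ennreal (W x))) P"
    "emeasure (density lebesgue (\<lambda>x. ennreal (W x))) P < \<infinity>"
    "0 < emeasure (density lebesgue (\<lambda>x. ennreal (dual_weight r W x))) P"
    "emeasure (density lebesgue (\<lambda>x. ennreal (dual_weight r W x))) P < \<infinity>"
    using Q abc W pos_weight_dual[OF W] by (simp_all add: emeasure_density_pos_weight)
qed

lemma epowr_divide_ennreal:
  assumes "0 < c" "0 \<le> t"
  shows "epowr (I / ennreal c) t = epowr I t * ennreal (c powr (- t))"
proof -
  have "I / ennreal c = I * ennreal (1 / c)"
    using assms by (simp add: divide_ennreal_def inverse_ennreal inverse_eq_divide)
  then show ?thesis using assms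
    by (simp add: epowr_mult epowr_ennreal_pos powr_minus powr_divide inverse_eq_divide)
qed

text \<open>Let \<open>c\<close>, \<open>a\<close>, \<open>b\<close> be the Lebesgue measure of a cell \<open>P\<close> and its \<open>W\<close>- and \<open>\<sigma>\<close>-measures, and \<open>I\<close> the
  integral of \<open>f\<close> over \<open>P\<close>.  On \<open>P\<close> the function \<open>N\<close> is at least \<open>I/b\<close>, because \<open>I\<close> is also the
  \<open>\<sigma>\<close>-integral of \<open>f/\<sigma>\<close>; hence the \<open>W\<close>-average of \<open>N\<^bsup>r-1\<^esup>/W\<close> over \<open>P\<close> is at least \<open>c (I/b)\<^bsup>r-1\<^esup>/a\<close>.
  The bound \<open>(a/c) (b/c)\<^bsup>r-1\<^esup> \<le> K\<close> compares this with \<open>(I/c)\<^bsup>r-1\<^esup>\<close>.\<close>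

lemma lerner_pointwise:
  fixes W :: "real ^ 'n \<Rightarrow> real" and f :: "real ^ 'n \<Rightarrow> ennreal" and s :: "'n \<Rightarrow> bool"
  assumes W: "pos_weight W" and r: "1 < r" and K: "Ap_char r W \<le> ennreal K" "0 < K"
    and [measurable]: "f \<in> borel_measurable lebesgue"
  defines "\<mu> \<equiv> density lebesgue (\<lambda>x. ennreal (W x))"
    and "\<nu> \<equiv> density lebesgue (\<lambda>x. ennreal (dual_weight r W x))"
  defines "N \<equiv> maxop \<nu> (grid s) (\<lambda>x. f x * ennreal (W x powr (1 / (r - 1))))"
  shows "epowr (maxop lebesgue (grid s) f x) (r - 1)
    \<le> ennreal K * maxop \<mu> (grid s) (\<lambda>x. epowr (N x) (r - 1) * ennreal (1 / W x)) x"
proof -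
  have Wp: "0 < W x" for x using W by (rule pos_weightD)
  have [measurable]: "W \<in> borel_measurable lebesgue" "dual_weight r W \<in> borel_measurable lebesgue"
    using pos_weightD W pos_weight_dual[OF W] by auto
  have "N \<in> borel_measurable \<nu>"
    unfolding N_def \<nu>_def by (intro measurable_maxop countable_grid averaging_grid[OF W r K])
  then have [measurable]: "N \<in> borel_measurable lebesgue" by (simp add: \<nu>_def)
  have main: "epowr ((\<integral>\<^sup>+y\<in>P. f y \<partial>lebesgue) / emeasure lebesgue P) (r - 1)
      \<le> ennreal K * ((\<integral>\<^sup>+y\<in>P. (epowr (N y) (r - 1) * ennreal (1 / W y)) \<partial>\<mu>) / emeasure \<mu> P)"
    if P: "P \<in> grid s" for P
  proof -
    obtain Q where Q: "Q \<in> cubes" "P \<in> sets lebesgue" "emeasure lebesgue P = emeasure lebesgue Q"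
      "\<forall>g. (\<integral>\<^sup>+x\<in>P. g x \<partial>lebesgue) = (\<integral>\<^sup>+x\<in>Q. g x \<partial>lebesgue)"
      using grid_as_cube[OF P] .
    note [measurable] = Q(2)
    obtain a b c where abc: "0 < a" "0 < b" "0 < c"
      "(\<integral>\<^sup>+x\<in>Q. ennreal (W x) \<partial>lebesgue) = ennreal a"
      "(\<integral>\<^sup>+x\<in>Q. ennreal (dual_weight r W x) \<partial>lebesgue) = ennreal b"
      "emeasure lebesgue Q = ennreal c" "a / c * (b / c) powr (r - 1) \<le> K"
      using Ap_char_cube[OF W r K Q(1)] .
    have mu: "emeasure \<mu> P = ennreal a" and nu: "emeasure \<nu> P = ennreal b"
      using Q abc W pos_weight_dual[OF W] by (simp_all add: emeasure_density_pos_weight \<mu>_def \<nu>_def)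
    define I where "I = (\<integral>\<^sup>+y\<in>P. f y \<partial>lebesgue)"
    have "(\<integral>\<^sup>+y\<in>P. (f y * ennreal (W y powr (1 / (r - 1)))) \<partial>\<nu>)
        = (\<integral>\<^sup>+y. ennreal (dual_weight r W y) * (f y * ennreal (W y powr (1 / (r - 1))) * indicator P y) \<partial>lebesgue)"
      unfolding \<nu>_def by (intro nn_integral_density) auto
    also have "\<dots> = I"
      unfolding I_def
    proof (intro nn_integral_cong)
      fix y
      have "ennreal (dual_weight r W y) * ennreal (W y powr (1 / (r - 1))) = 1"
        using Wp[of y] by (simp add: dual_weight_def flip: ennreal_mult powr_add)
      then show "ennreal (dual_weight r W y) * (f y * ennreal (W y powr (1 / (r - 1))) * indicator P y)
          = f y * indicator P y"
        by (metis (no_types, lifting) mult.assoc mult.left_commute mult_1)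
    qed
    finally have NI: "I / ennreal b \<le> N y" if "y \<in> P" for y
      using avg_le_maxop[OF P that, where M=\<nu> and f="\<lambda>x. f x * ennreal (W x powr (1 / (r - 1)))"]
      by (simp add: nu N_def)
    have "epowr (I / ennreal b) (r - 1) * ennreal c = (\<integral>\<^sup>+y\<in>P. epowr (I / ennreal b) (r - 1) \<partial>lebesgue)"
      by (subst nn_integral_cmult_indicator[OF Q(2)]) (simp only: Q(3) abc(6))
    also have "\<dots> \<le> (\<integral>\<^sup>+y. ennreal (W y) * (epowr (N y) (r - 1) * ennreal (1 / W y) * indicator P y) \<partial>lebesgue)"
    proof (intro nn_integral_mono)
      fix y
      have "ennreal (W y) * ennreal (1 / W y) = 1"
        using Wp[of y] by (simp flip: ennreal_mult)
      then have "ennreal (W y) * (epowr (N y) (r - 1) * ennreal (1 / W y) * indicator P y)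
          = epowr (N y) (r - 1) * indicator P y"
        by (metis (no_types, lifting) mult.assoc mult.left_commute mult_1)
      then show "epowr (I / ennreal b) (r - 1) * indicator P y
        \<le> ennreal (W y) * (epowr (N y) (r - 1) * ennreal (1 / W y) * indicator P y)"
        using NI[of y] r by (auto split: split_indicator intro!: epowr_mono)
    qed
    also have "\<dots> = (\<integral>\<^sup>+y\<in>P. (epowr (N y) (r - 1) * ennreal (1 / W y)) \<partial>\<mu>)"
      unfolding \<mu>_def by (intro nn_integral_density[symmetric]) auto
    finally have le: "epowr (I / ennreal b) (r - 1) * ennreal c
      \<le> (\<integral>\<^sup>+y\<in>P. (epowr (N y) (r - 1) * ennreal (1 / W y)) \<partial>\<mu>)" .
    have real: "c powr (- (r - 1)) \<le> K * (b powr (- (r - 1)) * c / a)"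
    proof -
      define B C where "B = b powr (r - 1)" and "C = c powr (r - 1)"
      have BC: "0 < B" "0 < C" using abc by (auto simp: B_def C_def)
      have "a / c * (B / C) \<le> K" using abc by (simp add: powr_divide B_def C_def)
      then have "1 / C \<le> K * (1 / B * c / a)" using abc(1-3) BC by (simp add: field_simps)
      then show ?thesis unfolding powr_minus_divide B_def C_def .
    qed
    have "epowr (I / ennreal c) (r - 1) = epowr I (r - 1) * ennreal (c powr (- (r - 1)))"
      using abc r by (simp add: epowr_divide_ennreal)
    also have "\<dots> \<le> epowr I (r - 1) * ennreal (K * (b powr (- (r - 1)) * c / a))"
      by (intro mult_left_mono ennreal_leI real) auto
    also have "\<dots> = ennreal K * (epowr I (r - 1) * ennreal (b powr (- (r - 1))) * ennreal c / ennreal a)"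
      using abc K by (simp add: ennreal_mult divide_ennreal[symmetric] ennreal_times_divide ac_simps)
    also have "\<dots> = ennreal K * (epowr (I / ennreal b) (r - 1) * ennreal c / ennreal a)"
      using abc r by (simp add: epowr_divide_ennreal)
    also have "\<dots> \<le> ennreal K * ((\<integral>\<^sup>+y\<in>P. (epowr (N y) (r - 1) * ennreal (1 / W y)) \<partial>\<mu>) / ennreal a)"
      by (intro mult_left_mono divide_right_mono_ennreal le) auto
    finally show ?thesis unfolding I_def using Q abc mu by simp
  qed
  show ?thesis
    unfolding maxop_def[of lebesgue]
  proof (subst epowr_SUP, use r in simp, rule SUP_least)
    fix P :: "(real ^ 'n) set" assume P: "P \<in> grid s"
    show "epowr ((\<integral>\<^sup>+y\<in>P. f y \<partial>lebesgue) / emeasure lebesgue P * indicator P x) (r - 1)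
      \<le> ennreal K * maxop \<mu> (grid s) (\<lambda>x. epowr (N x) (r - 1) * ennreal (1 / W x)) x"
    proof (cases "x \<in> P")
      case True
      then show ?thesis
        using order_trans[OF main[OF P] mult_left_mono[OF avg_le_maxop[OF P True]]] by simp
    qed (use r in simp)
  qed
qed

text \<open>Raise the pointwise bound to the power \<open>r' = r/(r-1)\<close>, and apply Doob's inequality first with
  respect to \<open>W dx\<close> and exponent \<open>r'\<close>, then with respect to \<open>\<sigma> dx\<close> and exponent \<open>r\<close>.  The
  intermediate norms match because \<open>W\<^bsup>1-r'\<^esup> = \<sigma>\<close> and \<open>\<sigma>\<^bsup>1-r\<^esup> = W\<close>.\<close>

lemma grid_maxop_bound:
  fixes W :: "real ^ 'n \<Rightarrow> real" and f :: "real ^ 'n \<Rightarrow> ennreal"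
  assumes W: "pos_weight W" and r: "1 < r" and K: "Ap_char r W \<le> ennreal K" "0 < K"
    and f [measurable]: "f \<in> borel_measurable lebesgue"
  shows "(\<integral>\<^sup>+x. epowr (maxop lebesgue (grid s) f x) r * ennreal (W x) \<partial>lebesgue)
    \<le> ennreal (doob_const (r / (r - 1)) * doob_const r * K powr (r / (r - 1)))
      * (\<integral>\<^sup>+x. epowr (f x) r * ennreal (W x) \<partial>lebesgue)"
proof -
  define \<mu> where "\<mu> = density lebesgue (\<lambda>x. ennreal (W x))"
  define \<nu> where "\<nu> = density lebesgue (\<lambda>x. ennreal (dual_weight r W x))"
  define N where "N = maxop \<nu> (grid s) (\<lambda>x. f x * ennreal (W x powr (1 / (r - 1))))"
  define G where "G = (\<lambda>x. epowr (N x) (r - 1) * ennreal (1 / W x))"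
  let ?r = "r / (r - 1)"
  have r': "1 < ?r" "0 < ?r" using r by (auto simp: field_simps)
  have Wp: "0 < W x" for x using W by (rule pos_weightD)
  have [measurable]: "W \<in> borel_measurable lebesgue" "dual_weight r W \<in> borel_measurable lebesgue"
    using pos_weightD W pos_weight_dual[OF W] by auto
  have "N \<in> borel_measurable \<nu>"
    unfolding N_def \<nu>_def by (intro measurable_maxop countable_grid averaging_grid[OF W r K])
  then have [measurable]: "N \<in> borel_measurable lebesgue" by (simp add: \<nu>_def)
  have [measurable]: "G \<in> borel_measurable lebesgue" unfolding G_def by measurable
  have "maxop \<mu> (grid s) G \<in> borel_measurable \<mu>"
    unfolding \<mu>_def by (intro measurable_maxop countable_grid averaging_grid[OF W r K])
  then have [measurable]: "maxop \<mu> (grid s) G \<in> borel_measurable lebesgue" by (simp add: \<mu>_def)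
  have int_mu: "(\<integral>\<^sup>+x. g x \<partial>\<mu>) = (\<integral>\<^sup>+x. g x * ennreal (W x) \<partial>lebesgue)"
    if [measurable]: "g \<in> borel_measurable lebesgue" for g
    unfolding \<mu>_def by (subst nn_integral_density) (auto simp: mult.commute)
  have int_nu: "(\<integral>\<^sup>+x. g x \<partial>\<nu>) = (\<integral>\<^sup>+x. g x * ennreal (dual_weight r W x) \<partial>lebesgue)"
    if [measurable]: "g \<in> borel_measurable lebesgue" for g
    unfolding \<nu>_def by (subst nn_integral_density) (auto simp: mult.commute)
  have "(\<integral>\<^sup>+x. epowr (maxop lebesgue (grid s) f x) r * ennreal (W x) \<partial>lebesgue)
      \<le> (\<integral>\<^sup>+x. epowr (ennreal K * maxop \<mu> (grid s) G x) ?r * ennreal (W x) \<partial>lebesgue)"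
  proof (intro nn_integral_mono mult_right_mono)
    fix x
    have "epowr (maxop lebesgue (grid s) f x) r = epowr (epowr (maxop lebesgue (grid s) f x) (r - 1)) ?r"
      using r by (simp add: epowr_epowr)
    also have "\<dots> \<le> epowr (ennreal K * maxop \<mu> (grid s) G x) ?r"
      using lerner_pointwise[OF W r K f, where s=s and x=x] r'
      by (intro epowr_mono) (auto simp: G_def N_def \<mu>_def \<nu>_def)
    finally show "epowr (maxop lebesgue (grid s) f x) r \<le> epowr (ennreal K * maxop \<mu> (grid s) G x) ?r" .
  qed auto
  also have "\<dots> = ennreal (K powr ?r) * (\<integral>\<^sup>+x. epowr (maxop \<mu> (grid s) G x) ?r \<partial>\<mu>)"
    using r' K by (simp add: int_mu epowr_mult epowr_ennreal_pos mult.assoc nn_integral_cmult)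
  also have "\<dots> \<le> ennreal (K powr ?r) * (ennreal (doob_const ?r) * (\<integral>\<^sup>+x. epowr (G x) ?r \<partial>\<mu>))"
    by (intro mult_left_mono doob_maxop countable_grid laminar_grid r')
      (auto simp: \<mu>_def intro!: averaging_grid[OF W r K])
  also have "(\<integral>\<^sup>+x. epowr (G x) ?r \<partial>\<mu>) = (\<integral>\<^sup>+x. epowr (N x) r \<partial>\<nu>)"
  proof (subst int_mu, measurable, subst int_nu, measurable, rule nn_integral_cong)
    fix x
    have *: "(1 / W x) powr ?r * W x = dual_weight r W x"
    proof -
      have "(1 / W x) powr ?r * W x = W x powr (- ?r + 1)"
      proof -
        have "(1 / W x) powr ?r = W x powr (- ?r)"
          using Wp[of x] by (simp add: powr_minus_divide powr_divide)
        then show ?thesis using Wp[of x] by (simp only: powr_add) simp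
      qed
      also have "- ?r + 1 = - 1 / (r - 1)" using r by (simp add: field_simps)
      finally show ?thesis by (simp add: dual_weight_def)
    qed
    have "epowr (G x) ?r * ennreal (W x) = epowr (N x) r * (ennreal ((1 / W x) powr ?r) * ennreal (W x))"
      using r r' Wp[of x] unfolding G_def
      by (simp add: epowr_mult epowr_epowr epowr_ennreal_pos mult.assoc)
    also have "ennreal ((1 / W x) powr ?r) * ennreal (W x) = ennreal (dual_weight r W x)"
      using Wp[of x] by (subst ennreal_mult[symmetric]) (auto simp: less_imp_le simp flip: *)
    finally show "epowr (G x) ?r * ennreal (W x) = epowr (N x) r * ennreal (dual_weight r W x)" .
  qed
  also have "ennreal (K powr ?r) * (ennreal (doob_const ?r) * (\<integral>\<^sup>+x. epowr (N x) r \<partial>\<nu>))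
      \<le> ennreal (K powr ?r) * (ennreal (doob_const ?r) * (ennreal (doob_const r)
        * (\<integral>\<^sup>+x. epowr (f x * ennreal (W x powr (1 / (r - 1)))) r \<partial>\<nu>)))"
    unfolding N_def
    by (intro mult_left_mono doob_maxop countable_grid laminar_grid r) (auto simp: \<nu>_def intro!: averaging_grid[OF W r K])
  also have "(\<integral>\<^sup>+x. epowr (f x * ennreal (W x powr (1 / (r - 1)))) r \<partial>\<nu>)
      = (\<integral>\<^sup>+x. epowr (f x) r * ennreal (W x) \<partial>lebesgue)"
  proof (subst int_nu, measurable, rule nn_integral_cong)
    fix x
    have *: "(W x powr (1 / (r - 1))) powr r * dual_weight r W x = W x"
    proof -
      have "(W x powr (1 / (r - 1))) powr r * dual_weight r W x = W x powr (?r - 1 / (r - 1))"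
        using Wp[of x] by (simp add: dual_weight_def powr_powr powr_add[symmetric])
      also have "?r - 1 / (r - 1) = 1" using r by (simp add: diff_divide_distrib[symmetric])
      finally show ?thesis using Wp[of x] by simp
    qed
    have "epowr (f x * ennreal (W x powr (1 / (r - 1)))) r * ennreal (dual_weight r W x)
      = epowr (f x) r * (ennreal ((W x powr (1 / (r - 1))) powr r) * ennreal (dual_weight r W x))"
      using r Wp[of x] by (simp add: epowr_mult epowr_ennreal_pos mult.assoc)
    also have "ennreal ((W x powr (1 / (r - 1))) powr r) * ennreal (dual_weight r W x) = ennreal (W x)"
      by (subst ennreal_mult[symmetric]) (auto simp: * dual_weight_def[of r W x, symmetric], simp add: dual_weight_def)
    finally show "epowr (f x * ennreal (W x powr (1 / (r - 1)))) r * ennreal (dual_weight r W x)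
      = epowr (f x) r * ennreal (W x)" .
  qed
  finally show ?thesis
    using doob_const_pos[OF r] doob_const_pos[OF r'(1)]
    by (simp add: ennreal_mult ac_simps)
qed

text \<open>The supremum over the \<open>2\<^sup>n\<close> grids controls the averages over all cubes.\<close>

definition dmax :: "(real ^ 'n \<Rightarrow> ennreal) \<Rightarrow> real ^ 'n \<Rightarrow> ennreal" where
  "dmax f x = (SUP s. maxop lebesgue (grid s) f x)"

lemma averaging_grid_lebesgue: "averaging lebesgue (grid s)"
  unfolding averaging_def
proof
  fix P :: "(real ^ 'a) set" assume "P \<in> grid s"
  obtain Q where "Q \<in> cubes" "P \<in> sets lebesgue" "emeasure lebesgue P = emeasure lebesgue Q"
    "\<forall>g. (\<integral>\<^sup>+x\<in>P. g x \<partial>lebesgue) = (\<integral>\<^sup>+x\<in>Q. g x \<partial>lebesgue)"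
    using grid_as_cube[OF \<open>P \<in> grid s\<close>] .
  then show "P \<in> sets lebesgue \<and> 0 < emeasure lebesgue P \<and> emeasure lebesgue P < \<infinity>"
    by (auto elim!: cubes_measure)
qed

lemma measurable_dmax [measurable]: "dmax f \<in> borel_measurable lebesgue"
  unfolding dmax_def[abs_def]
  by (intro borel_measurable_SUP measurable_maxop countable_grid averaging_grid_lebesgue) auto

lemma avg_le_dmax:
  fixes Q :: "(real ^ 'n) set"
  assumes "Q \<in> cubes" "x \<in> Q" and [measurable]: "f \<in> borel_measurable lebesgue"
  shows "avg Q f \<le> ennreal (12 ^ CARD('n)) * dmax f x"
proof -
  obtain s P where P: "P \<in> grid s" "Q \<subseteq> P"
    and le: "emeasure lebesgue P \<le> ennreal (12 ^ CARD('n)) * emeasure lebesgue Q"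
    using cube_subset_grid[OF assms(1)] .
  obtain c where c: "0 < c" "emeasure lebesgue Q = ennreal c" using cubes_measure[OF assms(1)] .
  obtain p where p: "0 < p" "emeasure lebesgue P = ennreal p"
    using averaging_grid_lebesgue[of s] P(1) unfolding averaging_def
    by (metis ennreal_zero_top_pos order_less_irrefl)
  have pc: "p \<le> 12 ^ CARD('n) * c"
  proof -
    have "ennreal p \<le> ennreal (12 ^ CARD('n) * c)"
      using le unfolding c p by (subst ennreal_mult) (use c in auto)
    then show ?thesis using c by (subst (asm) ennreal_le_iff) auto
  qed
  define I where "I = (\<integral>\<^sup>+x\<in>P. f x \<partial>lebesgue)"
  have "avg Q f \<le> I / ennreal c"
    unfolding avg_def c I_def using P(2)
    by (intro divide_right_mono_ennreal nn_integral_mono) (auto split: split_indicator)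
  also have "\<dots> = I * ennreal (1 / c)"
    using c by (simp add: divide_ennreal_def inverse_ennreal inverse_eq_divide)
  also have "\<dots> \<le> I * ennreal (12 ^ CARD('n) * (1 / p))"
    using c p pc by (intro mult_left_mono ennreal_leI) (auto simp: field_simps)
  also have "\<dots> = ennreal (12 ^ CARD('n)) * (I * ennreal (1 / p))"
    using p by (subst ennreal_mult) (auto simp: ac_simps)
  also have "I * ennreal (1 / p) = I / ennreal p"
    using p by (simp add: divide_ennreal_def inverse_ennreal inverse_eq_divide)
  also have "\<dots> \<le> maxop lebesgue (grid s) f x"
    using avg_le_maxop[OF P(1), of x lebesgue f] P(2) assms(2) p by (auto simp: I_def)
  also have "\<dots> \<le> dmax f x" unfolding dmax_def by (rule SUP_upper) auto
  finally show ?thesis by (simp add: mult_left_mono)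
qed

definition buckley_const :: "nat \<Rightarrow> real \<Rightarrow> real" where
  "buckley_const n r = 2 ^ n * (doob_const (r / (r - 1)) * doob_const r)"

lemma buckley_const_pos: "1 < r \<Longrightarrow> 0 < buckley_const n r"
  by (simp add: buckley_const_def doob_const_pos field_simps)

lemma dmax_bound:
  fixes W :: "real ^ 'n \<Rightarrow> real"
  assumes W: "pos_weight W" and r: "1 < r" and K: "Ap_char r W \<le> ennreal K" "0 < K"
    and f [measurable]: "f \<in> borel_measurable lebesgue"
  shows "(\<integral>\<^sup>+x. epowr (dmax f x) r * ennreal (W x) \<partial>lebesgue)
    \<le> ennreal (buckley_const CARD('n) r * K powr (r / (r - 1)))
      * (\<integral>\<^sup>+x. epowr (f x) r * ennreal (W x) \<partial>lebesgue)"
proof -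
  let ?c = "doob_const (r / (r - 1)) * doob_const r * K powr (r / (r - 1))"
  let ?I = "\<integral>\<^sup>+x. epowr (f x) r * ennreal (W x) \<partial>lebesgue"
  have [measurable]: "W \<in> borel_measurable lebesgue" using pos_weightD W by auto
  have [measurable]: "maxop lebesgue (grid s) f \<in> borel_measurable lebesgue" for s :: "'n \<Rightarrow> bool"
    by (intro measurable_maxop countable_grid averaging_grid_lebesgue)
  have "(\<integral>\<^sup>+x. epowr (dmax f x) r * ennreal (W x) \<partial>lebesgue)
      \<le> (\<integral>\<^sup>+x. (\<Sum>s\<in>UNIV. epowr (maxop lebesgue (grid s) f x) r * ennreal (W x)) \<partial>lebesgue)"
    unfolding sum_distrib_right[symmetric] dmax_def
  proof (intro nn_integral_mono mult_right_mono)
    fix x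
    show "epowr (SUP s. maxop lebesgue (grid s) f x) r \<le> (\<Sum>s\<in>UNIV. epowr (maxop lebesgue (grid s) f x) r)"
      using r by (subst epowr_SUP) (auto intro!: SUP_least member_le_sum)
  qed auto
  also have "\<dots> = (\<Sum>s\<in>UNIV. \<integral>\<^sup>+x. epowr (maxop lebesgue (grid s) f x) r * ennreal (W x) \<partial>lebesgue)"
    by (intro nn_integral_sum) auto
  also have "\<dots> \<le> (\<Sum>s\<in>(UNIV :: ('n \<Rightarrow> bool) set). ennreal ?c * ?I)"
    by (intro sum_mono grid_maxop_bound[OF W r K f])
  also have "\<dots> = of_nat (2 ^ CARD('n)) * (ennreal ?c * ?I)"
    by (simp add: card_fun card_UNIV_bool)
  also have "\<dots> = ennreal (buckley_const CARD('n) r * K powr (r / (r - 1))) * ?I"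
  proof -
    have "0 \<le> ?c" using doob_const_pos[OF r] doob_const_pos[of "r / (r - 1)"] r by (simp add: field_simps)
    then have "ennreal (2 ^ CARD('n) * ?c) = ennreal (2 ^ CARD('n)) * ennreal ?c"
      by (intro ennreal_mult) auto
    moreover have "ennreal (2 ^ CARD('n)) = of_nat (2 ^ CARD('n))"
      by (metis ennreal_of_nat_eq_real_of_nat of_nat_numeral of_nat_power)
    ultimately show ?thesis by (simp add: buckley_const_def mult.assoc)
  qed
  finally show ?thesis .
qed

section \<open>The Rubio de Francia algorithm\<close>

lemma maxop_suminf_le:
  assumes [measurable]: "\<And>k. g k \<in> borel_measurable M" and "averaging M F"
  shows "maxop M F (\<lambda>x. \<Sum>k. g k x) x \<le> (\<Sum>k. maxop M F (g k) x)"
  unfolding maxop_def[of M F "\<lambda>x. \<Sum>k. g k x"]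
proof (rule SUP_least)
  fix Q assume Q: "Q \<in> F"
  then have [measurable]: "Q \<in> sets M" using assms by (auto simp: averaging_def)
  have "(\<integral>\<^sup>+y\<in>Q. (\<Sum>k. g k y) \<partial>M) = (\<integral>\<^sup>+y. (\<Sum>k. g k y * indicator Q y) \<partial>M)"
    by simp
  also have "\<dots> = (\<Sum>k. \<integral>\<^sup>+y\<in>Q. g k y \<partial>M)"
    by (intro nn_integral_suminf) auto
  finally have "(\<integral>\<^sup>+y\<in>Q. (\<Sum>k. g k y) \<partial>M) / emeasure M Q * indicator Q x
      = (\<Sum>k. (\<integral>\<^sup>+y\<in>Q. g k y \<partial>M) / emeasure M Q * indicator Q x)"
    by simp
  also have "\<dots> \<le> (\<Sum>k. maxop M F (g k) x)"
    by (intro suminf_le summableI) (auto simp: maxop_def intro: SUP_upper Q)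
  finally show "(\<integral>\<^sup>+y\<in>Q. (\<Sum>k. g k y) \<partial>M) / emeasure M Q * indicator Q x
    \<le> (\<Sum>k. maxop M F (g k) x)" .
qed

lemma maxop_cmult:
  assumes [measurable]: "g \<in> borel_measurable M" and "averaging M F"
  shows "maxop M F (\<lambda>x. c * g x) x = c * maxop M F g x"
proof -
  have "(\<integral>\<^sup>+y\<in>Q. (c * g y) \<partial>M) = c * (\<integral>\<^sup>+y\<in>Q. g y \<partial>M)" if "Q \<in> F" for Q
  proof -
    have [measurable]: "Q \<in> sets M" using that assms by (auto simp: averaging_def)
    show ?thesis by (simp add: mult.assoc nn_integral_cmult)
  qed
  then show ?thesis unfolding maxop_def SUP_mult_left_ennreal
    by (intro SUP_cong) (auto simp flip: ennreal_times_divide simp: mult.assoc[symmetric])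
qed

lemma dmax_suminf_le:
  assumes [measurable]: "\<And>k. g k \<in> borel_measurable lebesgue"
  shows "dmax (\<lambda>x. \<Sum>k. c k * g k x) x \<le> (\<Sum>k. c k * dmax (g k) x)"
  unfolding dmax_def[of "\<lambda>x. \<Sum>k. c k * g k x"]
proof (rule SUP_least)
  fix s
  have "maxop lebesgue (grid s) (\<lambda>x. \<Sum>k. c k * g k x) x \<le> (\<Sum>k. maxop lebesgue (grid s) (\<lambda>x. c k * g k x) x)"
    by (intro maxop_suminf_le averaging_grid_lebesgue) auto
  also have "\<dots> \<le> (\<Sum>k. c k * dmax (g k) x)"
    by (intro suminf_le summableI)
      (auto simp: maxop_cmult averaging_grid_lebesgue dmax_def intro!: mult_left_mono SUP_upper)
  finally show "maxop lebesgue (grid s) (\<lambda>x. \<Sum>k. c k * g k x) x \<le> (\<Sum>k. c k * dmax (g k) x)" .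
qed

lemma suminf_half_powers: "(\<Sum>k. ennreal ((1/2) ^ k)) = ennreal 2"
proof -
  have "(\<lambda>k. (1/2) ^ k) sums (1 / (1 - 1/2 :: real))" by (rule geometric_sums) simp
  then show ?thesis by (intro suminf_ennreal_eq) auto
qed

text \<open>Convexity of the \<open>r\<close>-th power for the weights \<open>2\<^bsup>-k\<^esup>\<close>, which takes the place of Minkowski's
  inequality for the series below.\<close>

lemma suminf_half_powers_Jensen:
  fixes b :: "nat \<Rightarrow> ennreal"
  assumes r: "1 < r"
  shows "epowr (\<Sum>k. ennreal ((1/2) ^ k) * b k) r
    \<le> ennreal (2 powr (r - 1)) * (\<Sum>k. ennreal ((1/2) ^ k) * epowr (b k) r)"
proof -
  have 1: "ennreal ((1/2) ^ k) * b k
      = epowr (ennreal ((1/2) ^ k) * epowr (b k) r) (1 / r) * epowr (ennreal ((1/2) ^ k)) (1 - 1 / r)" for k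
  proof -
    have "epowr (ennreal ((1/2) ^ k)) (1 / r) * epowr (ennreal ((1/2) ^ k)) (1 - 1 / r) = ennreal ((1/2) ^ k)"
      using epowr_add[of "1 / r" "1 - 1 / r" "ennreal ((1/2) ^ k)"] r by simp
    moreover have "epowr (ennreal ((1/2) ^ k) * epowr (b k) r) (1 / r)
        = epowr (ennreal ((1/2) ^ k)) (1 / r) * b k"
      using r by (simp add: epowr_mult epowr_epowr)
    ultimately show ?thesis by (metis mult.assoc mult.commute)
  qed
  have "(\<Sum>k. ennreal ((1/2) ^ k) * b k)
      = (\<integral>\<^sup>+k. epowr (ennreal ((1/2) ^ k) * epowr (b k) r) (1 / r) * epowr (ennreal ((1/2) ^ k)) (1 - 1 / r)
          \<partial>count_space UNIV)"
    by (subst nn_integral_count_space_nat) (simp only: 1[symmetric])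
  also have "\<dots> \<le> epowr (\<integral>\<^sup>+k. ennreal ((1/2) ^ k) * epowr (b k) r \<partial>count_space UNIV) (1 / r)
      * epowr (\<integral>\<^sup>+k. ennreal ((1/2) ^ k) \<partial>count_space UNIV) (1 - 1 / r)"
    using r by (intro nn_integral_Hoelder) auto
  also have "\<dots> = epowr (\<Sum>k. ennreal ((1/2) ^ k) * epowr (b k) r) (1 / r) * epowr (ennreal 2) (1 - 1 / r)"
    by (simp only: nn_integral_count_space_nat suminf_half_powers)
  finally have "epowr (\<Sum>k. ennreal ((1/2) ^ k) * b k) r
      \<le> epowr (epowr (\<Sum>k. ennreal ((1/2) ^ k) * epowr (b k) r) (1 / r) * epowr (ennreal 2) (1 - 1 / r)) r"
    using r by (intro epowr_mono) auto
  also have "\<dots> = ennreal (2 powr (r - 1)) * (\<Sum>k. ennreal ((1/2) ^ k) * epowr (b k) r)"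
  proof -
    have "(1 - 1 / r) * r = r - 1" using r by (simp add: field_simps)
    moreover have "epowr (epowr (ennreal 2) (1 - 1 / r)) r = epowr (ennreal 2) ((1 - 1 / r) * r)"
      using r by (intro epowr_epowr) auto
    ultimately have "epowr (epowr (ennreal 2) (1 - 1 / r)) r = ennreal (2 powr (r - 1))"
      by (simp only:) (simp add: epowr_ennreal_pos del: ennreal_numeral)
    then show ?thesis using r by (simp add: epowr_mult epowr_epowr mult.commute del: ennreal_numeral)
  qed
  finally show ?thesis .
qed

definition rdf_const :: "nat \<Rightarrow> real \<Rightarrow> real" where
  "rdf_const n r = 12 ^ n * (2 * buckley_const n r powr (1 / r))"

lemma rdf_const_pos: "1 < r \<Longrightarrow> 0 < rdf_const n r"
  using buckley_const_pos[of r n] by (simp add: rdf_const_def)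

text \<open>With \<open>A\<close> the bound for the norm of the maximal operator \<open>M\<close>, the majorant is
  \<open>v = (\<Sum>k. (2 A)\<^bsup>-k\<^esup> M\<^sup>k h)\<close>.  Its first term is \<open>h\<close>; the norm of the \<open>k\<close>-th term is at most \<open>2\<^bsup>-k\<^esup>\<close>
  times the norm of \<open>h\<close>; and \<open>M v \<le> 2 A v\<close> by shifting the series, which is the \<open>A(1)\<close>
  property.  The function \<open>u\<close> is \<open>v\<close> with its infinite values replaced on a null set.\<close>

lemma rubio_de_francia:
  fixes W :: "real ^ 'n \<Rightarrow> real" and h :: "real ^ 'n \<Rightarrow> ennreal"
  assumes W: "pos_weight W" and r: "1 < r" and K: "Ap_char r W \<le> ennreal K" "0 < K"
    and h [measurable]: "h \<in> borel_measurable lebesgue"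
    and hfin: "(\<integral>\<^sup>+x. epowr (h x) r * ennreal (W x) \<partial>lebesgue) < \<infinity>"
    and hne: "\<not> (AE x in lebesgue. h x = 0)"
  obtains u where "pos_weight u" "AE x in lebesgue. h x \<le> ennreal (u x)"
    "(\<integral>\<^sup>+x. ennreal (u x powr r * W x) \<partial>lebesgue)
      \<le> ennreal (2 powr r) * (\<integral>\<^sup>+x. epowr (h x) r * ennreal (W x) \<partial>lebesgue)"
    "\<And>Q. Q \<in> cubes \<Longrightarrow> AE x in lebesgue. x \<in> Q \<longrightarrow>
      avg Q (\<lambda>x. ennreal (u x)) \<le> ennreal (rdf_const CARD('n) r * K powr (1 / (r - 1))) * ennreal (u x)"
proof -
  define A where "A = buckley_const CARD('n) r powr (1 / r) * K powr (1 / (r - 1))"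
  have A: "0 < A" using buckley_const_pos[OF r, of "CARD('n)"] K by (simp add: A_def)
  have Ar: "A powr r = buckley_const CARD('n) r * K powr (r / (r - 1))"
    using r buckley_const_pos[OF r, of "CARD('n)"] K by (simp add: A_def powr_mult powr_powr)
  define H where "H = (\<integral>\<^sup>+x. epowr (h x) r * ennreal (W x) \<partial>lebesgue)"
  define g where "g k = (dmax ^^ k) h" for k
  have gS: "g (Suc k) = dmax (g k)" "g 0 = h" for k by (auto simp: g_def)
  have [measurable]: "g k \<in> borel_measurable lebesgue" for k
    by (cases k) (auto simp: gS)
  have [measurable]: "W \<in> borel_measurable lebesgue" using pos_weightD W by auto
  have gk: "(\<integral>\<^sup>+x. epowr (g k x) r * ennreal (W x) \<partial>lebesgue) \<le> ennreal ((A powr r) ^ k) * H" for k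
  proof (induction k)
    case (Suc k)
    have "(\<integral>\<^sup>+x. epowr (g (Suc k) x) r * ennreal (W x) \<partial>lebesgue)
        \<le> ennreal (A powr r) * (\<integral>\<^sup>+x. epowr (g k x) r * ennreal (W x) \<partial>lebesgue)"
      unfolding gS Ar by (intro dmax_bound W r K) auto
    also have "\<dots> \<le> ennreal (A powr r) * (ennreal ((A powr r) ^ k) * H)"
      by (intro mult_left_mono Suc) auto
    finally show ?case by (simp add: ennreal_mult mult.assoc)
  qed (simp add: gS H_def)
  define v where "v x = (\<Sum>k. ennreal ((1 / (2 * A)) ^ k) * g k x)" for x
  have [measurable]: "v \<in> borel_measurable lebesgue" unfolding v_def[abs_def] by measurable
  have hv: "h x \<le> v x" for x
  proof -
    have "(\<Sum>k\<in>{0}. ennreal ((1 / (2 * A)) ^ k) * g k x) \<le> v x"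
      unfolding v_def by (intro sum_le_suminf summableI) auto
    then show ?thesis by (simp add: gS)
  qed
  have vint: "(\<integral>\<^sup>+x. epowr (v x) r * ennreal (W x) \<partial>lebesgue) \<le> ennreal (2 powr r) * H"
  proof -
    have "epowr (v x) r \<le> ennreal (2 powr (r - 1)) * (\<Sum>k. ennreal ((1/2) ^ k * (1 / A) powr (r * k)) * epowr (g k x) r)" for x
    proof -
      have "v x = (\<Sum>k. ennreal ((1/2) ^ k) * (ennreal ((1 / A) ^ k) * g k x))"
        unfolding v_def using A
        by (intro suminf_cong) (simp add: power_mult_distrib power_divide ennreal_mult[symmetric] mult.assoc[symmetric])
      also have "epowr \<dots> r \<le> ennreal (2 powr (r - 1))
          * (\<Sum>k. ennreal ((1/2) ^ k) * epowr (ennreal ((1 / A) ^ k) * g k x) r)"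
        by (rule suminf_half_powers_Jensen[OF r])
      also have "(\<Sum>k. ennreal ((1/2) ^ k) * epowr (ennreal ((1 / A) ^ k) * g k x) r)
          = (\<Sum>k. ennreal ((1/2) ^ k * (1 / A) powr (r * k)) * epowr (g k x) r)"
      proof (rule suminf_cong)
        fix k
        have "epowr (ennreal ((1 / A) ^ k)) r = ennreal ((1 / A) powr (r * k))"
          using A r by (simp add: epowr_ennreal_pos powr_powr mult.commute flip: powr_realpow)
        then show "ennreal ((1/2) ^ k) * epowr (ennreal ((1 / A) ^ k) * g k x) r
          = ennreal ((1/2) ^ k * (1 / A) powr (r * k)) * epowr (g k x) r"
          using r by (simp only: epowr_mult mult.assoc ennreal_mult powr_ge_zero zero_le_power)
      qed
      finally show ?thesis .
    qed
    then have "(\<integral>\<^sup>+x. epowr (v x) r * ennreal (W x) \<partial>lebesgue)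
        \<le> (\<integral>\<^sup>+x. ennreal (2 powr (r - 1)) * (\<Sum>k. ennreal ((1/2) ^ k * (1 / A) powr (r * k)) * epowr (g k x) r) * ennreal (W x) \<partial>lebesgue)"
      by (intro nn_integral_mono mult_right_mono) auto
    also have "\<dots> = (\<integral>\<^sup>+x. ennreal (2 powr (r - 1)) * (\<Sum>k. ennreal ((1/2) ^ k * (1 / A) powr (r * k)) * (epowr (g k x) r * ennreal (W x))) \<partial>lebesgue)"
      by (simp add: mult.assoc flip: ennreal_suminf_multc)
    also have "\<dots> = ennreal (2 powr (r - 1)) * (\<Sum>k. ennreal ((1/2) ^ k * (1 / A) powr (r * k)) * (\<integral>\<^sup>+x. epowr (g k x) r * ennreal (W x) \<partial>lebesgue))"
      by (simp add: nn_integral_cmult nn_integral_suminf)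
    also have "\<dots> \<le> ennreal (2 powr (r - 1)) * (\<Sum>k. ennreal ((1/2) ^ k) * H)"
    proof (intro mult_left_mono suminf_le summableI)
      fix k
      have "ennreal ((1/2) ^ k * (1 / A) powr (r * k)) * (\<integral>\<^sup>+x. epowr (g k x) r * ennreal (W x) \<partial>lebesgue)
          \<le> ennreal ((1/2) ^ k * (1 / A) powr (r * k)) * (ennreal ((A powr r) ^ k) * H)"
        by (intro mult_left_mono gk) auto
      also have "\<dots> = ennreal ((1/2) ^ k * ((1 / A) powr (r * k) * (A powr r) ^ k)) * H"
        by (simp only: ennreal_mult zero_le_power powr_ge_zero mult_nonneg_nonneg mult.assoc)
      also have "(1 / A) powr (r * k) * (A powr r) ^ k = 1"
        using A by (simp add: powr_powr powr_divide flip: powr_realpow)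
      finally show "ennreal ((1/2) ^ k * (1 / A) powr (r * k)) * (\<integral>\<^sup>+x. epowr (g k x) r * ennreal (W x) \<partial>lebesgue)
        \<le> ennreal ((1/2) ^ k) * H" by simp
    qed auto
    also have "\<dots> = ennreal (2 powr (r - 1) * 2) * H"
      unfolding ennreal_suminf_multc suminf_half_powers mult.assoc[symmetric]
      by (subst ennreal_mult) auto
    also have "2 powr (r - 1) * 2 = 2 powr r" by (simp add: powr_diff)
    finally show ?thesis .
  qed
  have Mv: "dmax v x \<le> ennreal (2 * A) * v x" for x
  proof -
    have "dmax v x \<le> (\<Sum>k. ennreal ((1 / (2 * A)) ^ k) * g (Suc k) x)"
      unfolding v_def[abs_def] gS by (intro dmax_suminf_le) auto
    also have "\<dots> = (\<Sum>k. ennreal (2 * A) * (ennreal ((1 / (2 * A)) ^ Suc k) * g (Suc k) x))"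
    proof (rule suminf_cong)
      fix k
      have "(1 / (2 * A)) ^ k = 2 * A * (1 / (2 * A)) ^ Suc k" using A by simp
      then have "ennreal ((1 / (2 * A)) ^ k) = ennreal (2 * A) * ennreal ((1 / (2 * A)) ^ Suc k)"
        using A by (subst ennreal_mult[symmetric]) auto
      then show "ennreal ((1 / (2 * A)) ^ k) * g (Suc k) x = ennreal (2 * A) * (ennreal ((1 / (2 * A)) ^ Suc k) * g (Suc k) x)"
        by (simp only: mult.assoc)
    qed
    also have "\<dots> = ennreal (2 * A) * (\<Sum>k. ennreal ((1 / (2 * A)) ^ Suc k) * g (Suc k) x)"
      by (rule ennreal_suminf_cmult)
    also have "\<dots> \<le> ennreal (2 * A) * v x"
    proof (rule mult_left_mono)
      have "v x = (\<Sum>k. ennreal ((1 / (2 * A)) ^ Suc k) * g (Suc k) x)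
          + ennreal ((1 / (2 * A)) ^ 0) * g 0 x"
        unfolding v_def using suminf_offset[of "\<lambda>k. ennreal ((1 / (2 * A)) ^ k) * g k x" 1] by (simp add: add.commute)
      then show "(\<Sum>k. ennreal ((1 / (2 * A)) ^ Suc k) * g (Suc k) x) \<le> v x" by simp
    qed simp
    finally show ?thesis .
  qed
  let ?L = "rdf_const CARD('n) r * K powr (1 / (r - 1))"
  have L: "12 ^ CARD('n) * (2 * A) = ?L" by (simp add: rdf_const_def A_def)
  have av: "avg Q v \<le> ennreal ?L * v x" if "Q \<in> cubes" "x \<in> Q" for Q x
  proof -
    have "avg Q v \<le> ennreal (12 ^ CARD('n)) * dmax v x"
      using that by (intro avg_le_dmax) auto
    also have "\<dots> \<le> ennreal (12 ^ CARD('n)) * (ennreal (2 * A) * v x)"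
      by (intro mult_left_mono Mv) auto
    also have "\<dots> = ennreal ?L * v x"
      unfolding L[symmetric] using A by (subst ennreal_mult) (auto simp: mult.assoc)
    finally show ?thesis .
  qed
  \<comment> \<open>A zero of \<open>v\<close> would force all averages over cubes through it to vanish.\<close>
  have vpos: "v x \<noteq> 0" for x
  proof
    assume v0: "v x = 0"
    have "AE y in lebesgue. v y = 0"
    proof (rule AE_big_cubeI)
      fix j
      obtain i where "norm x \<le> real i" using real_arch_simple by blast
      define Q :: "(real ^ 'n) set" where "Q = big_cube (max i j)"
      have Q: "Q \<in> cubes" and [measurable]: "Q \<in> sets lebesgue"
        unfolding Q_def by (rule big_cube)+
      have "x \<in> Q" unfolding Q_def
        using norm_le_big_cube[OF \<open>norm x \<le> real i\<close>] big_cube_mono[of i "max i j"] by auto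
      with av[OF Q] v0 have "avg Q v = 0" by (metis le_zero_eq mult_zero_right)
      moreover obtain c where "0 < c" "emeasure lebesgue Q = ennreal c" "Q \<in> sets lebesgue"
        using cubes_measure[OF Q] .
      ultimately have "(\<integral>\<^sup>+y\<in>Q. v y \<partial>lebesgue) = 0" by (simp add: avg_def)
      then have "AE y in lebesgue. v y * indicator Q y = 0"
        by (subst (asm) nn_integral_0_iff_AE) auto
      moreover have "big_cube j \<subseteq> Q" unfolding Q_def by (rule big_cube_mono) simp
      ultimately show "AE y in lebesgue. y \<in> big_cube j \<longrightarrow> v y = 0"
        by (auto elim!: eventually_mono)
    qed
    then have "AE y in lebesgue. h y = 0"
    proof eventually_elim
      case (elim y)
      then show ?case using hv[of y] by simp
    qed
    then show False using hne by simp
  qed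
  have "(\<integral>\<^sup>+x. epowr (v x) r * ennreal (W x) \<partial>lebesgue) \<noteq> \<infinity>"
    using vint hfin unfolding H_def[symmetric]
    by (auto simp: ennreal_mult_eq_top_iff top_unique)
  then have "AE x in lebesgue. epowr (v x) r * ennreal (W x) \<noteq> \<infinity>"
    by (intro nn_integral_PInf_AE) auto
  then have vfin: "AE x in lebesgue. v x < top"
  proof eventually_elim
    case (elim x)
    then show ?case using pos_weightD(1)[OF W, of x] r
      by (auto simp: ennreal_mult_eq_top_iff epowr_eq_top_iff less_top[symmetric] ennreal_eq_0_iff)
  qed
  define u where "u x = (if v x = top then 1 else enn2real (v x))" for x
  have uv: "AE x in lebesgue. ennreal (u x) = v x"
    using vfin by eventually_elim (auto simp: u_def)
  have upos: "0 < u x" for x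
    using vpos[of x] by (auto simp: u_def enn2real_positive_iff less_top zero_less_iff_neq_zero)
  have [measurable]: "u \<in> borel_measurable lebesgue" unfolding u_def[abs_def] by measurable
  show ?thesis
  proof (rule that)
    show "pos_weight u" using upos by (auto simp: pos_weight_def)
    show "AE x in lebesgue. h x \<le> ennreal (u x)"
      using uv by eventually_elim (simp add: hv)
    have "(\<integral>\<^sup>+x. ennreal (u x powr r * W x) \<partial>lebesgue) = (\<integral>\<^sup>+x. epowr (v x) r * ennreal (W x) \<partial>lebesgue)"
    proof (rule nn_integral_cong_AE)
      show "AE x in lebesgue. ennreal (u x powr r * W x) = epowr (v x) r * ennreal (W x)"
        using uv
      proof eventually_elim
        case (elim x)
        then show ?case using upos[of x] pos_weightD(1)[OF W, of x]
          by (simp add: ennreal_mult epowr_ennreal_pos flip: elim)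
      qed
    qed
    then show "(\<integral>\<^sup>+x. ennreal (u x powr r * W x) \<partial>lebesgue)
      \<le> ennreal (2 powr r) * (\<integral>\<^sup>+x. epowr (h x) r * ennreal (W x) \<partial>lebesgue)"
      using vint by (simp add: H_def)
    show "AE x in lebesgue. x \<in> Q \<longrightarrow> avg Q (\<lambda>x. ennreal (u x)) \<le> ennreal ?L * ennreal (u x)"
      if "Q \<in> cubes" for Q
    proof -
      have "avg Q (\<lambda>x. ennreal (u x)) = avg Q v"
        unfolding avg_def using uv
        by (intro arg_cong[where f="\<lambda>z. z / _"] nn_integral_cong_AE) (auto elim: eventually_mono)
      then show ?thesis using uv av[OF that] by (auto elim!: eventually_mono)
    qed
  qed
qed

section \<open>Products of powers of Muckenhoupt weights\<close>

definition A1_bound :: "(real ^ 'n \<Rightarrow> real) \<Rightarrow> real \<Rightarrow> bool" where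
  "A1_bound u L \<longleftrightarrow> (\<forall>Q\<in>cubes. AE x in lebesgue. x \<in> Q \<longrightarrow> avg Q (\<lambda>x. ennreal (u x)) \<le> ennreal L * ennreal (u x))"

text \<open>For \<open>r = 1\<close> the exponent \<open>-1/(r - 1)\<close> of the dual weight degenerates, and the class has
  its own definition.\<close>

definition Ap_bound :: "real \<Rightarrow> (real ^ 'n \<Rightarrow> real) \<Rightarrow> real \<Rightarrow> bool" where
  "Ap_bound r V K \<longleftrightarrow> (if r = 1 then A1_bound V K else Ap_char r V \<le> ennreal K)"

lemma Ap_char_dual:
  assumes W: "pos_weight W" and r: "1 < r" and K: "Ap_char r W \<le> ennreal K" "0 < K"
  shows "Ap_char (r / (r - 1)) (dual_weight r W) \<le> ennreal (K powr (1 / (r - 1)))"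
  unfolding Ap_char_def
proof (rule SUP_least)
  fix Q :: "(real ^ 'a) set" assume Q: "Q \<in> cubes"
  have e: "r / (r - 1) - 1 = 1 / (r - 1)" using r by (simp add: field_simps)
  have "dual_weight (r / (r - 1)) (dual_weight r W) x = W x" for x
  proof -
    have "(- 1 / (r - 1)) * (- 1 / (1 / (r - 1))) = 1" using r by (simp add: divide_eq_eq)
    then show ?thesis
      using pos_weightD(1)[OF W, of x] unfolding dual_weight_def e powr_powr by (simp only:) simp
  qed
  then have "avg Q (\<lambda>x. ennreal (dual_weight r W x))
      * epowr (avg Q (\<lambda>x. ennreal (dual_weight (r / (r - 1)) (dual_weight r W) x))) (r / (r - 1) - 1)
    = epowr (avg Q (\<lambda>x. ennreal (W x)) * epowr (avg Q (\<lambda>x. ennreal (dual_weight r W x))) (r - 1)) (1 / (r - 1))"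
    using r by (simp add: e epowr_mult epowr_epowr mult.commute)
  also have "\<dots> \<le> epowr (Ap_char r W) (1 / (r - 1))"
    using r unfolding Ap_char_def by (intro epowr_mono SUP_upper Q) auto
  also have "\<dots> \<le> epowr (ennreal K) (1 / (r - 1))"
    using r K by (intro epowr_mono) auto
  also have "\<dots> = ennreal (K powr (1 / (r - 1)))" using K by (simp add: epowr_ennreal_pos)
  finally show "avg Q (\<lambda>x. ennreal (dual_weight r W x))
      * epowr (avg Q (\<lambda>x. ennreal (dual_weight (r / (r - 1)) (dual_weight r W) x))) (r / (r - 1) - 1)
    \<le> ennreal (K powr (1 / (r - 1)))" .
qed

lemma avg_Hoelder:
  assumes t: "0 < t" "t < 1" and Q: "Q \<in> cubes"
    and [measurable]: "F \<in> borel_measurable lebesgue" "G \<in> borel_measurable lebesgue"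
  shows "avg Q (\<lambda>x. epowr (F x) t * epowr (G x) (1 - t)) \<le> epowr (avg Q F) t * epowr (avg Q G) (1 - t)"
proof -
  obtain c where c: "0 < c" "emeasure lebesgue Q = ennreal c" and [measurable]: "Q \<in> sets lebesgue"
    using cubes_measure[OF Q] .
  have "(\<integral>\<^sup>+x\<in>Q. (epowr (F x) t * epowr (G x) (1 - t)) \<partial>lebesgue)
      = (\<integral>\<^sup>+x. epowr (F x * indicator Q x) t * epowr (G x * indicator Q x) (1 - t) \<partial>lebesgue)"
    using t by (intro nn_integral_cong) (auto split: split_indicator)
  also have "\<dots> \<le> epowr (\<integral>\<^sup>+x\<in>Q. F x \<partial>lebesgue) t * epowr (\<integral>\<^sup>+x\<in>Q. G x \<partial>lebesgue) (1 - t)"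
    using t by (intro nn_integral_Hoelder) auto
  finally have "avg Q (\<lambda>x. epowr (F x) t * epowr (G x) (1 - t))
      \<le> epowr (\<integral>\<^sup>+x\<in>Q. F x \<partial>lebesgue) t * epowr (\<integral>\<^sup>+x\<in>Q. G x \<partial>lebesgue) (1 - t) / ennreal c"
    unfolding avg_def c by (rule divide_right_mono_ennreal)
  also have "\<dots> = epowr (avg Q F) t * epowr (avg Q G) (1 - t)"
  proof -
    have "ennreal (c powr (- t)) * ennreal (c powr (- (1 - t))) = ennreal (1 / c)"
    proof -
      have "c powr (- t) * c powr (- (1 - t)) = c powr (- 1)"
        unfolding powr_add[symmetric] by simp
      then show ?thesis using c by (simp add: powr_minus_divide flip: ennreal_mult)
    qed
    moreover have "x / ennreal c = x * ennreal (1 / c)" for x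
      using c by (simp add: divide_ennreal_def inverse_ennreal inverse_eq_divide)
    moreover have "epowr (x / ennreal c) t = epowr x t * ennreal (c powr (- t))"
      "epowr (x / ennreal c) (1 - t) = epowr x (1 - t) * ennreal (c powr (- (1 - t)))" for x
      using c t by (auto intro!: epowr_divide_ennreal simp del: minus_diff_eq)
    ultimately show ?thesis
      unfolding avg_def c(2) by (metis (no_types, lifting) mult.assoc mult.left_commute)
  qed
  finally show ?thesis .
qed

lemma cube_AE_ex:
  assumes "Q \<in> cubes" "AE x in lebesgue. x \<in> Q \<longrightarrow> P x"
  shows "\<exists>x\<in>Q. P x"
proof (rule ccontr)
  assume "\<not> ?thesis"
  then have ae: "AE x in lebesgue. x \<notin> Q" using assms(2) by (auto elim!: eventually_mono)
  obtain c where c: "0 < c" "emeasure lebesgue Q = ennreal c" "Q \<in> sets lebesgue"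
    using cubes_measure[OF assms(1)] .
  have "emeasure lebesgue Q = 0"
    using ae by (subst (asm) AE_iff_measurable[OF c(3)]) auto
  then show False using c by simp
qed

text \<open>The use of the \<open>A(1)\<close> condition: negative powers of \<open>u\<close> on a cube are bounded by powers of the
  average \<open>m\<close> of \<open>u\<close>, while positive powers below \<open>1\<close> are averaged by Hoelder's inequality.\<close>

lemma A1_bound_cube:
  assumes u: "pos_weight u" and L: "A1_bound u L" "0 < L" and Q: "Q \<in> cubes"
  obtains m where "0 < m" "avg Q (\<lambda>x. ennreal (u x)) = ennreal m"
    "AE x in lebesgue. x \<in> Q \<longrightarrow> m / L \<le> u x"
proof -
  let ?m = "avg Q (\<lambda>x. ennreal (u x))"
  have ae: "AE x in lebesgue. x \<in> Q \<longrightarrow> ?m \<le> ennreal L * ennreal (u x)"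
    using L Q by (auto simp: A1_bound_def)
  obtain x where "?m \<le> ennreal L * ennreal (u x)" using cube_AE_ex[OF Q ae] by auto
  then have "?m < top" by (rule le_less_trans) (simp add: ennreal_mult_less_top)
  moreover have "?m \<noteq> 0"
  proof -
    obtain c where "0 < c" "emeasure lebesgue Q = ennreal c" "Q \<in> sets lebesgue"
      using cubes_measure[OF Q] .
    then show ?thesis using pos_weight_integral_pos[OF u Q] by (simp add: avg_def)
  qed
  ultimately obtain m where m: "0 < m" "?m = ennreal m"
    by (cases ?m rule: ennreal_zero_top_pos) auto
  have "AE x in lebesgue. x \<in> Q \<longrightarrow> m / L \<le> u x"
    using ae
  proof eventually_elim
    case (elim x)
    show ?case
    proof
      assume "x \<in> Q"
      then have "ennreal m \<le> ennreal (L * u x)"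
        using elim m L pos_weightD(1)[OF u, of x] by (simp add: ennreal_mult)
      then have "m \<le> L * u x"
        using L pos_weightD(1)[OF u, of x] by (subst (asm) ennreal_le_iff) auto
      then show "m / L \<le> u x" using L by (simp add: field_simps)
    qed
  qed
  with m show ?thesis using that by blast
qed

lemma avg_mono_AE:
  assumes "AE x in lebesgue. x \<in> Q \<longrightarrow> f x \<le> g x"
  shows "avg Q f \<le> avg Q g"
  unfolding avg_def using assms
  by (intro divide_right_mono_ennreal nn_integral_mono_AE) (auto elim!: eventually_mono split: split_indicator)

lemma avg_cmult:
  assumes Q: "Q \<in> cubes" and [measurable]: "f \<in> borel_measurable lebesgue"
  shows "avg Q (\<lambda>x. c * f x) = c * avg Q f"
proof -
  obtain c where "0 < c" "emeasure lebesgue Q = ennreal c" and [measurable]: "Q \<in> sets lebesgue"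
    using cubes_measure[OF Q] .
  show ?thesis unfolding avg_def by (simp add: mult.assoc nn_integral_cmult ennreal_times_divide)
qed

lemma Ap_char_averages:
  assumes W: "pos_weight W" and r: "1 < r" and K: "Ap_char r W \<le> ennreal K" "0 < K" and Q: "Q \<in> cubes"
  obtains a b where "0 < a" "0 < b" "avg Q (\<lambda>x. ennreal (W x)) = ennreal a"
    "avg Q (\<lambda>x. ennreal (dual_weight r W x)) = ennreal b" "a * b powr (r - 1) \<le> K"
proof -
  obtain a b c where "0 < a" "0 < b" "0 < c"
    "(\<integral>\<^sup>+x\<in>Q. ennreal (W x) \<partial>lebesgue) = ennreal a"
    "(\<integral>\<^sup>+x\<in>Q. ennreal (dual_weight r W x) \<partial>lebesgue) = ennreal b"
    "emeasure lebesgue Q = ennreal c" "a / c * (b / c) powr (r - 1) \<le> K"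
    using Ap_char_cube[OF assms] .
  then show ?thesis by (intro that[of "a / c" "b / c"]) (auto simp: avg_def divide_ennreal)
qed

text \<open>In the average of \<open>V = W u\<^bsup>r-r0\<^esup>\<close> the \<open>A(1)\<close> condition removes \<open>u\<close>.  The dual weight of \<open>V\<close>
  is \<open>\<sigma>\<^sup>t u\<^bsup>1-t\<^esup>\<close> with \<open>\<sigma>\<close> the dual weight of \<open>W\<close> and \<open>t = (r - 1)/(r0 - 1)\<close>, to which Hoelder's
  inequality applies; the powers of the average of \<open>u\<close> cancel.\<close>

lemma Ap_char_times_A1:
  assumes W: "pos_weight W" and r: "1 < r" "r < r0" and K: "Ap_char r W \<le> ennreal K" "0 < K"
    and u: "pos_weight u" and L: "A1_bound u L" "0 < L"
  shows "Ap_char r0 (\<lambda>x. W x * u x powr (r - r0)) \<le> ennreal (K * L powr (r0 - r))"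
  unfolding Ap_char_def
proof (rule SUP_least)
  fix Q :: "(real ^ 'a) set" assume Q: "Q \<in> cubes"
  let ?V = "\<lambda>x. W x * u x powr (r - r0)"
  define t where "t = (r - 1) / (r0 - 1)"
  have t: "0 < t" "t < 1" using r by (auto simp: t_def)
  have Wp: "0 < W x" and up: "0 < u x" for x using W u pos_weightD by auto
  have [measurable]: "W \<in> borel_measurable lebesgue" "u \<in> borel_measurable lebesgue"
    "dual_weight r W \<in> borel_measurable lebesgue"
    using pos_weightD(2) W u pos_weight_dual[OF W] by auto
  obtain a b where ab: "0 < a" "0 < b" "avg Q (\<lambda>x. ennreal (W x)) = ennreal a"
    "avg Q (\<lambda>x. ennreal (dual_weight r W x)) = ennreal b" "a * b powr (r - 1) \<le> K"
    using Ap_char_averages[OF W r(1) K Q] .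
  obtain m where m: "0 < m" "avg Q (\<lambda>x. ennreal (u x)) = ennreal m"
    "AE x in lebesgue. x \<in> Q \<longrightarrow> m / L \<le> u x"
    using A1_bound_cube[OF u L Q] .
  have "avg Q (\<lambda>x. ennreal (?V x)) \<le> avg Q (\<lambda>x. ennreal ((m / L) powr (r - r0)) * ennreal (W x))"
  proof (rule avg_mono_AE, use m(3) in eventually_elim, intro impI)
    fix x assume "x \<in> Q \<longrightarrow> m / L \<le> u x" "x \<in> Q"
    then have "u x powr (r - r0) \<le> (m / L) powr (r - r0)"
      using m L r by (intro powr_mono2') auto
    then show "ennreal (?V x) \<le> ennreal ((m / L) powr (r - r0)) * ennreal (W x)"
      using Wp[of x] by (simp add: mult.commute mult_left_mono flip: ennreal_mult)
  qed
  also have "\<dots> = ennreal ((m / L) powr (r - r0) * a)"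
    using ab by (subst avg_cmult[OF Q]) (auto simp: ennreal_mult)
  finally have 1: "avg Q (\<lambda>x. ennreal (?V x)) \<le> ennreal ((m / L) powr (r - r0) * a)" .
  have dual: "dual_weight r0 ?V x = dual_weight r W x powr t * u x powr (1 - t)" for x
  proof -
    have "dual_weight r0 ?V x = W x powr (- 1 / (r0 - 1)) * u x powr ((r - r0) * (- 1 / (r0 - 1)))"
      using Wp[of x] up[of x] by (simp add: dual_weight_def powr_mult powr_powr)
    also have "(r - r0) * (- 1 / (r0 - 1)) = 1 - t" using r by (simp add: t_def field_simps)
    also have "- 1 / (r0 - 1) = (- 1 / (r - 1)) * t" using r by (simp add: t_def)
    finally show ?thesis by (simp only: dual_weight_def powr_powr)
  qed
  have "avg Q (\<lambda>x. ennreal (dual_weight r0 ?V x))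
      = avg Q (\<lambda>x. epowr (ennreal (dual_weight r W x)) t * epowr (ennreal (u x)) (1 - t))"
    using up pos_weightD(1)[OF pos_weight_dual[OF W]]
    by (simp add: dual epowr_ennreal_pos ennreal_mult)
  also have "\<dots> \<le> epowr (ennreal b) t * epowr (ennreal m) (1 - t)"
    using avg_Hoelder[OF t Q, of "\<lambda>x. ennreal (dual_weight r W x)" "\<lambda>x. ennreal (u x)"] ab m by simp
  also have "\<dots> = ennreal (b powr t * m powr (1 - t))"
    using ab m by (simp add: epowr_ennreal_pos ennreal_mult)
  finally have "epowr (avg Q (\<lambda>x. ennreal (dual_weight r0 ?V x))) (r0 - 1)
      \<le> epowr (ennreal (b powr t * m powr (1 - t))) (r0 - 1)"
    using r by (intro epowr_mono) auto
  also have "\<dots> = ennreal (b powr (r - 1) * m powr (r0 - r))"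
  proof -
    have "t * (r0 - 1) = r - 1" "(1 - t) * (r0 - 1) = r0 - r" using r by (auto simp: t_def field_simps)
    then show ?thesis using ab m by (simp add: epowr_ennreal_pos powr_mult powr_powr)
  qed
  finally have 2: "epowr (avg Q (\<lambda>x. ennreal (dual_weight r0 ?V x))) (r0 - 1)
      \<le> ennreal (b powr (r - 1) * m powr (r0 - r))" .
  have "avg Q (\<lambda>x. ennreal (?V x)) * epowr (avg Q (\<lambda>x. ennreal (dual_weight r0 ?V x))) (r0 - 1)
      \<le> ennreal ((m / L) powr (r - r0) * a) * ennreal (b powr (r - 1) * m powr (r0 - r))"
    by (intro mult_mono 1 2) auto
  also have "\<dots> = ennreal ((a * b powr (r - 1)) * L powr (r0 - r))"
  proof -
    have "(m / L) powr (r - r0) * m powr (r0 - r) = L powr (r0 - r)"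
      using m L by (simp add: powr_divide powr_add[symmetric] powr_minus_divide[of L "r0 - r"] field_simps)
    then show ?thesis using ab by (simp flip: ennreal_mult)
  qed
  also have "\<dots> \<le> ennreal (K * L powr (r0 - r))"
    using ab by (intro ennreal_leI mult_right_mono) auto
  finally show "avg Q (\<lambda>x. ennreal (?V x)) * epowr (avg Q (\<lambda>x. ennreal (dual_weight r0 ?V x))) (r0 - 1)
    \<le> ennreal (K * L powr (r0 - r))" .
qed

text \<open>The same idea with the roles exchanged: Hoelder's inequality treats \<open>V = W\<^sup>t u\<^bsup>1-t\<^esup>\<close> itself, and the
  \<open>A(1)\<close> condition its dual weight.  For \<open>r0 = 1\<close> one has \<open>t = 0\<close> and \<open>V = u\<close>.\<close>

lemma Ap_bound_mean_A1:
  assumes W: "pos_weight W" and r: "1 \<le> r0" "r0 < r" and K: "Ap_char r W \<le> ennreal K" "0 < K"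
    and u: "pos_weight u" and L: "A1_bound u L" "0 < L"
  defines "t \<equiv> (r0 - 1) / (r - 1)"
  shows "Ap_bound r0 (\<lambda>x. W x powr t * u x powr (1 - t)) (K powr t * L powr (1 - t))"
proof (cases "r0 = 1")
  case True
  then have "t = 0" by (simp add: t_def)
  then show ?thesis using True L pos_weightD(1)[OF W] pos_weightD(1)[OF u] K
    by (simp add: Ap_bound_def less_imp_le less_imp_neq[THEN not_sym])
next
  case False
  with r have r: "1 < r0" "r0 < r" "1 < r" by auto
  have t: "0 < t" "t < 1" using r by (auto simp: t_def)
  let ?V = "\<lambda>x. W x powr t * u x powr (1 - t)"
  have Wp: "0 < W x" and up: "0 < u x" for x using W u pos_weightD by auto
  have [measurable]: "W \<in> borel_measurable lebesgue" "u \<in> borel_measurable lebesgue"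
    "dual_weight r W \<in> borel_measurable lebesgue"
    using pos_weightD(2) W u pos_weight_dual[OF W] by auto
  have "Ap_char r0 ?V \<le> ennreal (K powr t * L powr (1 - t))"
    unfolding Ap_char_def
  proof (rule SUP_least)
    fix Q :: "(real ^ 'a) set" assume Q: "Q \<in> cubes"
    obtain a b where ab: "0 < a" "0 < b" "avg Q (\<lambda>x. ennreal (W x)) = ennreal a"
      "avg Q (\<lambda>x. ennreal (dual_weight r W x)) = ennreal b" "a * b powr (r - 1) \<le> K"
      using Ap_char_averages[OF W r(3) K Q] .
    obtain m where m: "0 < m" "avg Q (\<lambda>x. ennreal (u x)) = ennreal m"
      "AE x in lebesgue. x \<in> Q \<longrightarrow> m / L \<le> u x"
      using A1_bound_cube[OF u L Q] .
    have "avg Q (\<lambda>x. ennreal (?V x)) = avg Q (\<lambda>x. epowr (ennreal (W x)) t * epowr (ennreal (u x)) (1 - t))"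
      using Wp up by (simp add: epowr_ennreal_pos ennreal_mult)
    also have "\<dots> \<le> epowr (ennreal a) t * epowr (ennreal m) (1 - t)"
      using avg_Hoelder[OF t Q, of "\<lambda>x. ennreal (W x)" "\<lambda>x. ennreal (u x)"] ab m by simp
    also have "\<dots> = ennreal (a powr t * m powr (1 - t))"
      using ab m by (simp add: epowr_ennreal_pos ennreal_mult)
    finally have 1: "avg Q (\<lambda>x. ennreal (?V x)) \<le> ennreal (a powr t * m powr (1 - t))" .
    define e where "e = - (1 - t) / (r0 - 1)"
    have e: "e \<le> 0" using t r by (simp add: e_def divide_nonpos_pos)
    have dual: "dual_weight r0 ?V x = u x powr e * dual_weight r W x" for x
    proof -
      have "dual_weight r0 ?V x = W x powr (t * (- 1 / (r0 - 1))) * u x powr ((1 - t) * (- 1 / (r0 - 1)))"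
        using Wp[of x] up[of x] by (simp add: dual_weight_def powr_mult powr_powr)
      also have "t * (- 1 / (r0 - 1)) = - 1 / (r - 1)" using r by (simp add: t_def)
      also have "(1 - t) * (- 1 / (r0 - 1)) = e" using r by (simp add: e_def field_simps)
      finally show ?thesis by (simp only: dual_weight_def mult.commute)
    qed
    have "avg Q (\<lambda>x. ennreal (dual_weight r0 ?V x))
        \<le> avg Q (\<lambda>x. ennreal ((m / L) powr e) * ennreal (dual_weight r W x))"
    proof (rule avg_mono_AE, use m(3) in eventually_elim, intro impI)
      fix x assume "x \<in> Q \<longrightarrow> m / L \<le> u x" "x \<in> Q"
      then have "u x powr e \<le> (m / L) powr e"
        using m L e by (intro powr_mono2') auto
      then show "ennreal (dual_weight r0 ?V x) \<le> ennreal ((m / L) powr e) * ennreal (dual_weight r W x)"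
        unfolding dual using pos_weightD(1)[OF pos_weight_dual[OF W], of r x]
        by (subst ennreal_mult[symmetric]) (auto intro!: ennreal_leI mult_right_mono)
    qed
    also have "\<dots> = ennreal ((m / L) powr e * b)"
      using ab by (subst avg_cmult[OF Q]) (auto simp: ennreal_mult)
    finally have "epowr (avg Q (\<lambda>x. ennreal (dual_weight r0 ?V x))) (r0 - 1)
        \<le> epowr (ennreal ((m / L) powr e * b)) (r0 - 1)"
      using r by (intro epowr_mono) auto
    also have "\<dots> = ennreal ((m / L) powr (- (1 - t)) * b powr (r0 - 1))"
    proof -
      have "e * (r0 - 1) = - (1 - t)" using r by (simp add: e_def)
      then show ?thesis using ab m L by (simp add: epowr_ennreal_pos powr_mult powr_powr)
    qed
    finally have 2: "epowr (avg Q (\<lambda>x. ennreal (dual_weight r0 ?V x))) (r0 - 1)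
        \<le> ennreal ((m / L) powr (- (1 - t)) * b powr (r0 - 1))" .
    have "avg Q (\<lambda>x. ennreal (?V x)) * epowr (avg Q (\<lambda>x. ennreal (dual_weight r0 ?V x))) (r0 - 1)
        \<le> ennreal (a powr t * m powr (1 - t)) * ennreal ((m / L) powr (- (1 - t)) * b powr (r0 - 1))"
      by (intro mult_mono 1 2) auto
    also have "\<dots> = ennreal ((a * b powr (r - 1)) powr t * L powr (1 - t))"
    proof -
      have "(m / L) powr (- (1 - t)) * m powr (1 - t) = L powr (1 - t)"
        unfolding powr_minus_divide using m L by (simp add: powr_divide)
      moreover have "(r - 1) * t = r0 - 1" using r by (simp add: t_def)
      then have "(a * b powr (r - 1)) powr t = a powr t * b powr (r0 - 1)"
        using ab by (simp add: powr_mult powr_powr)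
      ultimately show ?thesis by (simp flip: ennreal_mult) (metis mult.assoc mult.commute)
    qed
    also have "\<dots> \<le> ennreal (K powr t * L powr (1 - t))"
      using ab t by (intro ennreal_leI mult_right_mono powr_mono2) auto
    finally show "avg Q (\<lambda>x. ennreal (?V x)) * epowr (avg Q (\<lambda>x. ennreal (dual_weight r0 ?V x))) (r0 - 1)
      \<le> ennreal (K powr t * L powr (1 - t))" .
  qed
  then show ?thesis using False by (simp add: Ap_bound_def)
qed

section \<open>Extrapolation for powers of the weight\<close>

text \<open>The norm of \<open>w F\<close> in \<open>L\<^sup>p\<close>, for \<open>w = W\<^bsup>1/q\<^esup>\<close> and \<open>F \<ge> 0\<close>.\<close>

definition wnorm :: "real \<Rightarrow> real \<Rightarrow> (real ^ 'n \<Rightarrow> real) \<Rightarrow> (real ^ 'n \<Rightarrow> real) \<Rightarrow> ennreal" where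
  "wnorm p q W F = epowr (\<integral>\<^sup>+x. ennreal (F x powr p * W x powr (p / q)) \<partial>lebesgue) (1 / p)"

lemma epowr_wnorm: "0 < p \<Longrightarrow>
  epowr (wnorm p q W F) p = (\<integral>\<^sup>+x. ennreal (F x powr p * W x powr (p / q)) \<partial>lebesgue)"
  by (simp add: wnorm_def epowr_epowr)

text \<open>The function \<open>h\<close> is determined by \<open>h\<^sup>r W = F\<^sup>p W\<^bsup>p/q\<^esup>\<close>, so that \<open>h\<close> has finite norm in \<open>L\<^sup>r(W)\<close>
  exactly when the right side is finite.  Write \<open>G\<^sup>q W = (G\<^bsup>q0\<^esup> V)\<^bsup>q/q0\<^esup> (u\<^sup>r W)\<^bsup>1-q/q0\<^esup>\<close> and use Hoelder's
  inequality; the first factor is controlled by the hypothesis, the second by the norm of \<open>h\<close>.\<close>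

lemma extrapolation_down:
  fixes W F G :: "real ^ 'n \<Rightarrow> real"
  assumes exps: "1 < p" "p < p0" "0 < q" "q < q0" "1 < r" "r < r0"
    and rel: "r0 = r * q0 / q" "1 / p - 1 / q = 1 / p0 - 1 / q0" "1 / q - 1 / q0 = (r0 - r) / (q0 * r)"
    and W: "pos_weight W" and K: "Ap_char r W \<le> ennreal K" "0 < K"
    and F [measurable]: "F \<in> borel_measurable lebesgue" "\<And>x. 0 \<le> F x"
    and G [measurable]: "G \<in> borel_measurable lebesgue" "\<And>x. 0 \<le> G x"
    and Fne: "\<not> (AE x in lebesgue. F x = 0)" and Ffin: "wnorm p q W F < \<infinity>"
    and hyp: "\<And>V L. pos_weight V \<Longrightarrow> 0 < L \<Longrightarrow> Ap_char r0 V \<le> ennreal L \<Longrightarrow>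
      wnorm q0 q0 V G \<le> ennreal (c * L powr \<gamma>) * wnorm p0 q0 V F"
    and c: "0 < c"
  shows "wnorm q q W G \<le> ennreal (c * rdf_const CARD('n) r powr ((r0 - r) * \<gamma>) * 2 powr (r * (1 / q - 1 / q0))
      * K powr (\<gamma> * ((r0 - 1) / (r - 1)))) * wnorm p q W F"
proof -
  have Wp: "0 < W x" for x using W pos_weightD by auto
  have Wm [measurable]: "W \<in> borel_measurable lebesgue" using pos_weightD(2) W by auto
  define Y where "Y = (\<integral>\<^sup>+x. ennreal (F x powr p * W x powr (p / q)) \<partial>lebesgue)"
  define h where "h x = F x powr (p / r) * W x powr ((p / q - 1) / r)" for x
  have hr: "h x powr r * W x = F x powr p * W x powr (p / q)" for x
  proof -
    have "h x powr r * W x = F x powr p * (W x powr (p / q - 1) * W x powr 1)"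
      using exps Wp[of x] by (simp add: h_def powr_mult powr_powr)
    then show ?thesis by (simp only: powr_add[symmetric]) simp
  qed
  have hY: "(\<integral>\<^sup>+x. epowr (ennreal (h x)) r * ennreal (W x) \<partial>lebesgue) = Y"
    unfolding Y_def
  proof (rule nn_integral_cong)
    fix x
    have "0 \<le> h x" using Wp[of x] by (simp add: h_def)
    then show "epowr (ennreal (h x)) r * ennreal (W x) = ennreal (F x powr p * W x powr (p / q))"
      using exps Wp[of x] by (simp add: epowr_ennreal less_imp_le flip: hr ennreal_mult)
  qed
  have Yfin: "Y < \<infinity>" using Ffin exps by (simp add: wnorm_def Y_def)
  have hne: "\<not> (AE x in lebesgue. ennreal (h x) = 0)"
  proof
    assume "AE x in lebesgue. ennreal (h x) = 0"
    then have "AE x in lebesgue. F x = 0"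
    proof eventually_elim
      case (elim x)
      then have "h x = 0" using Wp[of x] by (simp add: h_def)
      then show ?case using Wp[of x] by (simp add: h_def)
    qed
    then show False using Fne by simp
  qed
  have [measurable]: "h \<in> borel_measurable lebesgue" unfolding h_def[abs_def] by measurable
  obtain u where u: "pos_weight u" and hu: "AE x in lebesgue. ennreal (h x) \<le> ennreal (u x)"
    and uint: "(\<integral>\<^sup>+x. ennreal (u x powr r * W x) \<partial>lebesgue)
      \<le> ennreal (2 powr r) * (\<integral>\<^sup>+x. epowr (ennreal (h x)) r * ennreal (W x) \<partial>lebesgue)"
    and uA1: "\<And>Q. Q \<in> cubes \<Longrightarrow> AE x in lebesgue. x \<in> Q \<longrightarrow>
      avg Q (\<lambda>x. ennreal (u x)) \<le> ennreal (rdf_const CARD('n) r * K powr (1 / (r - 1))) * ennreal (u x)"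
    by (rule rubio_de_francia[OF W exps(5) K, of "\<lambda>x. ennreal (h x)"]) (use hY Yfin hne in auto)
  have up: "0 < u x" for x using u pos_weightD by auto
  have [measurable]: "u \<in> borel_measurable lebesgue" using u pos_weightD by auto
  define L where "L = rdf_const CARD('n) r * K powr (1 / (r - 1))"
  have L: "0 < L" "A1_bound u L"
    using uA1 rdf_const_pos[OF exps(5)] K by (auto simp: L_def A1_bound_def)
  define V where "V x = W x * u x powr (r - r0)" for x
  have Vp: "0 < V x" for x using Wp[of x] up[of x] by (simp add: V_def)
  have V: "pos_weight V" unfolding pos_weight_def using Vp by (auto simp: V_def[abs_def])
  have [measurable]: "V \<in> borel_measurable lebesgue" using V pos_weightD by auto
  define K0 where "K0 = K * L powr (r0 - r)"
  have K0: "0 < K0" "Ap_char r0 V \<le> ennreal K0"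
    using Ap_char_times_A1[OF W exps(5,6) K u L(2,1)] K L by (auto simp: K0_def V_def[abs_def])
  have H: "wnorm q0 q0 V G \<le> ennreal (c * K0 powr \<gamma>) * wnorm p0 q0 V F"
    by (rule hyp[OF V K0])
  \<comment> \<open>The weight \<open>V\<close> is chosen so that \<open>u \<ge> h\<close> turns the norm of \<open>F\<close> into the original one.\<close>
  have FV: "wnorm p0 q0 V F \<le> epowr Y (1 / p0)"
    unfolding wnorm_def Y_def
  proof (intro epowr_mono nn_integral_mono_AE)
    show "AE x in lebesgue. ennreal (F x powr p0 * V x powr (p0 / q0)) \<le> ennreal (F x powr p * W x powr (p / q))"
      using hu
    proof eventually_elim
      case (elim x)
      show ?case
      proof (cases "F x = 0")
        case False
        then have Fp: "0 < F x" using F(2)[of x] by simp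
        have hp: "0 < h x" using Fp Wp[of x] by (simp add: h_def)
        have hux: "h x \<le> u x" using elim up[of x] by (subst (asm) ennreal_le_iff) auto
        define e where "e = (r - r0) * (p0 / q0)"
        have e: "e \<le> 0" unfolding e_def using exps by (intro mult_nonpos_nonneg) auto
        have er: "e / r = - p0 * (1 / q - 1 / q0)"
          unfolding rel(3) using exps by (simp add: e_def field_simps)
        have pq: "1 / q - 1 / q0 = 1 / p - 1 / p0" using rel(2) by simp
        have e1: "p0 + p / r * e = p"
        proof -
          have "p / r * e = p * (e / r)" by simp
          also have "\<dots> = - p0 * p * (1 / p - 1 / p0)" unfolding er pq by simp
          also have "\<dots> = - p0 + p" using exps by (simp add: field_simps)
          finally show ?thesis by simp
        qed
        have e2: "p0 / q0 + (p / q - 1) / r * e = p / q"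
        proof -
          have "(p / q - 1) / r * e = (p / q) * (e / r) - e / r" using exps by (simp add: field_simps)
          also have "p / q * (e / r) = (p - p0) / q"
          proof -
            have "p * (e / r) = p - p0" using e1 by simp
            then show ?thesis by (metis times_divide_eq_left)
          qed
          also have "(p - p0) / q - e / r = (p - p0) / q + p0 * (1 / q - 1 / q0)" unfolding er by simp
          finally show ?thesis by (simp add: diff_divide_distrib algebra_simps)
        qed
        have "F x powr p0 * V x powr (p0 / q0) = F x powr p0 * (W x powr (p0 / q0) * u x powr e)"
          using Wp[of x] up[of x] by (simp add: V_def powr_mult powr_powr e_def)
        also have "\<dots> \<le> F x powr p0 * (W x powr (p0 / q0) * h x powr e)"
          using hp hux e by (intro mult_left_mono powr_mono2') auto
        also have "\<dots> = F x powr (p0 + p / r * e) * W x powr (p0 / q0 + (p / q - 1) / r * e)"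
          using Fp Wp[of x] by (simp add: h_def powr_mult powr_powr powr_add)
        also have "\<dots> = F x powr p * W x powr (p / q)" by (simp only: e1 e2)
        finally show ?thesis by (rule ennreal_leI)
      qed (use exps in simp)
    qed
  qed (use exps in simp)
  have GW: "wnorm q q W G \<le> wnorm q0 q0 V G * epowr (ennreal (2 powr r) * Y) (1 / q - 1 / q0)"
  proof -
    define t where "t = q / q0"
    have t: "0 < t" "t < 1" using exps by (auto simp: t_def)
    have "(\<integral>\<^sup>+x. ennreal (G x powr q * W x powr (q / q)) \<partial>lebesgue)
        = (\<integral>\<^sup>+x. epowr (ennreal (G x powr q0 * V x powr (q0 / q0))) t
            * epowr (ennreal (u x powr r * W x)) (1 - t) \<partial>lebesgue)"
    proof (rule nn_integral_cong)
      fix x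
      \<comment> \<open>The powers of \<open>u\<close> cancel since \<open>r/q = r0/q0\<close>.\<close>
      have e: "(r - r0) * t + r * (1 - t) = 0" unfolding t_def rel(1) using exps by (simp add: field_simps)
      have "(G x powr q0 * V x powr (q0 / q0)) powr t * (u x powr r * W x) powr (1 - t)
        = G x powr (q0 * t) * ((W x powr t * W x powr (1 - t)) * (u x powr ((r - r0) * t) * u x powr (r * (1 - t))))"
        using exps Wp[of x] up[of x] by (simp add: V_def powr_mult powr_powr)
      also have "\<dots> = G x powr q * W x"
        unfolding powr_add[symmetric] e using exps Wp[of x] up[of x] by (simp add: t_def)
      finally show "ennreal (G x powr q * W x powr (q / q)) = epowr (ennreal (G x powr q0 * V x powr (q0 / q0))) t
            * epowr (ennreal (u x powr r * W x)) (1 - t)"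
        using exps t Wp[of x] up[of x] Vp[of x]
        by (simp add: epowr_ennreal less_imp_le flip: ennreal_mult)
    qed
    also have "\<dots> \<le> epowr (\<integral>\<^sup>+x. ennreal (G x powr q0 * V x powr (q0 / q0)) \<partial>lebesgue) t
        * epowr (\<integral>\<^sup>+x. ennreal (u x powr r * W x) \<partial>lebesgue) (1 - t)"
      by (intro nn_integral_Hoelder t) auto
    also have "\<dots> \<le> epowr (epowr (wnorm q0 q0 V G) q0) t * epowr (ennreal (2 powr r) * Y) (1 - t)"
      using uint t exps by (subst epowr_wnorm) (auto intro!: mult_left_mono epowr_mono simp: hY)
    finally have "wnorm q q W G \<le> epowr (epowr (epowr (wnorm q0 q0 V G) q0) t * epowr (ennreal (2 powr r) * Y) (1 - t)) (1 / q)"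
      unfolding wnorm_def[of q q] using exps by (intro epowr_mono) auto
    moreover have "(1 - t) * (1 / q) = 1 / q - 1 / q0" "q0 * t * (1 / q) = 1"
      using exps by (auto simp: t_def field_simps)
    moreover have "epowr (epowr (epowr N q0) t * epowr B (1 - t)) (1 / q)
        = epowr N (q0 * t * (1 / q)) * epowr B ((1 - t) * (1 / q))" for N B
      using exps t by (simp add: epowr_mult epowr_epowr)
    ultimately show ?thesis by (simp only: epowr_one)
  qed
  have d: "0 \<le> 1 / q - 1 / q0" using exps by (simp add: field_simps)
  have "wnorm q q W G \<le> ennreal (c * K0 powr \<gamma>) * epowr Y (1 / p0) * epowr (ennreal (2 powr r) * Y) (1 / q - 1 / q0)"
    by (intro order_trans[OF GW] mult_right_mono order_trans[OF H] mult_left_mono FV) auto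
  also have "\<dots> = ennreal (c * K0 powr \<gamma>) * ennreal (2 powr (r * (1 / q - 1 / q0))) * (epowr Y (1 / p0) * epowr Y (1 / q - 1 / q0))"
    using d by (simp add: epowr_mult epowr_ennreal_pos powr_powr ac_simps)
  also have "epowr Y (1 / p0) * epowr Y (1 / q - 1 / q0) = wnorm p q W F"
  proof -
    have "1 / p0 + (1 / q - 1 / q0) = 1 / p" using rel(2) by simp
    then show ?thesis using epowr_add[of "1 / p0" "1 / q - 1 / q0" Y] d exps by (simp add: wnorm_def Y_def)
  qed
  also have "ennreal (c * K0 powr \<gamma>) * ennreal (2 powr (r * (1 / q - 1 / q0)))
      = ennreal (c * K0 powr \<gamma> * 2 powr (r * (1 / q - 1 / q0)))"
    using c by (subst ennreal_mult) auto
  also have "K0 powr \<gamma> = rdf_const CARD('n) r powr ((r0 - r) * \<gamma>) * K powr (\<gamma> * ((r0 - 1) / (r - 1)))"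
  proof -
    have e: "\<gamma> + 1 / (r - 1) * (r0 - r) * \<gamma> = \<gamma> * ((r0 - 1) / (r - 1))"
      using exps by (simp add: field_simps)
    have "K0 powr \<gamma> = rdf_const CARD('n) r powr ((r0 - r) * \<gamma>) * (K powr \<gamma> * K powr (1 / (r - 1) * (r0 - r) * \<gamma>))"
      using K rdf_const_pos[OF exps(5), of "CARD('n)"] by (simp add: K0_def L_def powr_mult powr_powr)
    then show ?thesis by (simp only: powr_add[symmetric] e)
  qed
  finally show ?thesis by (simp add: ac_simps)
qed

text \<open>Here duality is made explicit.  The algorithm runs on \<open>h = g\<^bsup>q/r'\<^esup> W\<close> in \<open>L\<^bsup>r'\<^esup>(\<sigma>)\<close>, where \<open>\<sigma>\<close> is the
  dual weight; then \<open>h\<^bsup>r'\<^esup> \<sigma> = g\<^sup>q W\<close>, and \<open>u \<ge> h\<close> gives \<open>g\<^sup>q W \<le> g\<^bsup>q0\<^esup> V\<close>.  On the side of \<open>F\<close>, Hoelder's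
  inequality splits \<open>F\<^bsup>p0\<^esup> V\<^bsup>p0/q0\<^esup>\<close> into powers of \<open>F\<^sup>p W\<^bsup>p/q\<^esup>\<close> and \<open>u\<^bsup>r'\<^esup> \<sigma>\<close>.  The resulting power of the
  norm of \<open>g\<close> is divided out, which needs that norm to be finite; hence \<open>g\<close> is only a minorant
  of \<open>G\<close>.\<close>

lemma extrapolation_up_aux:
  fixes W F G g :: "real ^ 'n \<Rightarrow> real"
  assumes exps: "1 \<le> p0" "p0 < p" "0 < q0" "q0 < q" "1 \<le> r0" "r0 < r"
    and rel: "r0 = r * q0 / q" "1 / p - 1 / q = 1 / p0 - 1 / q0"
    and W: "pos_weight W" and K: "Ap_char r W \<le> ennreal K" "0 < K"
    and F [measurable]: "F \<in> borel_measurable lebesgue" "\<And>x. 0 \<le> F x"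
    and g [measurable]: "g \<in> borel_measurable lebesgue" "\<And>x. 0 \<le> g x" "\<And>x. g x \<le> G x"
    and gfin: "wnorm q q W g < \<infinity>"
    and hyp: "\<And>V L. pos_weight V \<Longrightarrow> 0 < L \<Longrightarrow> Ap_bound r0 V L \<Longrightarrow>
      wnorm q0 q0 V G \<le> ennreal (c * L powr \<gamma>) * wnorm p0 q0 V F"
    and c: "0 < c"
  shows "wnorm q q W g \<le> ennreal (c * rdf_const CARD('n) (r / (r - 1)) powr ((r - r0) / (r - 1) * \<gamma>)
      * 2 powr (r / (r - 1) * (1 / q0 - 1 / q)) * K powr \<gamma>) * wnorm p q W F"
proof (cases "wnorm q q W g = 0")
  case False
  have r: "1 < r" using exps by simp
  define r' where "r' = r / (r - 1)"
  have r': "1 < r'" "1 / (r' - 1) = r - 1" using r by (auto simp: r'_def field_simps)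
  define s where "s = dual_weight r W"
  have Wp: "0 < W x" for x using W pos_weightD by auto
  have s: "pos_weight s" unfolding s_def by (rule pos_weight_dual[OF W])
  have sp: "0 < s x" for x using s pos_weightD by auto
  have Wm [measurable]: "W \<in> borel_measurable lebesgue" "s \<in> borel_measurable lebesgue"
    using pos_weightD(2) W s by auto
  define X where "X = (\<integral>\<^sup>+x. ennreal (g x powr q * W x) \<partial>lebesgue)"
  have Xq: "wnorm q q W g = epowr X (1 / q)"
    using exps Wp by (simp add: wnorm_def X_def less_imp_le)
  have Xfin: "X < \<infinity>" "X \<noteq> 0"
    using gfin False exps unfolding Xq by (auto simp: epowr_eq_0_iff)
  define h where "h x = g x powr (q / r') * W x" for x
  have hr: "h x powr r' * s x = g x powr q * W x" for x
  proof -
    have e: "r' + - 1 / (r - 1) = 1" using r by (simp add: r'_def diff_divide_distrib[symmetric])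
    have "h x powr r' * s x = g x powr q * (W x powr r' * W x powr (- 1 / (r - 1)))"
      using r' Wp[of x] by (simp add: h_def s_def dual_weight_def powr_mult powr_powr)
    then show ?thesis unfolding powr_add[symmetric] e using Wp[of x] by simp
  qed
  have h0: "0 \<le> h x" for x using Wp[of x] by (simp add: h_def)
  have hX: "(\<integral>\<^sup>+x. epowr (ennreal (h x)) r' * ennreal (s x) \<partial>lebesgue) = X"
    unfolding X_def
    using r' h0 sp by (intro nn_integral_cong) (simp add: epowr_ennreal less_imp_le flip: hr ennreal_mult)
  have [measurable]: "h \<in> borel_measurable lebesgue" unfolding h_def[abs_def] by measurable
  have hne: "\<not> (AE x in lebesgue. ennreal (h x) = 0)"
  proof
    assume "AE x in lebesgue. ennreal (h x) = 0"
    then have "AE x in lebesgue. epowr (ennreal (h x)) r' * ennreal (s x) = 0"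
      by eventually_elim (use r' in simp)
    then have "X = 0" unfolding hX[symmetric] by (subst nn_integral_0_iff_AE) auto
    then show False using Xfin by simp
  qed
  have K': "Ap_char r' s \<le> ennreal (K powr (1 / (r - 1)))" "0 < K powr (1 / (r - 1))"
    using Ap_char_dual[OF W r K] K by (auto simp: r'_def s_def)
  obtain u where u: "pos_weight u" and hu: "AE x in lebesgue. ennreal (h x) \<le> ennreal (u x)"
    and uint: "(\<integral>\<^sup>+x. ennreal (u x powr r' * s x) \<partial>lebesgue)
      \<le> ennreal (2 powr r') * (\<integral>\<^sup>+x. epowr (ennreal (h x)) r' * ennreal (s x) \<partial>lebesgue)"
    and uA1: "\<And>Q. Q \<in> cubes \<Longrightarrow> AE x in lebesgue. x \<in> Q \<longrightarrow>
      avg Q (\<lambda>x. ennreal (u x)) \<le> ennreal (rdf_const CARD('n) r' * (K powr (1 / (r - 1))) powr (1 / (r' - 1))) * ennreal (u x)"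
    by (rule rubio_de_francia[OF s r'(1) K', of "\<lambda>x. ennreal (h x)"]) (use hX Xfin hne in auto)
  have up: "0 < u x" for x using u pos_weightD by auto
  have [measurable]: "u \<in> borel_measurable lebesgue" using u pos_weightD by auto
  define L where "L = rdf_const CARD('n) r' * K"
  have "(K powr (1 / (r - 1))) powr (1 / (r' - 1)) = K"
    using K r by (simp add: r' powr_powr)
  then have L: "0 < L" "A1_bound u L"
    using uA1 rdf_const_pos[OF r'(1)] K by (auto simp: L_def A1_bound_def)
  define t where "t = (r0 - 1) / (r - 1)"
  have t: "0 \<le> t" "t < 1" using exps by (auto simp: t_def)
  define V where "V x = W x powr t * u x powr (1 - t)" for x
  have Vp: "0 < V x" for x using Wp[of x] up[of x] by (simp add: V_def)
  have V: "pos_weight V" unfolding pos_weight_def using Vp by (auto simp: V_def[abs_def])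
  have [measurable]: "V \<in> borel_measurable lebesgue" using V pos_weightD by auto
  define K0 where "K0 = K powr t * L powr (1 - t)"
  have K0: "0 < K0" "Ap_bound r0 V K0"
    using Ap_bound_mean_A1[OF W exps(5,6) K u L(2,1)] K L by (auto simp: K0_def V_def[abs_def] t_def)
  have H: "wnorm q0 q0 V G \<le> ennreal (c * K0 powr \<gamma>) * wnorm p0 q0 V F"
    by (rule hyp[OF V K0])
  have t1: "1 - t = (r - r0) / (r - 1)" using r by (simp add: t_def field_simps)
  have qr: "q / r' * (1 - t) = q - q0"
  proof -
    have "q / r' * (1 - t) = q * (r - r0) / r" unfolding t1 r'_def using r by simp
    also have "\<dots> = q - q0" unfolding rel(1) using exps r by (simp add: field_simps)
    finally show ?thesis .
  qed
  have GV: "epowr X (1 / q0) \<le> wnorm q0 q0 V G"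
    unfolding X_def wnorm_def
  proof (intro epowr_mono nn_integral_mono_AE)
    show "AE x in lebesgue. ennreal (g x powr q * W x) \<le> ennreal (G x powr q0 * V x powr (q0 / q0))"
      using hu
    proof eventually_elim
      case (elim x)
      have "h x \<le> u x" using elim up[of x] by (subst (asm) ennreal_le_iff) auto
      have "g x powr q * W x = g x powr (q0 + (q - q0)) * (W x powr (t + (1 - t)))"
        using Wp[of x] by simp
      also have "\<dots> = g x powr q0 * (W x powr t * h x powr (1 - t))"
        unfolding h_def qr[symmetric] using Wp[of x] r' exps by (simp only: powr_add powr_mult powr_powr) (simp add: powr_mult powr_powr)
      also have "\<dots> \<le> G x powr q0 * (W x powr t * u x powr (1 - t))"
        using g(2,3)[of x] \<open>h x \<le> u x\<close> h0[of x] t exps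
        by (intro mult_mono mult_left_mono powr_mono2) auto
      finally show ?case using exps Vp[of x] by (intro ennreal_leI) (simp add: V_def)
    qed
  qed (use exps in simp)
  define Y where "Y = (\<integral>\<^sup>+x. ennreal (F x powr p * W x powr (p / q)) \<partial>lebesgue)"
  define d where "d = 1 / q0 - 1 / q"
  have d: "0 < d" using exps by (simp add: d_def field_simps)
  have FV: "wnorm p0 q0 V F \<le> wnorm p q W F * epowr (ennreal (2 powr r') * X) d"
  proof -
    define b where "b = p0 / p"
    have b: "0 < b" "b < 1" using exps by (auto simp: b_def)
    have pd: "1 - b = p0 * d"
    proof -
      have "1 - b = p0 * (1 / p0 - 1 / p)" using exps by (simp add: b_def field_simps)
      also have "1 / p0 - 1 / p = d" using rel(2) by (simp add: d_def)
      finally show ?thesis .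
    qed
    have rd: "r' * d = (1 - t) / q0"
    proof -
      have "d = (q - q0) / (q * q0)" using exps by (simp add: d_def field_simps)
      also have "q - q0 = q / r' * (1 - t)" by (rule qr[symmetric])
      finally have "r' * d = r' * (q / r' * (1 - t) / (q * q0))" by (simp only:)
      then show ?thesis using r' exps by simp
    qed
    have e1: "r' * (1 - b) = (1 - t) * (p0 / q0)"
      unfolding pd using rd by (metis mult.commute mult.left_commute times_divide_eq_right times_divide_eq_left)
    have e2: "p / q * b + - 1 / (r - 1) * (1 - b) = t * (p0 / q0)"
    proof -
      have i: "- 1 / (r - 1) = 1 - r'" using r by (simp add: r'_def field_simps)
      have "p / q * b + - 1 / (r - 1) * (1 - b) = p0 / q + (1 - b) - r' * (1 - b)"
      proof -
        have "p / q * b = p0 / q" using exps by (simp add: b_def)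
        then show ?thesis unfolding i by (simp add: algebra_simps)
      qed
      also have "\<dots> = p0 / q + p0 * d - (1 - t) * (p0 / q0)" by (simp only: e1) (simp only: pd)
      also have "\<dots> = t * (p0 / q0)" unfolding d_def using exps by (simp add: field_simps)
      finally show ?thesis .
    qed
    have "(\<integral>\<^sup>+x. ennreal (F x powr p0 * V x powr (p0 / q0)) \<partial>lebesgue)
        = (\<integral>\<^sup>+x. epowr (ennreal (F x powr p * W x powr (p / q))) b
            * epowr (ennreal (u x powr r' * s x)) (1 - b) \<partial>lebesgue)"
    proof (rule nn_integral_cong)
      fix x
      have "(F x powr p * W x powr (p / q)) powr b * (u x powr r' * s x) powr (1 - b)
        = F x powr (p * b) * ((W x powr (p / q * b) * W x powr (- 1 / (r - 1) * (1 - b))) * u x powr (r' * (1 - b)))"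
        using Wp[of x] up[of x] by (simp add: s_def dual_weight_def powr_mult powr_powr)
      also have "\<dots> = F x powr p0 * (W x powr (t * (p0 / q0)) * u x powr ((1 - t) * (p0 / q0)))"
        unfolding powr_add[symmetric] e1 e2 using exps by (simp add: b_def)
      also have "\<dots> = F x powr p0 * V x powr (p0 / q0)"
        using Wp[of x] up[of x] by (simp add: V_def powr_mult powr_powr)
      finally show "ennreal (F x powr p0 * V x powr (p0 / q0)) = epowr (ennreal (F x powr p * W x powr (p / q))) b
            * epowr (ennreal (u x powr r' * s x)) (1 - b)"
        using b Wp[of x] up[of x] sp[of x]
        by (simp add: epowr_ennreal less_imp_le flip: ennreal_mult)
    qed
    also have "\<dots> \<le> epowr Y b * epowr (\<integral>\<^sup>+x. ennreal (u x powr r' * s x) \<partial>lebesgue) (1 - b)"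
      unfolding Y_def by (intro nn_integral_Hoelder b) auto
    also have "\<dots> \<le> epowr Y b * epowr (ennreal (2 powr r') * X) (1 - b)"
      using uint b by (auto intro!: mult_left_mono epowr_mono simp: hX)
    finally have "wnorm p0 q0 V F \<le> epowr (epowr Y b * epowr (ennreal (2 powr r') * X) (1 - b)) (1 / p0)"
      unfolding wnorm_def[of p0] using exps by (intro epowr_mono) auto
    moreover have "(1 - b) * (1 / p0) = d" "b * (1 / p0) = 1 / p"
      unfolding pd using exps by (auto simp: b_def)
    moreover have "epowr (epowr Y b * epowr B (1 - b)) (1 / p0)
        = epowr Y (b * (1 / p0)) * epowr B ((1 - b) * (1 / p0))" for B
      using exps b by (simp add: epowr_mult epowr_epowr)
    ultimately show ?thesis by (simp only: wnorm_def[of p] Y_def[symmetric])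
  qed
  have "epowr X (1 / q0) \<le> ennreal (c * K0 powr \<gamma>) * (wnorm p q W F * epowr (ennreal (2 powr r') * X) d)"
    by (intro order_trans[OF GV] order_trans[OF H] mult_left_mono FV) auto
  also have "\<dots> = epowr X d * (ennreal (c * K0 powr \<gamma>) * ennreal (2 powr (r' * d)) * wnorm p q W F)"
    using d by (simp add: epowr_mult epowr_ennreal_pos powr_powr ac_simps)
  also have "epowr X (1 / q0) = epowr X d * epowr X (1 / q)"
    using epowr_add[of d "1 / q" X] d exps by (simp add: d_def)
  finally have "epowr X (1 / q) \<le> ennreal (c * K0 powr \<gamma>) * ennreal (2 powr (r' * d)) * wnorm p q W F"
    using Xfin d by (subst (asm) ennreal_mult_le_mult_iff) (auto simp: epowr_eq_0_iff epowr_eq_top_iff)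
  also have "ennreal (c * K0 powr \<gamma>) * ennreal (2 powr (r' * d)) = ennreal (c * K0 powr \<gamma> * 2 powr (r' * d))"
    using c by (subst ennreal_mult) auto
  also have "K0 powr \<gamma> = rdf_const CARD('n) r' powr ((1 - t) * \<gamma>) * K powr \<gamma>"
  proof -
    have "K0 powr \<gamma> = rdf_const CARD('n) r' powr ((1 - t) * \<gamma>) * (K powr (t * \<gamma>) * K powr ((1 - t) * \<gamma>))"
      using K rdf_const_pos[OF r'(1), of "CARD('n)"] by (simp add: K0_def L_def powr_mult powr_powr)
    also have "K powr (t * \<gamma>) * K powr ((1 - t) * \<gamma>) = K powr \<gamma>"
      unfolding powr_add[symmetric] by (simp add: algebra_simps)
    finally show ?thesis .
  qed
  finally show ?thesis unfolding Xq d_def t1 r'_def by (simp add: ac_simps)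
qed simp

text \<open>Truncating \<open>G\<close> in height and to a large cube makes its norm finite, since \<open>W\<close> is integrable over
  cubes; monotone convergence removes the truncation.\<close>

lemma extrapolation_up:
  fixes W F G :: "real ^ 'n \<Rightarrow> real"
  assumes exps: "1 \<le> p0" "p0 < p" "0 < q0" "q0 < q" "1 \<le> r0" "r0 < r"
    and rel: "r0 = r * q0 / q" "1 / p - 1 / q = 1 / p0 - 1 / q0"
    and W: "pos_weight W" and K: "Ap_char r W \<le> ennreal K" "0 < K"
    and F [measurable]: "F \<in> borel_measurable lebesgue" "\<And>x. 0 \<le> F x"
    and G [measurable]: "G \<in> borel_measurable lebesgue" "\<And>x. 0 \<le> G x"
    and hyp: "\<And>V L. pos_weight V \<Longrightarrow> 0 < L \<Longrightarrow> Ap_bound r0 V L \<Longrightarrow>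
      wnorm q0 q0 V G \<le> ennreal (c * L powr \<gamma>) * wnorm p0 q0 V F"
    and c: "0 < c"
  shows "wnorm q q W G \<le> ennreal (c * rdf_const CARD('n) (r / (r - 1)) powr ((r - r0) / (r - 1) * \<gamma>)
      * 2 powr (r / (r - 1) * (1 / q0 - 1 / q)) * K powr \<gamma>) * wnorm p q W F" (is "_ \<le> ?C")
proof -
  have r: "1 < r" using exps by simp
  have Wp: "0 < W x" for x using W pos_weightD by auto
  have [measurable]: "W \<in> borel_measurable lebesgue" using pos_weightD(2) W by auto
  note [measurable] = big_cube(2)
  define g where "g j x = min (G x) (real j) * indicator (big_cube j :: (real ^ 'n) set) x" for j x
  have g0: "0 \<le> g j x" "g j x \<le> G x" for j x using G(2)[of x] by (auto simp: g_def split: split_indicator)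
  have gm [measurable]: "g j \<in> borel_measurable lebesgue" for j unfolding g_def[abs_def] by measurable
  have gmono: "g i x \<le> g j x" if "i \<le> j" for i j x
  proof -
    have "x \<in> big_cube i \<Longrightarrow> x \<in> big_cube j" using big_cube_mono[OF that] by blast
    then show ?thesis using that G(2)[of x] by (auto simp: g_def split: split_indicator)
  qed
  have bnd: "wnorm q q W (g j) \<le> ?C" for j
  proof (rule extrapolation_up_aux[OF exps rel W K F gm g0 _ hyp c])
    obtain a b e where ab: "0 < a" "0 < b" "0 < e" "(\<integral>\<^sup>+x\<in>big_cube j. ennreal (W x) \<partial>lebesgue) = ennreal a"
      "(\<integral>\<^sup>+x\<in>big_cube j. ennreal (dual_weight r W x) \<partial>lebesgue) = ennreal b"
      "emeasure lebesgue (big_cube j :: (real ^ 'n) set) = ennreal e" "a / e * (b / e) powr (r - 1) \<le> K"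
      using Ap_char_cube[OF W r K big_cube(1)[of j]] .
    have "(\<integral>\<^sup>+x. ennreal (g j x powr q * W x powr (q / q)) \<partial>lebesgue)
      \<le> (\<integral>\<^sup>+x. ennreal (real j powr q) * (ennreal (W x) * indicator (big_cube j) x) \<partial>lebesgue)"
    proof (intro nn_integral_mono)
      fix x
      have "g j x powr q * W x \<le> real j powr q * W x"
        using g0[of j x] Wp[of x] exps by (intro mult_right_mono powr_mono2) (auto simp: g_def split: split_indicator)
      then show "ennreal (g j x powr q * W x powr (q / q)) \<le> ennreal (real j powr q) * (ennreal (W x) * indicator (big_cube j) x)"
        using exps Wp[of x] by (cases "x \<in> big_cube j") (auto simp: g_def ennreal_leI less_imp_le simp flip: ennreal_mult)
    qed
    also have "\<dots> = ennreal (real j powr q) * ennreal a" by (simp add: nn_integral_cmult ab)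
    also have "\<dots> < \<infinity>" by (simp add: ennreal_mult_less_top)
    finally show "wnorm q q W (g j) < \<infinity>" using exps by (simp add: wnorm_def)
  qed auto
  have SG: "(SUP j. ennreal (g j x powr q * W x powr (q / q))) = ennreal (G x powr q * W x powr (q / q))" for x
  proof (rule antisym)
    show "(SUP j. ennreal (g j x powr q * W x powr (q / q))) \<le> ennreal (G x powr q * W x powr (q / q))"
      using g0 exps by (intro SUP_least ennreal_leI mult_right_mono powr_mono2) auto
    obtain j where j: "max (G x) (norm x) \<le> real j" using real_arch_simple by blast
    then have "x \<in> big_cube j" by (intro norm_le_big_cube) simp
    then have "g j x = G x" using j by (simp add: g_def)
    then show "ennreal (G x powr q * W x powr (q / q)) \<le> (SUP j. ennreal (g j x powr q * W x powr (q / q)))"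
      by (intro SUP_upper2[of j]) auto
  qed
  have "wnorm q q W G = epowr (SUP j. \<integral>\<^sup>+x. ennreal (g j x powr q * W x powr (q / q)) \<partial>lebesgue) (1 / q)"
  proof -
    have "(\<integral>\<^sup>+x. (SUP j. ennreal (g j x powr q * W x powr (q / q))) \<partial>lebesgue)
        = (SUP j. \<integral>\<^sup>+x. ennreal (g j x powr q * W x powr (q / q)) \<partial>lebesgue)"
    proof (rule nn_integral_monotone_convergence_SUP)
      show "incseq (\<lambda>j x. ennreal (g j x powr q * W x powr (q / q)))"
        unfolding incseq_def le_fun_def using g0 gmono exps
        by (intro allI impI ennreal_leI mult_right_mono powr_mono2) auto
    qed measurable
    then show ?thesis by (simp only: wnorm_def SG)
  qed
  also have "\<dots> = (SUP j. wnorm q q W (g j))"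
    unfolding wnorm_def using exps by (intro epowr_SUP) auto
  also have "\<dots> \<le> ?C" by (intro SUP_least bnd)
  finally show ?thesis .
qed

lemma wnorm_zero_AE:
  fixes F :: "real ^ 'n \<Rightarrow> real"
  assumes "AE x in lebesgue. F x = 0" "0 < p"
  shows "wnorm p q W F = 0"
proof -
  have "(\<integral>\<^sup>+x. ennreal (F x powr p * W x powr (p / q)) \<partial>lebesgue) = (\<integral>\<^sup>+x. 0 \<partial>(lebesgue :: (real ^ 'n) measure))"
    using assms by (intro nn_integral_cong_AE) (auto elim!: eventually_mono)
  then show ?thesis using assms by (simp add: wnorm_def)
qed

lemma Ap_char_one: "Ap_char r (\<lambda>x :: real ^ 'n. 1) \<le> ennreal 1"
  unfolding Ap_char_def
proof (rule SUP_least)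
  fix Q :: "(real ^ 'n) set" assume "Q \<in> cubes"
  then obtain c where "0 < c" "emeasure lebesgue Q = ennreal c" "Q \<in> sets lebesgue"
    using cubes_measure by blast
  then have "avg Q (\<lambda>x. 1) = 1" by (simp add: avg_def)
  then show "avg Q (\<lambda>x. ennreal 1) * epowr (avg Q (\<lambda>x. ennreal (dual_weight r (\<lambda>x. 1) x))) (r - 1) \<le> ennreal 1"
    by (simp add: dual_weight_def)
qed

text \<open>If \<open>F\<close> vanishes almost everywhere there is no \<open>h\<close> to start from, but the hypothesis for the
  constant weight already forces \<open>G\<close> to vanish.\<close>

lemma extrapolation_down_total:
  fixes W F G :: "real ^ 'n \<Rightarrow> real"
  assumes exps: "1 < p" "p < p0" "0 < q" "q < q0" "1 < r" "r < r0"
    and rel: "r0 = r * q0 / q" "1 / p - 1 / q = 1 / p0 - 1 / q0" "1 / q - 1 / q0 = (r0 - r) / (q0 * r)"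
    and W: "pos_weight W" and K: "Ap_char r W \<le> ennreal K" "0 < K"
    and F [measurable]: "F \<in> borel_measurable lebesgue" "\<And>x. 0 \<le> F x"
    and G [measurable]: "G \<in> borel_measurable lebesgue" "\<And>x. 0 \<le> G x"
    and hyp: "\<And>V L. pos_weight V \<Longrightarrow> 0 < L \<Longrightarrow> Ap_char r0 V \<le> ennreal L \<Longrightarrow>
      wnorm q0 q0 V G \<le> ennreal (c * L powr \<gamma>) * wnorm p0 q0 V F"
    and c: "0 < c"
  shows "wnorm q q W G \<le> ennreal (c * rdf_const CARD('n) r powr ((r0 - r) * \<gamma>) * 2 powr (r * (1 / q - 1 / q0))
      * K powr (\<gamma> * ((r0 - 1) / (r - 1)))) * wnorm p q W F" (is "_ \<le> ennreal ?C * _")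
proof -
  consider "AE x in lebesgue. F x = 0" | "wnorm p q W F = \<infinity>"
    | "\<not> (AE x in lebesgue. F x = 0)" "wnorm p q W F < \<infinity>"
    by (metis infinity_ennreal_def top.not_eq_extremum)
  then show ?thesis
  proof cases
    case 1
    have "pos_weight (\<lambda>x :: real ^ 'n. 1)" by (simp add: pos_weight_def)
    from hyp[OF this _ Ap_char_one] have "wnorm q0 q0 (\<lambda>x. 1) G = 0"
      using wnorm_zero_AE[OF 1, of p0 q0 "\<lambda>x. 1"] exps by simp
    then have "(\<integral>\<^sup>+x. ennreal (G x powr q0) \<partial>lebesgue) = 0"
      using exps by (simp add: wnorm_def epowr_eq_0_iff)
    then have "AE x in lebesgue. G x = 0"
      by (subst (asm) nn_integral_0_iff_AE) (auto elim!: eventually_mono)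
    then show ?thesis using wnorm_zero_AE[of G q q W] exps by simp
  next
    case 2
    have "0 < ?C" using c K rdf_const_pos[OF exps(5), of "CARD('n)"] by simp
    moreover have "X \<le> ennreal C * \<infinity>" if "0 < C" for X C using that by (simp add: ennreal_mult_top)
    ultimately show ?thesis unfolding 2 by blast
  next
    case 3
    show ?thesis by (rule extrapolation_down[OF exps rel W K F G 3 hyp c])
  qed
qed

section \<open>From powers of weights to weights\<close>

lemma div_conj_exp: "q / conj_exp p = q * (1 - 1 / p)"
  by (simp add: conj_exp_def)

text \<open>With \<open>r = 1 + q/p'\<close>, the weight \<open>w\<^bsup>-p'\<^esup>\<close> is the dual weight of \<open>W = w\<^sup>q\<close>, because
  \<open>p'/q = 1/(r - 1)\<close>.\<close>

lemma Apq_const_root: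
  fixes W :: "real ^ 'n \<Rightarrow> real"
  assumes W: "\<And>x. 0 < W x" and pq: "1 < p" "0 < q"
  shows "Apq_const p q (\<lambda>x. W x powr (1 / q)) = Ap_char (1 + q / conj_exp p) W"
proof -
  have "epowr (ennreal (W x powr (1 / q))) q = ennreal (W x)" for x
    using W[of x] pq by (simp add: epowr_ennreal_pos powr_powr)
  moreover have "epowr (ennreal (W x powr (1 / q))) (- conj_exp p)
      = ennreal (dual_weight (1 + q / conj_exp p) W x)" for x
  proof -
    have "1 / q * (- conj_exp p) = - 1 / (1 + q / conj_exp p - 1)"
      using pq by simp
    then show ?thesis using W[of x] by (simp only: dual_weight_def) (simp add: epowr_ennreal_pos powr_powr)
  qed
  ultimately show ?thesis using pq by (simp add: Apq_const_def Ap_char_def)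
qed

lemma weight_measurable:
  fixes w :: "real ^ 'n \<Rightarrow> real"
  assumes "weight w"
  shows "w \<in> borel_measurable lebesgue"
proof (rule borel_measurable_LIMSEQ_real)
  fix x :: "real ^ 'n"
  obtain j where j: "norm x \<le> real j" using real_arch_simple by blast
  have "\<forall>\<^sub>F i in sequentially. indicator (big_cube i) x *\<^sub>R w x = w x"
    using eventually_ge_at_top[of j]
  proof eventually_elim
    case (elim i)
    then have "x \<in> big_cube i" using norm_le_big_cube[OF j] big_cube_mono by blast
    then show ?case by simp
  qed
  then show "(\<lambda>i. indicator (big_cube i) x *\<^sub>R w x) \<longlonglongrightarrow> w x"
    by (rule tendsto_eventually)
next
  fix i
  have "set_integrable lebesgue (big_cube i) w"
    using assms by (auto simp: weight_def big_cube_def)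
  then show "(\<lambda>x. indicator (big_cube i) x *\<^sub>R w x) \<in> borel_measurable lebesgue"
    unfolding set_integrable_def by (rule borel_measurable_integrable)
qed

lemma Ap_bound_local_integral:
  assumes V: "pos_weight V" and L: "Ap_bound r V L" "0 < L" "1 \<le> r" and Q: "Q \<in> cubes"
  shows "(\<integral>\<^sup>+x\<in>Q. ennreal (V x) \<partial>lebesgue) < \<infinity>"
proof -
  obtain c where c: "0 < c" "emeasure lebesgue Q = ennreal c" "Q \<in> sets lebesgue"
    using cubes_measure[OF Q] .
  have "avg Q (\<lambda>x. ennreal (V x)) < top"
  proof (cases "r = 1")
    case True
    then have "A1_bound V L" using L by (simp add: Ap_bound_def)
    then obtain m where "avg Q (\<lambda>x. ennreal (V x)) = ennreal m"
      using A1_bound_cube[OF V _ L(2) Q] by metis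
    then show ?thesis by simp
  next
    case False
    then have "Ap_char r V \<le> ennreal L" using L by (simp add: Ap_bound_def)
    then obtain m where "avg Q (\<lambda>x. ennreal (V x)) = ennreal m"
      using Ap_char_averages[OF V _ _ L(2) Q] False L(3) by (metis order_le_less)
    then show ?thesis by simp
  qed
  then have "avg Q (\<lambda>x. ennreal (V x)) \<noteq> top" by simp
  then show ?thesis unfolding avg_def c(2)
    by (simp_all only: ennreal_divide_eq_top_iff top.not_eq_extremum[symmetric] infinity_ennreal_def) auto
qed

lemma weight_root:
  fixes V :: "real ^ 'n \<Rightarrow> real"
  assumes V: "pos_weight V" and q: "1 \<le> q"
    and loc: "\<And>Q. Q \<in> cubes \<Longrightarrow> (\<integral>\<^sup>+x\<in>Q. ennreal (V x) \<partial>lebesgue) < \<infinity>"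
  shows "weight (\<lambda>x. V x powr (1 / q))"
  unfolding weight_def
proof (intro conjI allI impI)
  fix K :: "(real ^ 'n) set" assume K: "compact K"
  have [measurable]: "V \<in> borel_measurable lebesgue" using V pos_weightD by auto
  have Km [measurable]: "K \<in> sets lebesgue" using compact_imp_closed[OF K] by auto
  have Vp: "0 < V x" for x using V pos_weightD by auto
  obtain B where B: "\<And>x. x \<in> K \<Longrightarrow> norm x \<le> B" using compact_imp_bounded[OF K] by (auto simp: bounded_iff)
  obtain j where j: "B \<le> real j" using real_arch_simple by blast
  have sub: "K \<subseteq> big_cube j" using B j norm_le_big_cube by (meson order_trans subsetI)
  note [measurable] = big_cube(2)[of j]
  have le: "V x powr (1 / q) \<le> 1 + V x" for x
  proof (cases "V x \<le> 1")
    case True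
    then have "V x powr (1 / q) \<le> 1" using Vp[of x] q by (intro powr_le1) auto
    then show ?thesis using Vp[of x] by simp
  next
    case False
    then have "V x powr (1 / q) \<le> V x powr 1" using q by (intro powr_mono) auto
    then show ?thesis using Vp[of x] by simp
  qed
  show "set_integrable lebesgue K (\<lambda>x. V x powr (1 / q))"
    unfolding set_integrable_def
  proof (rule integrableI_bounded)
    have "(\<integral>\<^sup>+x. ennreal (norm (indicat_real K x *\<^sub>R V x powr (1 / q))) \<partial>lebesgue)
        \<le> (\<integral>\<^sup>+x. indicator (big_cube j) x + ennreal (V x) * indicator (big_cube j) x \<partial>lebesgue)"
    proof (intro nn_integral_mono)
      fix x
      show "ennreal (norm (indicat_real K x *\<^sub>R V x powr (1 / q)))
        \<le> indicator (big_cube j) x + ennreal (V x) * indicator (big_cube j) x"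
        using sub ennreal_leI[OF le[of x]] Vp[of x]
        by (auto split: split_indicator)
    qed
    also have "\<dots> = emeasure lebesgue (big_cube j :: (real ^ 'n) set) + (\<integral>\<^sup>+x\<in>big_cube j. ennreal (V x) \<partial>lebesgue)"
      by (subst nn_integral_add) auto
    also have "\<dots> < \<infinity>"
    proof -
      obtain c where "0 < c" "emeasure lebesgue (big_cube j :: (real ^ 'n) set) = ennreal c"
        "(big_cube j :: (real ^ 'n) set) \<in> sets lebesgue"
        using cubes_measure[OF big_cube(1)] .
      then have "emeasure lebesgue (big_cube j :: (real ^ 'n) set) < top" by (simp only: ennreal_less_top)
      then show ?thesis using loc[OF big_cube(1)[of j]]
        unfolding infinity_ennreal_def ennreal_add_less_top by blast
    qed
    finally show "(\<integral>\<^sup>+x. ennreal (norm (indicat_real K x *\<^sub>R V x powr (1 / q))) \<partial>lebesgue) < \<infinity>" .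
  qed measurable
qed simp

lemma root_in_Apq:
  fixes V :: "real ^ 'n \<Rightarrow> real"
  assumes pq: "1 \<le> p" "p \<le> q" and V: "pos_weight V" and L: "Ap_bound (1 + q / conj_exp p) V L" "0 < L"
  shows "(\<lambda>x. V x powr (1 / q)) \<in> Apq p q" "Apq_const p q (\<lambda>x. V x powr (1 / q)) \<le> ennreal L"
proof -
  have Vp: "0 < V x" for x using V pos_weightD by auto
  have r: "1 \<le> 1 + q / conj_exp p" using pq unfolding div_conj_exp by simp
  show le: "Apq_const p q (\<lambda>x. V x powr (1 / q)) \<le> ennreal L"
  proof (cases "p = 1")
    case True
    then have "A1_bound V L" using L by (simp add: Ap_bound_def conj_exp_def)
    have e: "epowr (ennreal (V x powr (1 / q))) q = ennreal (V x)" for x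
      using Vp[of x] pq by (simp add: epowr_ennreal_pos powr_powr)
    have "avg Q (\<lambda>x. ennreal (V x)) \<le> ennreal L * ess_inf Q (\<lambda>x. ennreal (V x))"
      if Q: "Q \<in> cubes" for Q
    proof -
      obtain m where m: "0 < m" "avg Q (\<lambda>x. ennreal (V x)) = ennreal m"
        "AE x in lebesgue. x \<in> Q \<longrightarrow> m / L \<le> V x"
        using A1_bound_cube[OF V \<open>A1_bound V L\<close> L(2) Q] .
      have "ennreal (m / L) \<le> ess_inf Q (\<lambda>x. ennreal (V x))"
        unfolding ess_inf_def using m(3)
        by (intro Sup_upper) (auto elim!: eventually_mono intro: ennreal_leI)
      then have "ennreal L * ennreal (m / L) \<le> ennreal L * ess_inf Q (\<lambda>x. ennreal (V x))"
        by (intro mult_left_mono) auto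
      moreover have "ennreal L * ennreal (m / L) = ennreal m"
        using m L by (simp flip: ennreal_mult)
      ultimately show ?thesis using m by simp
    qed
    then show ?thesis using True by (auto simp: Apq_const_def e intro!: Inf_lower)
  next
    case False
    then have "1 + q / conj_exp p \<noteq> 1" using pq unfolding div_conj_exp by simp
    then have "Ap_char (1 + q / conj_exp p) V \<le> ennreal L" using L by (simp add: Ap_bound_def)
    then show ?thesis using False pq Vp by (subst Apq_const_root) auto
  qed
  have "weight (\<lambda>x. V x powr (1 / q))"
    using pq Ap_bound_local_integral[OF V L r] by (intro weight_root V) auto
  then show "(\<lambda>x. V x powr (1 / q)) \<in> Apq p q"
    using le by (auto simp: Apq_def intro: le_less_trans)
qed

text \<open>If \<open>w\<close> vanished on part of the space only, then some cube would meet both parts in positive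
  measure.  There the average of \<open>w\<^sup>q\<close> is positive and that of \<open>w\<^bsup>-p'\<^esup>\<close> infinite.\<close>

lemma Apq_weight_dichotomy:
  fixes w :: "real ^ 'n \<Rightarrow> real"
  assumes w: "w \<in> Apq p q" and pq: "1 < p" "0 < q"
  shows "(AE x in lebesgue. w x = 0) \<or> (AE x in lebesgue. 0 < w x)"
proof (rule disjCI)
  have wt: "weight w" and fin: "Apq_const p q w < \<infinity>" using w by (auto simp: Apq_def)
  have w0: "0 \<le> w x" for x using wt by (simp add: weight_def)
  have [measurable]: "w \<in> borel_measurable lebesgue" using wt by (rule weight_measurable)
  assume "\<not> (AE x in lebesgue. 0 < w x)"
  then obtain i where i: "\<not> (AE x in lebesgue. x \<in> big_cube i \<longrightarrow> 0 < w x)"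
    using AE_big_cubeI[of "\<lambda>x. 0 < w x"] by auto
  show "AE x in lebesgue. w x = 0"
  proof (rule ccontr)
    assume "\<not> (AE x in lebesgue. w x = 0)"
    then obtain j where j: "\<not> (AE x in lebesgue. x \<in> big_cube j \<longrightarrow> w x = 0)"
      using AE_big_cubeI[of "\<lambda>x. w x = 0"] by auto
    define Q :: "(real ^ 'n) set" where "Q = big_cube (max i j)"
    have Q: "Q \<in> cubes" and [measurable]: "Q \<in> sets lebesgue" unfolding Q_def by (rule big_cube)+
    have sub: "big_cube i \<subseteq> Q" "big_cube j \<subseteq> Q" unfolding Q_def by (auto intro!: big_cube_mono)
    have ij: "\<not> (AE x in lebesgue. x \<in> Q \<longrightarrow> 0 < w x)" "\<not> (AE x in lebesgue. x \<in> Q \<longrightarrow> w x = 0)"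
    proof -
      have mono: "AE x in lebesgue. x \<in> A \<longrightarrow> P x"
        if "A \<subseteq> Q" "AE x in lebesgue. x \<in> Q \<longrightarrow> P x" for A P
        using that by (auto elim!: eventually_mono)
      show "\<not> (AE x in lebesgue. x \<in> Q \<longrightarrow> 0 < w x)"
        using mono[OF sub(1), of "\<lambda>x. 0 < w x"] i by metis
      show "\<not> (AE x in lebesgue. x \<in> Q \<longrightarrow> w x = 0)"
        using mono[OF sub(2), of "\<lambda>x. w x = 0"] j by metis
    qed
    obtain c where c: "0 < c" "emeasure lebesgue Q = ennreal c" "Q \<in> sets lebesgue"
      using cubes_measure[OF Q] .
    have cp: "0 < conj_exp p" using pq by (simp add: conj_exp_def)
    have "(\<integral>\<^sup>+x\<in>Q. epowr (ennreal (w x)) q \<partial>lebesgue) \<noteq> 0"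
    proof
      assume "(\<integral>\<^sup>+x\<in>Q. epowr (ennreal (w x)) q \<partial>lebesgue) = 0"
      then have "AE x in lebesgue. epowr (ennreal (w x)) q * indicator Q x = 0"
        by (subst (asm) nn_integral_0_iff_AE) auto
      then have "AE x in lebesgue. x \<in> Q \<longrightarrow> w x = 0"
      proof eventually_elim
        case (elim x)
        then show ?case using w0[of x] pq by (auto simp: epowr_eq_0_iff ennreal_eq_0_iff)
      qed
      then show False using ij by simp
    qed
    then have 1: "avg Q (\<lambda>x. epowr (ennreal (w x)) q) \<noteq> 0" using c by (simp add: avg_def)
    have "(\<integral>\<^sup>+x\<in>Q. epowr (ennreal (w x)) (- conj_exp p) \<partial>lebesgue) = \<infinity>"
    proof (rule ccontr)
      assume "(\<integral>\<^sup>+x\<in>Q. epowr (ennreal (w x)) (- conj_exp p) \<partial>lebesgue) \<noteq> \<infinity>"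
      then have "AE x in lebesgue. epowr (ennreal (w x)) (- conj_exp p) * indicator Q x \<noteq> \<infinity>"
        by (intro nn_integral_PInf_AE) auto
      then have "AE x in lebesgue. x \<in> Q \<longrightarrow> 0 < w x"
      proof eventually_elim
        case (elim x)
        then show ?case using w0[of x] cp by (cases "w x = 0") (auto simp: epowr_def)
      qed
      then show False using ij by simp
    qed
    then have 2: "avg Q (\<lambda>x. epowr (ennreal (w x)) (- conj_exp p)) = \<infinity>"
      using c by (simp add: avg_def ennreal_top_divide)
    have "avg Q (\<lambda>x. epowr (ennreal (w x)) q) * epowr (avg Q (\<lambda>x. epowr (ennreal (w x)) (- conj_exp p))) (q / conj_exp p)
        \<le> Apq_const p q w"
      using pq by (auto simp: Apq_const_def intro!: SUP_upper Q)
    then show False using fin 1 2 cp pq by (simp add: ennreal_mult_top)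
  qed
qed

lemma Apq_const_cong_AE:
  assumes "AE x in lebesgue. w x = v x" "1 < p"
  shows "Apq_const p q w = Apq_const p q v"
proof -
  have "avg Q (\<lambda>x. epowr (ennreal (w x)) a) = avg Q (\<lambda>x. epowr (ennreal (v x)) a)" for Q a
    unfolding avg_def using assms(1)
    by (intro arg_cong[where f="\<lambda>z. z / _"] nn_integral_cong_AE) (auto elim: eventually_mono)
  then show ?thesis using assms(2) by (simp add: Apq_const_def)
qed

lemma Lp_norm_cong_AE:
  assumes "AE x in lebesgue. f x = g x"
  shows "Lp_norm p f = Lp_norm p g"
  unfolding Lp_norm_def using assms
  by (intro arg_cong[where f="\<lambda>z. epowr z _"] nn_integral_cong_AE) (auto elim: eventually_mono)

lemma Lp_norm_root_weight:
  assumes W: "\<And>x. 0 < W x" and "0 < p" "0 < q"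
  shows "Lp_norm p (\<lambda>x. W x powr (1 / q) *\<^sub>R f x) = wnorm p q W (\<lambda>x. norm (f x))"
  unfolding Lp_norm_def wnorm_def
  using assms by (intro arg_cong[where f="\<lambda>z. epowr z _"] nn_integral_cong)
    (simp add: epowr_ennreal powr_mult powr_powr mult.commute)

lemma Ap_char_pos:
  fixes W :: "real ^ 'n \<Rightarrow> real"
  assumes W: "pos_weight W" and r: "1 < r"
  shows "Ap_char r W \<noteq> 0"
proof
  assume *: "Ap_char r W = 0"
  have Q: "(big_cube 0 :: (real ^ 'n) set) \<in> cubes" by (rule big_cube)
  obtain c where c: "0 < c" "emeasure lebesgue (big_cube 0 :: (real ^ 'n) set) = ennreal c"
    "(big_cube 0 :: (real ^ 'n) set) \<in> sets lebesgue"
    using cubes_measure[OF Q] .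
  have "avg (big_cube 0) (\<lambda>x. ennreal (W x)) * epowr (avg (big_cube 0) (\<lambda>x. ennreal (dual_weight r W x))) (r - 1) \<le> Ap_char r W"
    unfolding Ap_char_def by (rule SUP_upper[OF Q])
  then show False
    using * pos_weight_integral_pos[OF W Q] pos_weight_integral_pos[OF pos_weight_dual[OF W] Q] c r
    by (auto simp: avg_def epowr_eq_0_iff)
qed

text \<open>Reduction of the conclusion to weights that are positive everywhere: a weight that vanishes
  almost everywhere makes the left side zero, and any other one is equal almost everywhere to a
  positive one.\<close>

lemma extrapolate_weights:
  fixes G F :: "real ^ 'n \<Rightarrow> complex"
  assumes pq: "1 < p" "p \<le> q"
    and [measurable]: "F \<in> borel_measurable lebesgue" "G \<in> borel_measurable lebesgue"
    and C: "0 < C"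
    and pos: "\<And>W K. pos_weight W \<Longrightarrow> Ap_char (1 + q / conj_exp p) W \<le> ennreal K \<Longrightarrow> 0 < K \<Longrightarrow>
      wnorm q q W (\<lambda>x. norm (G x)) \<le> ennreal (C * K powr e) * wnorm p q W (\<lambda>x. norm (F x))"
    and w: "w \<in> Apq p q"
  shows "Lp_norm q (\<lambda>x. w x *\<^sub>R G x) \<le> ennreal C * epowr (Apq_const p q w) e * Lp_norm p (\<lambda>x. w x *\<^sub>R F x)"
proof (rule disjE[OF Apq_weight_dichotomy[OF w pq(1)]])
  assume "AE x in lebesgue. w x = 0"
  then have "Lp_norm q (\<lambda>x. w x *\<^sub>R G x) = Lp_norm q (\<lambda>x :: real ^ 'n. 0)"
    by (intro Lp_norm_cong_AE) (auto elim!: eventually_mono)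
  also have "\<dots> = 0" using pq by (simp add: Lp_norm_def)
  finally show ?thesis by simp
next
  assume wpos: "AE x in lebesgue. 0 < w x"
  have [measurable]: "w \<in> borel_measurable lebesgue"
    using w by (auto simp: Apq_def intro: weight_measurable)
  define W where "W x = (if 0 < w x then w x else 1) powr q" for x
  have Wp: "0 < W x" for x by (simp add: W_def)
  have W: "pos_weight W" unfolding pos_weight_def W_def[abs_def] by auto
  have root: "AE x in lebesgue. w x = W x powr (1 / q)"
    using wpos by eventually_elim (use pq in \<open>auto simp: W_def powr_powr\<close>)
  let ?r = "1 + q / conj_exp p"
  have r: "1 < ?r" using pq unfolding div_conj_exp by simp
  have char: "Apq_const p q w = Ap_char ?r W"
    using Apq_const_cong_AE[OF root pq(1)] Apq_const_root[of W p q] Wp pq by simp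
  have "Ap_char ?r W \<noteq> 0" "Ap_char ?r W \<noteq> \<infinity>"
    using Ap_char_pos[OF W r] w char by (auto simp: Apq_def)
  then obtain K where K: "0 < K" "Ap_char ?r W = ennreal K"
    by (cases "Ap_char ?r W" rule: ennreal_zero_top_pos) auto
  have "Lp_norm s (\<lambda>x. w x *\<^sub>R H x) = wnorm s q W (\<lambda>x. norm (H x))" if "0 < s" for s and H :: "real ^ 'n \<Rightarrow> complex"
  proof -
    have "Lp_norm s (\<lambda>x. w x *\<^sub>R H x) = Lp_norm s (\<lambda>x. W x powr (1 / q) *\<^sub>R H x)"
      using root by (intro Lp_norm_cong_AE) (auto elim!: eventually_mono)
    also have "\<dots> = wnorm s q W (\<lambda>x. norm (H x))"
      using Wp pq that by (intro Lp_norm_root_weight) auto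
    finally show ?thesis .
  qed
  then show ?thesis
    using pos[OF W _ K(1)] K C pq unfolding char
    by (simp add: epowr_ennreal_pos ennreal_mult)
qed (use pq in simp)

theorem theorem2p1:
  fixes T :: "(real ^ 'n \<Rightarrow> complex) \<Rightarrow> (real ^ 'n \<Rightarrow> complex)"
    and D :: "(real ^ 'n \<Rightarrow> complex) set"
    and p0 q0 \<gamma> c :: real
  assumes D_measurable: "\<And>f. f \<in> D \<Longrightarrow> f \<in> borel_measurable lebesgue"
    and T_measurable: "\<And>f. f \<in> D \<Longrightarrow> T f \<in> borel_measurable lebesgue"
    and "1 \<le> p0" and "p0 \<le> q0"
    and "0 < \<gamma>" and "0 < c"
    and bound: "\<And>w f. w \<in> Apq p0 q0 \<Longrightarrow> f \<in> D \<Longrightarrow>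
          Lp_norm q0 (\<lambda>x. w x *\<^sub>R T f x)
            \<le> ennreal c * epowr (Apq_const p0 q0 w) \<gamma> * Lp_norm p0 (\<lambda>x. w x *\<^sub>R f x)"
  shows "\<forall>p q :: real. 1 < p \<and> p \<le> q \<and> 1 / p - 1 / q = 1 / p0 - 1 / q0 \<longrightarrow>
          (\<exists>C::real. 0 < C \<and>
            (\<forall>w \<in> Apq p q. \<forall>f \<in> D.
              Lp_norm q (\<lambda>x. w x *\<^sub>R T f x)
                \<le> ennreal C
                    * epowr (Apq_const p q w) (\<gamma> * max 1 (q0 / conj_exp p0 * (conj_exp p / q)))
                    * Lp_norm p (\<lambda>x. w x *\<^sub>R f x)))"
proof (intro allI impI)
  fix p q :: real
  assume "1 < p \<and> p \<le> q \<and> 1 / p - 1 / q = 1 / p0 - 1 / q0"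
  then have pq: "1 < p" "p \<le> q" and rel: "1 / p - 1 / q = 1 / p0 - 1 / q0" by auto
  \<comment> \<open>The common value of \<open>r/q\<close> and \<open>r0/q0\<close>.\<close>
  define s where "s = 1 - (1 / p0 - 1 / q0)"
  have s: "0 < s"
  proof -
    have "1 / p0 \<le> 1" "0 < 1 / q0" using \<open>1 \<le> p0\<close> \<open>p0 \<le> q0\<close> by auto
    then show ?thesis unfolding s_def by linarith
  qed
  have q: "0 < q" "0 < q0" using pq \<open>1 \<le> p0\<close> \<open>p0 \<le> q0\<close> by auto
  define r where "r = 1 + q / conj_exp p"
  define r0 where "r0 = 1 + q0 / conj_exp p0"
  have rs: "r = q * s" unfolding r_def div_conj_exp s_def rel[symmetric] using q by (simp add: field_simps)
  have r0s: "r0 = q0 * s" unfolding r0_def div_conj_exp s_def using q by (simp add: field_simps)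
  have r1: "1 < r" using pq unfolding r_def div_conj_exp by simp
  have r01: "1 \<le> r0" using \<open>1 \<le> p0\<close> \<open>p0 \<le> q0\<close> unfolding r0_def div_conj_exp by simp
  have rr: "r0 = r * q0 / q" using q by (simp add: rs r0s)
  have ex: "q0 / conj_exp p0 * (conj_exp p / q) = (r0 - 1) / (r - 1)"
    by (simp add: r_def r0_def)
  let ?e = "\<gamma> * max 1 (q0 / conj_exp p0 * (conj_exp p / q))"
  have hyp: "wnorm q0 q0 V (\<lambda>x. norm (T f x)) \<le> ennreal (c * L powr \<gamma>) * wnorm p0 q0 V (\<lambda>x. norm (f x))"
    if "f \<in> D" and V: "pos_weight V" and L: "0 < L" "Ap_bound r0 V L" for f V L
  proof -
    have Vp: "0 < V x" for x using V pos_weightD by auto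
    have in_A: "(\<lambda>x. V x powr (1 / q0)) \<in> Apq p0 q0" "Apq_const p0 q0 (\<lambda>x. V x powr (1 / q0)) \<le> ennreal L"
      using root_in_Apq[OF \<open>1 \<le> p0\<close> \<open>p0 \<le> q0\<close> V _ L(1)] L(2) by (auto simp: r0_def)
    have "epowr (Apq_const p0 q0 (\<lambda>x. V x powr (1 / q0))) \<gamma> \<le> ennreal (L powr \<gamma>)"
      using epowr_mono[OF _ in_A(2), of \<gamma>] \<open>0 < \<gamma>\<close> L by (simp add: epowr_ennreal_pos)
    then have "ennreal c * epowr (Apq_const p0 q0 (\<lambda>x. V x powr (1 / q0))) \<gamma> \<le> ennreal (c * L powr \<gamma>)"
      using \<open>0 < c\<close> by (simp add: ennreal_mult mult_left_mono)
    then have "ennreal c * epowr (Apq_const p0 q0 (\<lambda>x. V x powr (1 / q0))) \<gamma> * Lp_norm p0 (\<lambda>x. V x powr (1 / q0) *\<^sub>R f x)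
        \<le> ennreal (c * L powr \<gamma>) * Lp_norm p0 (\<lambda>x. V x powr (1 / q0) *\<^sub>R f x)"
      by (rule mult_right_mono) simp
    with bound[OF in_A(1) \<open>f \<in> D\<close>] show ?thesis
      using Vp q \<open>1 \<le> p0\<close> by (simp add: Lp_norm_root_weight)
  qed
  have meas: "(\<lambda>x. norm (f x)) \<in> borel_measurable lebesgue" "(\<lambda>x. norm (T f x)) \<in> borel_measurable lebesgue"
    if "f \<in> D" for f
    using D_measurable[OF that] T_measurable[OF that] by auto
  have inv_less: "1 / a < 1 / b \<longleftrightarrow> b < a" if "0 < a" "0 < b" for a b :: real
    using that by (simp add: field_simps)
  consider "q = q0" | "q < q0" | "q0 < q" by linarith
  then show "\<exists>C::real. 0 < C \<and> (\<forall>w \<in> Apq p q. \<forall>f \<in> D.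
      Lp_norm q (\<lambda>x. w x *\<^sub>R T f x) \<le> ennreal C * epowr (Apq_const p q w) ?e * Lp_norm p (\<lambda>x. w x *\<^sub>R f x))"
  proof cases
    case 1
    then have "p = p0" using rel by simp
    have "r = r0" using 1 by (simp add: rs r0s)
    then have "?e = \<gamma>" unfolding ex using r1 by simp
    then show ?thesis using bound 1 \<open>p = p0\<close> \<open>0 < c\<close> by (intro exI[of _ c]) auto
  next
    case 2
    have "1 / p0 < 1 / p" using rel inv_less[of q0 q] 2 q by linarith
    then have "p < p0" using inv_less[of p0 p] pq \<open>1 \<le> p0\<close> by simp
    have "r < r0" unfolding rs r0s using 2 s by simp
    have e: "?e = \<gamma> * ((r0 - 1) / (r - 1))" unfolding ex using r1 \<open>r < r0\<close> by (simp add: max_def field_simps)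
    have rel3: "1 / q - 1 / q0 = (r0 - r) / (q0 * r)"
      unfolding rs r0s using q s by (simp add: field_simps)
    let ?C = "c * rdf_const CARD('n) r powr ((r0 - r) * \<gamma>) * 2 powr (r * (1 / q - 1 / q0))"
    have C: "0 < ?C" using rdf_const_pos[OF r1, of "CARD('n)"] \<open>0 < c\<close> by simp
    have "Lp_norm q (\<lambda>x. w x *\<^sub>R T f x) \<le> ennreal ?C * epowr (Apq_const p q w) ?e * Lp_norm p (\<lambda>x. w x *\<^sub>R f x)"
      if "w \<in> Apq p q" "f \<in> D" for w f
    proof (rule extrapolate_weights[OF pq D_measurable[OF \<open>f \<in> D\<close>] T_measurable[OF \<open>f \<in> D\<close>] C _ \<open>w \<in> Apq p q\<close>])
      fix W :: "real ^ 'n \<Rightarrow> real" and K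
      assume W: "pos_weight W" and K: "Ap_char (1 + q / conj_exp p) W \<le> ennreal K" "0 < K"
      have hyp': "wnorm q0 q0 V (\<lambda>x. norm (T f x)) \<le> ennreal (c * L powr \<gamma>) * wnorm p0 q0 V (\<lambda>x. norm (f x))"
        if "pos_weight V" "0 < L" "Ap_char r0 V \<le> ennreal L" for V L
        using hyp[OF \<open>f \<in> D\<close>] that r1 \<open>r < r0\<close> by (simp add: Ap_bound_def)
      show "wnorm q q W (\<lambda>x. norm (T f x)) \<le> ennreal (?C * K powr ?e) * wnorm p q W (\<lambda>x. norm (f x))"
        unfolding e
        by (rule extrapolation_down_total[OF pq(1) \<open>p < p0\<close> q(1) 2 r1 \<open>r < r0\<close> rr rel rel3 W _ K(2)
              meas(1)[OF \<open>f \<in> D\<close>] _ meas(2)[OF \<open>f \<in> D\<close>] _ hyp' \<open>0 < c\<close>])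
          (use K in \<open>auto simp: r_def\<close>)
    qed
    with C show ?thesis by (intro exI[of _ ?C]) blast
  next
    case 3
    have "1 / p < 1 / p0" using rel inv_less[of q q0] 3 q by linarith
    then have "p0 < p" using inv_less[of p p0] pq \<open>1 \<le> p0\<close> by simp
    have "r0 < r" unfolding rs r0s using 3 s by simp
    have e: "?e = \<gamma>" unfolding ex using r1 \<open>r0 < r\<close> by (simp add: max_def field_simps)
    let ?C = "c * rdf_const CARD('n) (r / (r - 1)) powr ((r - r0) / (r - 1) * \<gamma>) * 2 powr (r / (r - 1) * (1 / q0 - 1 / q))"
    have C: "0 < ?C" using rdf_const_pos[of "r / (r - 1)" "CARD('n)"] r1 \<open>0 < c\<close> by simp
    have "Lp_norm q (\<lambda>x. w x *\<^sub>R T f x) \<le> ennreal ?C * epowr (Apq_const p q w) ?e * Lp_norm p (\<lambda>x. w x *\<^sub>R f x)"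
      if "w \<in> Apq p q" "f \<in> D" for w f
    proof (rule extrapolate_weights[OF pq D_measurable[OF \<open>f \<in> D\<close>] T_measurable[OF \<open>f \<in> D\<close>] C _ \<open>w \<in> Apq p q\<close>])
      fix W :: "real ^ 'n \<Rightarrow> real" and K
      assume W: "pos_weight W" and K: "Ap_char (1 + q / conj_exp p) W \<le> ennreal K" "0 < K"
      show "wnorm q q W (\<lambda>x. norm (T f x)) \<le> ennreal (?C * K powr ?e) * wnorm p q W (\<lambda>x. norm (f x))"
        unfolding e
        by (rule extrapolation_up[OF \<open>1 \<le> p0\<close> \<open>p0 < p\<close> q(2) 3 r01 \<open>r0 < r\<close> rr rel W _ K(2)
              meas(1)[OF \<open>f \<in> D\<close>] _ meas(2)[OF \<open>f \<in> D\<close>] _ hyp[OF \<open>f \<in> D\<close>] \<open>0 < c\<close>])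
          (use K in \<open>auto simp: r_def\<close>)
    qed
    with C show ?thesis by (intro exI[of _ ?C]) blast
  qed
qed

end
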